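(* Let $T_A$ be the acyclic (transitive) tournament on $3$ vertices and $T_C$ the cyclic tournament on $3$ vertices. Then the threshold probability for Maker's win in the unbiased $T_A$-tournament game on $\mathcal{G}_{n,p}$ is $n^{-\frac{5}{9}}$, and the threshold probability for Maker's win in the unbiased $T_C$-tournament game on $\mathcal{G}_{n,p}$ is $n^{-\frac{8}{15}}$. That is, for $T\in\{T_A,T_C\}$ with corresponding $p_T=n^{-5/9}$ resp. $p_T=n^{-8/15}$: if $p=\omega(p_T)$ then a.a.s. Maker has a winning strategy in the unbiased $T$-tournament game on $G\sim\mathcal{G}_{n,p}$, and if $p=o(p_T)$ then a.a.s. Breaker has a winning strategy.
   Context: $\mathcal{G}_{n,p}$ denotes the random graph on vertex set $[n]$ in which each edge is present independently with probability $p$. "A.a.s." means with probability tending to $1$ as $n\to\infty$. In the unbiased Maker-Breaker $T$-tournament game on a graph $G$, Maker and Breaker alternately claim one previously unclaimed edge of $G$ each, Maker first, until all edges are claimed; whenever Maker claims an edge she also chooses one of its two orientations. Maker wins if at the end the directed graph of her oriented edges contains a copy of the tournament $T$; otherwise Breaker wins. *)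

theory Defs
  imports "HOL-Probability.Probability" "HOL-Library.Landau_Symbols"
begin

subsection \<open>Binomial random graphs\<close>

text \<open>A graph on the vertex set \<open>{1..n}\<close> is given by its set of edges, each edge being
  a two-element set of vertices.\<close>

definition all_edges :: "nat \<Rightarrow> nat set set" where
  "all_edges n = {e. e \<subseteq> {1..n} \<and> card e = 2}"

definition gnp :: "nat \<Rightarrow> real \<Rightarrow> nat set set pmf" where
  "gnp n p = map_pmf (\<lambda>present. {e \<in> all_edges n. present e})
     (Pi_pmf (all_edges n) False (\<lambda>_. bernoulli_pmf p))"

definition aas :: "(nat \<Rightarrow> real) \<Rightarrow> (nat set set \<Rightarrow> bool) \<Rightarrow> bool" where
  "aas p Q \<longleftrightarrow> (\<lambda>n. measure_pmf.prob (gnp n (p n)) {E. Q E}) \<longlonglongrightarrow> 1"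


subsection \<open>Tournaments\<close>

definition tournament_on :: "'a set \<Rightarrow> 'a rel \<Rightarrow> bool" where
  "tournament_on V T \<longleftrightarrow> T \<subseteq> V \<times> V \<and> irrefl T \<and>
     (\<forall>u\<in>V. \<forall>v\<in>V. u \<noteq> v \<longrightarrow> ((u, v) \<in> T) \<noteq> ((v, u) \<in> T))"

definition T_A :: "nat rel" where
  "T_A = {(0, 1), (1, 2), (0, 2)}"

definition T_C :: "nat rel" where
  "T_C = {(0, 1), (1, 2), (2, 0)}"

lemma tournament_T_A: "tournament_on {0, 1, 2} T_A"
  by (auto simp: tournament_on_def T_A_def irrefl_def)

lemma tournament_T_C: "tournament_on {0, 1, 2} T_C"
  by (auto simp: tournament_on_def T_C_def irrefl_def)

lemma acyclic_T_A: "acyclic T_A"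
proof (rule acyclic_subset)
  show "acyclic {(x, y). x < (y::nat)}"
    using wf_less by (rule wf_acyclic)
qed (auto simp: T_A_def)

lemma not_acyclic_T_C: "\<not> acyclic T_C"
proof -
  have "(0, 1) \<in> T_C" "(1, 2) \<in> T_C" "(2, 0) \<in> T_C"
    by (auto simp: T_C_def)
  then have "(0, 0) \<in> T_C\<^sup>+"
    by (meson trancl.intros)
  then show ?thesis
    by (auto simp: acyclic_def)
qed

text \<open>A tournament on at least two vertices has no isolated vertices, so \<open>Field T\<close> is
  its vertex set.\<close>

definition contains_copy :: "'a rel \<Rightarrow> 'b rel \<Rightarrow> bool" where
  "contains_copy T D \<longleftrightarrow>
     (\<exists>f. inj_on f (Field T) \<and> (\<forall>(u, v) \<in> T. (f u, f v) \<in> D))"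


subsection \<open>The unbiased tournament game\<close>

datatype player = Maker | Breaker

text \<open>Maker's move \<open>Direct u v\<close> claims the edge \<open>{u, v}\<close> and directs it from \<open>u\<close> to \<open>v\<close>.\<close>

datatype game_move = Direct nat nat | Claim "nat set"

fun move_edge :: "game_move \<Rightarrow> nat set" where
  "move_edge (Direct u v) = {u, v}"
| "move_edge (Claim e) = e"

fun mover :: "game_move \<Rightarrow> player" where
  "mover (Direct u v) = Maker"
| "mover (Claim e) = Breaker"

text \<open>A history lists all moves made so far, the earliest move first.\<close>

definition to_move :: "game_move list \<Rightarrow> player" where
  "to_move h = (if even (length h) then Maker else Breaker)"

definition claimed :: "game_move list \<Rightarrow> nat set set" where
  "claimed h = move_edge ` set h"

definition legal_move :: "nat set set \<Rightarrow> game_move list \<Rightarrow> game_move \<Rightarrow> bool" where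
  "legal_move E h m \<longleftrightarrow> mover m = to_move h \<and> move_edge m \<in> E - claimed h"

inductive legal_history :: "nat set set \<Rightarrow> game_move list \<Rightarrow> bool" for E where
  Nil: "legal_history E []"
| snoc: "legal_history E h \<Longrightarrow> legal_move E h m \<Longrightarrow> legal_history E (h @ [m])"

definition finished :: "nat set set \<Rightarrow> game_move list \<Rightarrow> bool" where
  "finished E h \<longleftrightarrow> claimed h = E"

definition maker_digraph :: "game_move list \<Rightarrow> nat rel" where
  "maker_digraph h = {(u, v). Direct u v \<in> set h}"

definition winner :: "'a rel \<Rightarrow> game_move list \<Rightarrow> player" where
  "winner T h = (if contains_copy T (maker_digraph h) then Maker else Breaker)"

type_synonym strategy = "game_move list \<Rightarrow> game_move"

definition follows :: "player \<Rightarrow> strategy \<Rightarrow> game_move list \<Rightarrow> bool" where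
  "follows P \<sigma> h \<longleftrightarrow> (\<forall>i < length h. to_move (take i h) = P \<longrightarrow> h ! i = \<sigma> (take i h))"

text \<open>Besides winning every finished play, a winning strategy has to prescribe a legal move in
  every unfinished play that it can lead to; otherwise getting stuck would count as a win.\<close>

definition winning_strategy ::
    "nat set set \<Rightarrow> 'a rel \<Rightarrow> player \<Rightarrow> strategy \<Rightarrow> bool" where
  "winning_strategy E T P \<sigma> \<longleftrightarrow>
     (\<forall>h. legal_history E h \<longrightarrow> follows P \<sigma> h \<longrightarrow>
        (if finished E h then winner T h = P
         else to_move h = P \<longrightarrow> legal_move E h (\<sigma> h)))"

definition has_winning_strategy :: "player \<Rightarrow> 'a rel \<Rightarrow> nat set set \<Rightarrow> bool" where
  "has_winning_strategy P T E \<longleftrightarrow> (\<exists>\<sigma>. winning_strategy E T P \<sigma>)"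

definition threshold_for_maker_win :: "'a rel \<Rightarrow> (nat \<Rightarrow> real) \<Rightarrow> bool" where
  "threshold_for_maker_win T q \<longleftrightarrow>
     (\<forall>p. (\<forall>n. 0 \<le> p n \<and> p n \<le> 1) \<longrightarrow>
        (p \<in> \<omega>(q) \<longrightarrow> aas p (has_winning_strategy Maker T)) \<and>
        (p \<in> o(q) \<longrightarrow> aas p (has_winning_strategy Breaker T)))"

end

theory Submission
  imports Defs
begin

text \<open>
  For \<open>p\<close> above the threshold the second moment method yields a copy of a fixed balanced graph on
  which Maker wins: \<open>K\<^sub>5\<close> minus an edge (5 vertices, 9 edges) for \<open>T_A\<close>, and two 4-wheels sharing the
  hub and a spoke (8 vertices, 15 edges) for \<open>T_C\<close>. In the latter Maker takes the common spoke and wins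
  by threats in the wheel in which Breaker does not answer.

  Below the threshold, a.a.s. every subgraph with boundedly many vertices has fewer than \<open>9/5\<close> (resp.
  \<open>15/8\<close>) edges per vertex. Breaker can play separately on edge sets that share no triangle, and he
  can pair the edges at a vertex of degree at most 2. What remains are triangle-connected graphs of
  minimum degree 3 (cores). Growing a core triangle by triangle bounds the number \<open>v\<close> of its vertices,
  and then the density forces at most \<open>2v - 2\<close> edges or, for \<open>T_C\<close> only, \<open>2v - 1\<close> edges with
  \<open>v \<le> 7\<close>. In the first case the core is \<open>K\<^sub>4\<close>, where Breaker wins directly, or it is a 2-tree plus an
  edge, and its edges can be paired so that every triangle contains a pair. The cores of the second
  kind are enumerated up to isomorphism, and on each of them Breaker wins the \<open>T_C\<close>-game by an explicit
  strategy that is checked by evaluation; here the orientations matter, since Maker can get a triangle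
  on some of these graphs.
\<close>

subsection \<open>Winning positions\<close>

text \<open>Both thresholds are n^(-v/e) for a graph with e = 2v - 1 edges: v = 5 for
  \<open>T_A\<close> and v = 8 for \<open>T_C\<close>. The quantity behind Breaker's half is the
  excess e - 2v. It is -3 for a single edge, and attaching a triangle to an edge that is already
  present never lowers it. Minimum degree 3 makes the excess of a core strictly larger than that of
  each of its nonempty proper parts, so it is at least -2. An excess of 0 or more means density at
  least 2, which is too dense. Excess -1 means density 2 - 1/v, which is below 9/5 only for v < 5
  and below 15/8 only for v < 8. On at most four vertices it cannot occur, so it never arises for
  \<open>T_A\<close>; for \<open>T_C\<close> the orders 5, 6 and 7 remain. The smallest of these
  cores is \<open>K5\<close> minus an edge, the very graph on which Maker wins with transitive
  triangles. The vertex numbers 15 and 24 in the density conditions are the points where 2m - 3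
  edges on m vertices reach density 9/5 and 15/8.\<close>

definition undir :: "nat \<times> nat \<Rightarrow> nat set" where
  "undir a = {fst a, snd a}"

lemma undir_pair [simp]: "undir (u, v) = {u, v}"
  by (simp add: undir_def)

text \<open>Both predicates describe positions with Maker to move, \<open>D\<close> being her digraph and \<open>F\<close> the
  set of unclaimed edges. Breaker's reply \<open>e\<close> need not be an unclaimed edge: passing never helps
  him, and allowing it makes \<open>breaker_wins\<close> antimonotone in \<open>F\<close>.\<close>

inductive breaker_wins :: "(nat rel \<Rightarrow> bool) \<Rightarrow> nat rel \<Rightarrow> nat set set \<Rightarrow> bool" for W where
  breaker_winsI: "\<not> W D \<Longrightarrow>
     (\<And>a. undir a \<in> F \<Longrightarrow> \<exists>e. breaker_wins W (insert a D) (F - {undir a} - {e})) \<Longrightarrow>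
     breaker_wins W D F"

inductive maker_wins :: "(nat rel \<Rightarrow> bool) \<Rightarrow> nat rel \<Rightarrow> nat set set \<Rightarrow> bool" for W where
  maker_wins_done: "W D \<Longrightarrow> maker_wins W D F"
| maker_wins_move: "undir a \<in> F \<Longrightarrow>
     (\<And>e. maker_wins W (insert a D) (F - {undir a} - {e})) \<Longrightarrow> maker_wins W D F"

lemma breaker_wins_not_goal: "breaker_wins W D F \<Longrightarrow> \<not> W D"
  by (erule breaker_wins.cases) blast

lemma breaker_wins_reply:
  "breaker_wins W D F \<Longrightarrow> undir a \<in> F \<Longrightarrow>
     \<exists>e. breaker_wins W (insert a D) (F - {undir a} - {e})"
  by (erule breaker_wins.cases) blast

lemma breaker_wins_subset:
  "breaker_wins W D F \<Longrightarrow> F' \<subseteq> F \<Longrightarrow> breaker_wins W D F'"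
proof (induction arbitrary: F' rule: breaker_wins.induct)
  case (breaker_winsI D F)
  show ?case
  proof (rule breaker_wins.intros)
    show "\<not> W D" by fact
    fix a assume "undir a \<in> F'"
    with breaker_winsI.prems breaker_winsI.IH[of a] obtain e where
      e: "\<And>F'. F' \<subseteq> F - {undir a} - {e} \<Longrightarrow> breaker_wins W (insert a D) F'"
      by blast
    have "F' - {undir a} - {e} \<subseteq> F - {undir a} - {e}"
      using breaker_winsI.prems by blast
    from e[OF this] show "\<exists>e. breaker_wins W (insert a D) (F' - {undir a} - {e})" ..
  qed
qed

lemma breaker_wins_weaken:
  assumes "breaker_wins W D F" and "\<And>D. W' D \<Longrightarrow> W D"
  shows "breaker_wins W' D F"
  using assms(1)
proof induction
  case (breaker_winsI D F)
  then show ?case using assms(2) by (metis breaker_wins.intros)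
qed

lemma maker_wins_empty: "maker_wins W D {} \<Longrightarrow> W D"
  by (erule maker_wins.cases) auto

section \<open>From winning positions to strategies on histories\<close>

lemma legal_history_claimed: "legal_history E h \<Longrightarrow> claimed h \<subseteq> E"
  by (induction rule: legal_history.induct) (auto simp: claimed_def legal_move_def)

lemma claimed_snoc: "claimed (h @ [m]) = insert (move_edge m) (claimed h)"
  by (auto simp: claimed_def)

lemma maker_digraph_snoc_Direct: "maker_digraph (h @ [Direct u v]) = insert (u, v) (maker_digraph h)"
  by (auto simp: maker_digraph_def)

lemma maker_digraph_snoc_Claim: "maker_digraph (h @ [Claim e]) = maker_digraph h"
  by (auto simp: maker_digraph_def)

lemma to_move_snoc: "to_move (h @ [m]) = (if to_move h = Maker then Breaker else Maker)"
  by (auto simp: to_move_def)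

lemma follows_snocD:
  assumes "follows P \<sigma> (h @ [m])"
  shows "follows P \<sigma> h" and "to_move h = P \<Longrightarrow> m = \<sigma> h"
proof -
  show "follows P \<sigma> h" unfolding follows_def
  proof safe
    fix i assume i: "i < length h" "P = to_move (take i h)"
    have "take i (h @ [m]) = take i h" "(h @ [m]) ! i = h ! i"
      using i by (auto simp: nth_append)
    with i assms show "h ! i = \<sigma> (take i h)"
      unfolding follows_def by (metis length_append_singleton less_SucI)
  qed
  show "m = \<sigma> h" if "to_move h = P"
    using assms that unfolding follows_def
    by (metis append_eq_conv_conj length_append_singleton lessI nth_append_length)
qed

lemma mover_cases:
  "mover m = Maker \<Longrightarrow> \<exists>u v. m = Direct u v" "mover m = Breaker \<Longrightarrow> \<exists>e. m = Claim e"
  by (cases m; simp)+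

lemma player_neq: "p \<noteq> Maker \<longleftrightarrow> p = Breaker" "p \<noteq> Breaker \<longleftrightarrow> p = Maker"
  by (cases p; simp)+

lemma claimed_Nil: "claimed [] = {}" and maker_digraph_Nil: "maker_digraph [] = {}"
  and to_move_Nil: "to_move [] = Maker"
  by (auto simp: claimed_def maker_digraph_def to_move_def)

text \<open>The invariant is that the current position is won, up to one reply still owed when
  Breaker is to move. A winning position may ask for a pass, which the rules forbid; any unclaimed
  edge will do instead, since \<open>breaker_wins\<close> is antimonotone in the set of unclaimed
  edges.\<close>

theorem breaker_wins_strategy:
  assumes win: "breaker_wins (contains_copy T) {} E"
  shows "has_winning_strategy Breaker T E"
proof -
  define W :: "nat rel \<Rightarrow> bool" where "W = contains_copy T"
  define ok where "ok h e \<longleftrightarrow> e \<in> E - claimed h \<and>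
      breaker_wins W (maker_digraph h) (E - claimed h - {e})" for h e
  define \<sigma> where "\<sigma> h = Claim (SOME e. ok h e)" for h
  have ok_ex: "\<exists>e. ok h e"
    if "breaker_wins W (maker_digraph h) (E - claimed h - {e})" "E - claimed h \<noteq> {}" for h e
  proof (cases "e \<in> E - claimed h")
    case False
    from that(2) obtain e' where "e' \<in> E - claimed h" by blast
    moreover have "breaker_wins W (maker_digraph h) (E - claimed h - {e'})"
      using False that(1) by (elim breaker_wins_subset) blast
    ultimately show ?thesis unfolding ok_def by blast
  qed (use that in \<open>auto simp: ok_def\<close>)
  have inv: "if to_move h = Maker then breaker_wins W (maker_digraph h) (E - claimed h)
       else \<exists>e. breaker_wins W (maker_digraph h) (E - claimed h - {e})"
    if "legal_history E h" "follows Breaker \<sigma> h" for h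
    using that
  proof (induction rule: legal_history.induct)
    case Nil
    then show ?case using win by (simp add: claimed_Nil maker_digraph_Nil to_move_Nil W_def)
  next
    case (snoc h m)
    have fol: "follows Breaker \<sigma> h" "to_move h = Breaker \<Longrightarrow> m = \<sigma> h"
      using follows_snocD[OF snoc.prems] by blast+
    note IH = snoc.IH[OF fol(1)]
    show ?case
    proof (cases "to_move h = Maker")
      case True
      with snoc.hyps(2) obtain u v where m: "m = Direct u v" "{u, v} \<in> E - claimed h"
        unfolding legal_move_def by (metis mover_cases(1) move_edge.simps(1))
      have "breaker_wins W (maker_digraph h) (E - claimed h)" using IH True by simp
      from breaker_wins_reply[OF this, of "(u, v)"] m(2)
      obtain e where "breaker_wins W (insert (u, v) (maker_digraph h)) (E - claimed h - {{u, v}} - {e})"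
        by auto
      moreover have "E - claimed h - {{u, v}} = E - insert {u, v} (claimed h)" by blast
      ultimately show ?thesis
        using True m(1) by (auto simp: to_move_snoc maker_digraph_snoc_Direct claimed_snoc)
    next
      case False
      then have B: "to_move h = Breaker" by (simp add: player_neq)
      have ne: "E - claimed h \<noteq> {}" using snoc.hyps(2) unfolding legal_move_def by blast
      obtain e where "breaker_wins W (maker_digraph h) (E - claimed h - {e})"
        using IH False by auto
      from someI_ex[OF ok_ex[OF this ne]] have "ok h (SOME e. ok h e)" .
      moreover have "m = Claim (SOME e. ok h e)" using fol(2)[OF B] by (simp add: \<sigma>_def)
      moreover have "E - claimed h - {e} = E - insert e (claimed h)" for e by blast
      ultimately show ?thesis
        using B by (auto simp: to_move_snoc maker_digraph_snoc_Claim claimed_snoc ok_def)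
    qed
  qed
  have "winning_strategy E T Breaker \<sigma>" unfolding winning_strategy_def
  proof (intro allI impI)
    fix h assume h: "legal_history E h" "follows Breaker \<sigma> h"
    note i = inv[OF h]
    show "if finished E h then winner T h = Breaker
          else to_move h = Breaker \<longrightarrow> legal_move E h (\<sigma> h)"
    proof (cases "finished E h")
      case True
      have "\<not> W (maker_digraph h)" using i breaker_wins_not_goal by (auto split: if_splits)
      then show ?thesis using True by (simp add: winner_def W_def)
    next
      case False
      then have ne: "E - claimed h \<noteq> {}"
        using legal_history_claimed[OF h(1)] by (auto simp: finished_def)
      show ?thesis
      proof (cases "to_move h = Breaker")
        case True
        then obtain e where "breaker_wins W (maker_digraph h) (E - claimed h - {e})"
          using i by auto
        from someI_ex[OF ok_ex[OF this ne]] True False show ?thesis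
          by (simp add: legal_move_def \<sigma>_def ok_def)
      qed (use False in simp)
    qed
  qed
  then show ?thesis unfolding has_winning_strategy_def by blast
qed

lemma contains_copy_mono: "contains_copy T D \<Longrightarrow> D \<subseteq> D' \<Longrightarrow> contains_copy T D'"
  unfolding contains_copy_def by fast

text \<open>Once the goal is reached, legal moves are still due until the board is full; hence the
  fallback of \<open>pick\<close> to an arbitrary unclaimed edge. It can be directed because every
  edge has two ends.\<close>

theorem maker_wins_strategy:
  assumes win: "maker_wins (contains_copy T) {} E" and E: "\<And>e. e \<in> E \<Longrightarrow> card e = 2"
  shows "has_winning_strategy Maker T E"
proof -
  define W :: "nat rel \<Rightarrow> bool" where "W = contains_copy T"
  have mono: "W (insert a D)" if "W D" for a D
    using that contains_copy_mono unfolding W_def by blast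
  define ok where "ok h a \<longleftrightarrow> undir a \<in> E - claimed h \<and>
      (\<forall>e. maker_wins W (insert a (maker_digraph h)) (E - claimed h - {undir a} - {e}))" for h a
  define pick where "pick h = (if \<exists>a. ok h a then SOME a. ok h a
      else SOME a. undir a \<in> E - claimed h)" for h
  define \<sigma> where "\<sigma> h = Direct (fst (pick h)) (snd (pick h))" for h
  have pick_ok: "ok h (pick h)" if "\<exists>a. ok h a" for h
    using someI_ex[OF that] that by (simp add: pick_def)
  have pick_edge: "undir (pick h) \<in> E - claimed h" if "E - claimed h \<noteq> {}" for h
  proof (cases "\<exists>a. ok h a")
    case True
    from pick_ok[OF this] show ?thesis by (simp add: ok_def)
  next
    case False
    from that obtain e where e: "e \<in> E - claimed h" by blast
    with E have "card e = 2" by blast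
    then obtain u v where "e = {u, v}" by (auto simp: card_2_iff)
    with e have "\<exists>a. undir a \<in> E - claimed h" by (intro exI[of _ "(u, v)"]) simp
    from someI_ex[OF this] False show ?thesis by (simp add: pick_def)
  qed
  have inv: "if to_move h = Maker then maker_wins W (maker_digraph h) (E - claimed h)
       else \<forall>e. maker_wins W (maker_digraph h) (E - claimed h - {e})"
    if "legal_history E h" "follows Maker \<sigma> h" for h
    using that
  proof (induction rule: legal_history.induct)
    case Nil
    then show ?case using win by (simp add: claimed_Nil maker_digraph_Nil to_move_Nil W_def)
  next
    case (snoc h m)
    have fol: "follows Maker \<sigma> h" "to_move h = Maker \<Longrightarrow> m = \<sigma> h"
      using follows_snocD[OF snoc.prems] by blast+
    note IH = snoc.IH[OF fol(1)]
    show ?case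
    proof (cases "to_move h = Maker")
      case True
      define a where "a = pick h"
      have m: "m = Direct (fst a) (snd a)" using fol(2)[OF True] by (simp add: \<sigma>_def a_def)
      have eq: "E - claimed h - {undir a} - {e} = E - insert {fst a, snd a} (claimed h) - {e}" for e
        by (auto simp: undir_def)
      have "maker_wins W (insert a (maker_digraph h)) (E - claimed h - {undir a} - {e})" for e
      proof (cases "\<exists>a. ok h a")
        case True
        from pick_ok[OF this] show ?thesis by (simp add: a_def ok_def)
      next
        case False
        have "maker_wins W (maker_digraph h) (E - claimed h)" using IH True by simp
        \<comment> \<open>Without a good move the position can only be won because the goal is
          already reached, and a reached goal persists.\<close>
        then have "W (maker_digraph h)"
        proof cases
          case (maker_wins_move a)
          then have "ok h a" unfolding ok_def by blast
          with False show ?thesis by blast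
        qed
        then show ?thesis by (intro maker_wins_done mono)
      qed
      then show ?thesis
        using True unfolding eq m by (auto simp: to_move_snoc maker_digraph_snoc_Direct claimed_snoc)
    next
      case False
      then have B: "to_move h = Breaker" by (simp add: player_neq)
      with snoc.hyps(2) obtain e where "m = Claim e"
        unfolding legal_move_def by (metis mover_cases(2))
      moreover have "E - claimed h - {e} = E - insert e (claimed h)" for e by blast
      ultimately show ?thesis
        using B IH by (auto simp: to_move_snoc maker_digraph_snoc_Claim claimed_snoc)
    qed
  qed
  have "winning_strategy E T Maker \<sigma>" unfolding winning_strategy_def
  proof (intro allI impI)
    fix h assume h: "legal_history E h" "follows Maker \<sigma> h"
    note i = inv[OF h]
    show "if finished E h then winner T h = Maker
          else to_move h = Maker \<longrightarrow> legal_move E h (\<sigma> h)"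
    proof (cases "finished E h")
      case True
      then have "claimed h = E" by (simp add: finished_def)
      then have "maker_wins W (maker_digraph h) {}" using i by (auto split: if_splits)
      then have "W (maker_digraph h)" by (rule maker_wins_empty)
      then show ?thesis using True by (simp add: winner_def W_def)
    next
      case False
      then have "E - claimed h \<noteq> {}"
        using legal_history_claimed[OF h(1)] by (auto simp: finished_def)
      from pick_edge[OF this] False show ?thesis
        by (simp add: legal_move_def \<sigma>_def undir_def)
    qed
  qed
  then show ?thesis unfolding has_winning_strategy_def by blast
qed

section \<open>Play on several boards and pairing strategies\<close>

text \<open>Breaker answers on the board where Maker has just moved. The condition on the goals
  concerns only digraphs \<open>X\<close> and \<open>Y\<close> that can arise on the two boards from
  the current position, so it is inherited by the smaller positions of the induction.\<close>

lemma breaker_wins_union: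
  assumes "finite F1" "finite F2" "breaker_wins W1 D1 F1" "breaker_wins W2 D2 F2" "F1 \<inter> F2 = {}"
    and "\<And>X Y. D1 \<subseteq> X \<Longrightarrow> undir ` (X - D1) \<subseteq> F1 \<Longrightarrow> D2 \<subseteq> Y \<Longrightarrow> undir ` (Y - D2) \<subseteq> F2 \<Longrightarrow>
      W (X \<union> Y) \<Longrightarrow> W1 X \<or> W2 Y"
  shows "breaker_wins W (D1 \<union> D2) (F1 \<union> F2)"
  using assms
proof (induction "card F1 + card F2" arbitrary: F1 F2 D1 D2 rule: less_induct)
  case less
  note [simp] = less.prems(1,2)
  show ?case
  proof (rule breaker_winsI)
    show "\<not> W (D1 \<union> D2)"
      using less.prems(6)[of D1 D2] less.prems(3,4) breaker_wins_not_goal by auto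
    fix a assume "undir a \<in> F1 \<union> F2"
    then show "\<exists>e. breaker_wins W (insert a (D1 \<union> D2)) (F1 \<union> F2 - {undir a} - {e})"
    proof
      assume a: "undir a \<in> F1"
      from breaker_wins_reply[OF less.prems(3) a]
      obtain e where e: "breaker_wins W1 (insert a D1) (F1 - {undir a} - {e})" ..
      have c: "card (F1 - {undir a} - {e}) < card F1"
        using a by (intro psubset_card_mono) auto
      have "breaker_wins W (insert a D1 \<union> D2) ((F1 - {undir a} - {e}) \<union> F2)"
      proof (rule less.hyps[OF _ _ _ e less.prems(4)])
        show "(F1 - {undir a} - {e}) \<inter> F2 = {}" using less.prems(5) by blast
        fix X Y
        assume X: "insert a D1 \<subseteq> X" "undir ` (X - insert a D1) \<subseteq> F1 - {undir a} - {e}"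
          and Y: "D2 \<subseteq> Y" "undir ` (Y - D2) \<subseteq> F2" "W (X \<union> Y)"
        have "undir ` (X - D1) \<subseteq> F1" using X a by blast
        then show "W1 X \<or> W2 Y" using less.prems(6)[of X Y] X Y by blast
      qed (use c in auto)
      \<comment> \<open>The prescribed reply may lie outside \<open>F1\<close>. It is then replaced
        by a pass, naming the edge that Maker has just taken, so that \<open>F2\<close> stays
        intact.\<close>
      moreover have "F1 \<union> F2 - {undir a} - {if e \<in> F1 then e else undir a}
          = (F1 - {undir a} - {e}) \<union> F2"
        using a less.prems(5) by (auto split: if_splits)
      ultimately show ?thesis by (metis Un_insert_left)
    next
      assume a: "undir a \<in> F2"
      from breaker_wins_reply[OF less.prems(4) a]
      obtain e where e: "breaker_wins W2 (insert a D2) (F2 - {undir a} - {e})" ..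
      have c: "card (F2 - {undir a} - {e}) < card F2"
        using a by (intro psubset_card_mono) auto
      have "breaker_wins W (D1 \<union> insert a D2) (F1 \<union> (F2 - {undir a} - {e}))"
      proof (rule less.hyps[OF _ _ _ less.prems(3) e])
        show "F1 \<inter> (F2 - {undir a} - {e}) = {}" using less.prems(5) by blast
        fix X Y
        assume X: "D1 \<subseteq> X" "undir ` (X - D1) \<subseteq> F1"
          and Y: "insert a D2 \<subseteq> Y" "undir ` (Y - insert a D2) \<subseteq> F2 - {undir a} - {e}" "W (X \<union> Y)"
        have "undir ` (Y - D2) \<subseteq> F2" using Y a by blast
        then show "W1 X \<or> W2 Y" using less.prems(6)[of X Y] X Y by blast
      qed (use c in auto)
      moreover have "F1 \<union> F2 - {undir a} - {if e \<in> F2 then e else undir a}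
          = F1 \<union> (F2 - {undir a} - {e})"
        using a less.prems(5) by (auto split: if_splits)
      ultimately show ?thesis by (metis Un_insert_right)
    qed
  qed
qed

definition disjoint_pairs :: "'a set set \<Rightarrow> bool" where
  "disjoint_pairs P \<longleftrightarrow> (\<forall>p\<in>P. card p = 2) \<and> (\<forall>p\<in>P. \<forall>q\<in>P. p \<noteq> q \<longrightarrow> p \<inter> q = {})"

text \<open>The invariant says that each pair is either untouched by Maker or contains an edge that
  she neither owns nor can still get. A general \<open>D\<close> serves positions in which Maker has
  already moved.\<close>

lemma breaker_wins_pairs_aux:
  assumes "disjoint_pairs P" "finite Q"
    and "\<And>p. p \<in> P \<Longrightarrow> p \<inter> undir ` D = {} \<or> \<not> p \<subseteq> undir ` D \<union> Q"
  shows "breaker_wins (\<lambda>Y. \<exists>p\<in>P. p \<subseteq> undir ` Y) D Q"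
  using assms(2,3)
proof (induction "card Q" arbitrary: D Q rule: less_induct)
  case less
  show ?case
  proof (rule breaker_winsI)
    show "\<not> (\<exists>p\<in>P. p \<subseteq> undir ` D)"
    proof
      assume "\<exists>p\<in>P. p \<subseteq> undir ` D"
      then obtain p where p: "p \<in> P" "p \<subseteq> undir ` D" by blast
      moreover have "p \<noteq> {}" using p(1) assms(1) by (auto simp: disjoint_pairs_def)
      ultimately show False using less.prems(2)[of p] by blast
    qed
    fix a assume a: "undir a \<in> Q"
    \<comment> \<open>After \<open>a\<close> and the answer \<open>f\<close>, Maker owns or can get
      the same edges as before except \<open>f\<close>, provided \<open>f\<close> is not hers
      already.\<close>
    have step: "breaker_wins (\<lambda>Y. \<exists>p\<in>P. p \<subseteq> undir ` Y) (insert a D) (Q - {undir a} - {f})"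
      if "\<And>p. p \<in> P \<Longrightarrow> p \<inter> insert (undir a) (undir ` D) = {} \<or>
           \<not> p \<subseteq> undir ` D \<union> Q - ({f} - {undir a} - undir ` D)" for f
    proof (rule less.hyps)
      show "card (Q - {undir a} - {f}) < card Q"
        using a less.prems(1) by (intro psubset_card_mono) auto
      fix p assume "p \<in> P"
      from that[OF this] a show "p \<inter> undir ` insert a D = {} \<or>
         \<not> p \<subseteq> undir ` insert a D \<union> (Q - {undir a} - {f})"
        by auto
    qed (use less.prems(1) in simp)
    show "\<exists>e. breaker_wins (\<lambda>Y. \<exists>p\<in>P. p \<subseteq> undir ` Y) (insert a D) (Q - {undir a} - {e})"
    proof (cases "\<exists>p\<in>P. undir a \<in> p \<and> p \<inter> undir ` D = {}")
      case True
      then obtain p where p: "p \<in> P" "undir a \<in> p" "p \<inter> undir ` D = {}" by blast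
      then obtain f where f: "p = {undir a, f}" "f \<noteq> undir a"
        using assms(1) unfolding disjoint_pairs_def
        by (metis card_2_iff doubleton_eq_iff insert_iff singletonD)
      show ?thesis
      proof (intro exI[of _ f] step)
        fix q assume q: "q \<in> P"
        show "q \<inter> insert (undir a) (undir ` D) = {} \<or>
           \<not> q \<subseteq> undir ` D \<union> Q - ({f} - {undir a} - undir ` D)"
        proof (cases "q = p")
          case True
          then show ?thesis using f p(3) by auto
        next
          case False
          then have "q \<inter> p = {}" using assms(1) p(1) q by (auto simp: disjoint_pairs_def)
          then show ?thesis using less.prems(2)[OF q] p(2) by auto
        qed
      qed
    next
      \<comment> \<open>No untouched pair contains the new edge, so a pass keeps the
        invariant.\<close>
      case False
      show ?thesis
      proof (intro exI[of _ "undir a"] step)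
        fix q assume q: "q \<in> P"
        show "q \<inter> insert (undir a) (undir ` D) = {} \<or>
           \<not> q \<subseteq> undir ` D \<union> Q - ({undir a} - {undir a} - undir ` D)"
          using less.prems(2)[OF q] False q by auto
      qed
    qed
  qed
qed

lemma breaker_wins_pairs:
  assumes "disjoint_pairs P" "finite Q"
  shows "breaker_wins (\<lambda>Y. \<exists>p\<in>P. p \<subseteq> undir ` Y) {} Q"
  using assms by (intro breaker_wins_pairs_aux) auto

text \<open>Unlike \<open>breaker_wins_weaken\<close>, this compares the goals only on digraphs that
  can still arise from the position. It is the union lemma with an empty first board.\<close>

lemma breaker_wins_restrict:
  assumes "finite F" "breaker_wins W' D F"
    and "\<And>Y. D \<subseteq> Y \<Longrightarrow> undir ` (Y - D) \<subseteq> F \<Longrightarrow> W Y \<Longrightarrow> W' Y"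
  shows "breaker_wins W D F"
proof -
  have "breaker_wins (\<lambda>_. False) {} {}" by (rule breaker_winsI) auto
  from breaker_wins_union[OF _ assms(1) this assms(2), of W] assms(3)
  show ?thesis by simp
qed

subsection \<open>Triangle-connected cores\<close>

definition graph :: "nat set set \<Rightarrow> bool" where
  "graph E \<longleftrightarrow> finite E \<and> (\<forall>e\<in>E. card e = 2)"

definition triangle :: "nat set set \<Rightarrow> bool" where
  "triangle t \<longleftrightarrow> (\<exists>a b c. a \<noteq> b \<and> b \<noteq> c \<and> a \<noteq> c \<and> t = {{a, b}, {b, c}, {a, c}})"

definition edges_at :: "nat set set \<Rightarrow> nat \<Rightarrow> nat set set" where
  "edges_at E x = {e \<in> E. x \<in> e}"

text \<open>Connectivity of the auxiliary graph on the edges of \<open>E\<close> in which two edges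
  are adjacent if a triangle of \<open>E\<close> contains both. In this cut form a failure directly
  yields two boards for Breaker, and success yields a triangle along which a proper part can
  grow.\<close>

definition triangle_connected :: "nat set set \<Rightarrow> bool" where
  "triangle_connected E \<longleftrightarrow>
     (\<forall>S. S \<subset> E \<longrightarrow> S \<noteq> {} \<longrightarrow> (\<exists>t. triangle t \<and> t \<subseteq> E \<and> t \<inter> S \<noteq> {} \<and> \<not> t \<subseteq> S))"

definition core :: "nat set set \<Rightarrow> bool" where
  "core E \<longleftrightarrow> graph E \<and> E \<noteq> {} \<and> triangle_connected E \<and>
     (\<forall>e\<in>E. \<exists>t. triangle t \<and> t \<subseteq> E \<and> e \<in> t) \<and> (\<forall>x\<in>\<Union>E. 3 \<le> card (edges_at E x))"

text \<open>Forgetting the orientations can only help Maker, so a win for Breaker against this goal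
  is a win in both tournament games.\<close>

definition triangle_goal :: "nat rel \<Rightarrow> bool" where
  "triangle_goal D \<longleftrightarrow> (\<exists>t. triangle t \<and> t \<subseteq> undir ` D)"

text \<open>Positions on edge-disjoint boards can be treated separately if every winning digraph of Maker
  already wins on a single triangle.\<close>

definition local_goal :: "(nat rel \<Rightarrow> bool) \<Rightarrow> bool" where
  "local_goal W \<longleftrightarrow> (\<forall>D. W D \<longrightarrow> (\<exists>t. triangle t \<and> t \<subseteq> undir ` D \<and>
     (\<forall>D'. {a \<in> D. undir a \<in> t} \<subseteq> D' \<longrightarrow> W D')))"

lemma graph_subset: "graph E \<Longrightarrow> F \<subseteq> E \<Longrightarrow> graph F"
  by (auto simp: graph_def intro: finite_subset)

lemma graph_finite_vertices: "graph E \<Longrightarrow> finite (\<Union>E)"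
  by (metis card.infinite finite_Union graph_def zero_neq_numeral)

lemma graph_edgeE:
  assumes "graph E" "e \<in> E"
  obtains a b where "e = {a, b}" "a \<noteq> b"
  using assms by (metis graph_def card_2_iff)

lemma triangle_edgeE:
  assumes "triangle t" "e \<in> t"
  obtains a b c where "a \<noteq> b" "b \<noteq> c" "a \<noteq> c" "e = {a, b}" "t = {{a, b}, {b, c}, {a, c}}"
proof -
  obtain x y z where t: "x \<noteq> y" "y \<noteq> z" "x \<noteq> z" "t = {{x, y}, {y, z}, {x, z}}"
    using assms(1) by (auto simp: triangle_def)
  consider "e = {x, y}" | "e = {y, z}" | "e = {x, z}" using assms(2) t(4) by blast
  then show thesis
  proof cases
    case 1 with t show thesis by (intro that[of x y z]) auto
  next
    case 2 with t show thesis by (intro that[of y z x]) (auto simp: insert_commute)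
  next
    case 3 with t show thesis by (intro that[of x z y]) (auto simp: insert_commute)
  qed
qed

lemma triangle_edge_thirdE:
  assumes "triangle t" "{x, y} \<in> t"
  obtains z where "z \<noteq> x" "z \<noteq> y" "x \<noteq> y" "t = {{x, y}, {y, z}, {x, z}}"
proof -
  obtain a b c where "a \<noteq> b" "b \<noteq> c" "a \<noteq> c" "{x, y} = {a, b}" "t = {{a, b}, {b, c}, {a, c}}"
    using triangle_edgeE[OF assms] by metis
  then show thesis by (intro that[of c]) (auto simp: doubleton_eq_iff insert_commute)
qed

lemma triangle_card: "triangle t \<Longrightarrow> card t = 3"
  by (auto simp: triangle_def doubleton_eq_iff card_insert_if)

lemma triangle_nonempty: "triangle t \<Longrightarrow> t \<noteq> {}"
  by (auto simp: triangle_def)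

lemma triangle_two_edges:
  assumes "triangle t" "x \<in> e" "e \<in> t"
  obtains f where "f \<in> t" "f \<noteq> e" "x \<in> f"
proof -
  obtain a b c where "a \<noteq> b" "b \<noteq> c" "a \<noteq> c" "e = {a, b}" "t = {{a, b}, {b, c}, {a, c}}"
    using triangle_edgeE[OF assms(1,3)] by metis
  then show thesis using assms(2) that[of "{a, c}"] that[of "{b, c}"]
    by (auto simp: doubleton_eq_iff)
qed

lemma local_goalE:
  assumes "local_goal W" "W D"
  obtains t where "triangle t" "t \<subseteq> undir ` D" "\<forall>D'. {a \<in> D. undir a \<in> t} \<subseteq> D' \<longrightarrow> W D'"
  using assms unfolding local_goal_def by metis

lemma local_goal_triangle: "local_goal W \<Longrightarrow> W D \<Longrightarrow> triangle_goal D"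
  by (auto simp: local_goal_def triangle_goal_def)

lemma breaker_wins_empty: "local_goal W \<Longrightarrow> breaker_wins W {} {}"
  by (rule breaker_winsI) (use local_goal_triangle triangle_nonempty in \<open>fastforce simp: triangle_goal_def\<close>)+

lemma breaker_wins_split:
  assumes "local_goal W" "finite E1" "finite E2" "breaker_wins W {} E1" "breaker_wins W {} E2"
    and disj: "E1 \<inter> E2 = {}"
    and "\<And>t. triangle t \<Longrightarrow> t \<subseteq> E1 \<union> E2 \<Longrightarrow> t \<subseteq> E1 \<or> t \<subseteq> E2"
  shows "breaker_wins W {} (E1 \<union> E2)"
proof -
  have "breaker_wins W ({} \<union> {}) (E1 \<union> E2)"
  proof (rule breaker_wins_union[OF assms(2-6)])
    fix X Y assume X: "undir ` (X - {}) \<subseteq> E1" and Y: "undir ` (Y - {}) \<subseteq> E2" and XY: "W (X \<union> Y)"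
    obtain t where t: "triangle t" "t \<subseteq> undir ` (X \<union> Y)"
      "\<forall>D'. {a \<in> X \<union> Y. undir a \<in> t} \<subseteq> D' \<longrightarrow> W D'"
      by (rule local_goalE[OF assms(1) XY])
    have "t \<subseteq> E1 \<union> E2" using t(2) X Y by blast
    from assms(7)[OF t(1) this] show "W X \<or> W Y"
    proof
      assume "t \<subseteq> E1"
      then have "{a \<in> X \<union> Y. undir a \<in> t} \<subseteq> X" using Y disj by blast
      then show ?thesis using t(3) by blast
    next
      assume "t \<subseteq> E2"
      then have "{a \<in> X \<union> Y. undir a \<in> t} \<subseteq> Y" using X disj by blast
      then show ?thesis using t(3) by blast
    qed
  qed
  then show ?thesis by simp
qed

text \<open>A winning triangle outside \<open>F\<close> would contain a pair inside
  \<open>Q\<close>, of which Breaker secures one edge; the arcs of a triangle inside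
  \<open>F\<close> all come from the game on \<open>F\<close>.\<close>

lemma breaker_wins_add_pairs:
  assumes "local_goal W" "finite F" "finite Q" "breaker_wins W {} F" "F \<inter> Q = {}" "disjoint_pairs P"
    and "\<And>t. triangle t \<Longrightarrow> t \<subseteq> F \<union> Q \<Longrightarrow> t \<subseteq> F \<or> (\<exists>p\<in>P. p \<subseteq> t \<inter> Q)"
  shows "breaker_wins W {} (F \<union> Q)"
proof -
  have "breaker_wins W ({} \<union> {}) (F \<union> Q)"
  proof (rule breaker_wins_union[OF assms(2,3,4) breaker_wins_pairs[OF assms(6,3)] assms(5)])
    fix X Y assume X: "undir ` (X - {}) \<subseteq> F" and Y: "undir ` (Y - {}) \<subseteq> Q" and XY: "W (X \<union> Y)"
    obtain t where t: "triangle t" "t \<subseteq> undir ` (X \<union> Y)"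
      "\<forall>D'. {a \<in> X \<union> Y. undir a \<in> t} \<subseteq> D' \<longrightarrow> W D'"
      by (rule local_goalE[OF assms(1) XY])
    have "t \<subseteq> F \<union> Q" using t(2) X Y by blast
    from assms(7)[OF t(1) this] show "W X \<or> (\<exists>p\<in>P. p \<subseteq> undir ` Y)"
    proof
      assume "t \<subseteq> F"
      then have "{a \<in> X \<union> Y. undir a \<in> t} \<subseteq> X" using Y assms(5) by blast
      then show ?thesis using t(3) by blast
    next
      assume "\<exists>p\<in>P. p \<subseteq> t \<inter> Q"
      then obtain p where p: "p \<in> P" "p \<subseteq> t \<inter> Q" by blast
      have "p \<subseteq> undir ` Y"
      proof
        fix e assume "e \<in> p"
        then have "e \<in> undir ` (X \<union> Y)" "e \<in> Q" using p t(2) by auto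
        then show "e \<in> undir ` Y" using X assms(5) by auto
      qed
      then show ?thesis using p(1) by blast
    qed
  qed
  then show ?thesis by simp
qed

text \<open>Strong induction on the number of edges: whichever clause of \<open>core\<close> fails,
  it yields proper parts of \<open>E\<close> to which the induction hypothesis applies, and any
  edges left over are harmless or can be paired.\<close>

lemma breaker_wins_if_cores:
  assumes W: "local_goal W" and "graph E" and "\<And>C. C \<subseteq> E \<Longrightarrow> core C \<Longrightarrow> breaker_wins W {} C"
  shows "breaker_wins W {} E"
  using assms(2,3)
proof (induction "card E" arbitrary: E rule: less_induct)
  case less
  have fin: "finite E" using less.prems(1) by (simp add: graph_def)
  have IH: "breaker_wins W {} F" if "F \<subset> E" for F
  proof (rule less.hyps)
    show "card F < card E" using that fin by (rule psubset_card_mono[rotated])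
    show "graph F" using that less.prems(1) by (auto intro: graph_subset)
    show "breaker_wins W {} C" if "C \<subseteq> F" "core C" for C
      using that \<open>F \<subset> E\<close> by (intro less.prems(2)) auto
  qed
  consider "E = {}" | e where "e \<in> E" "\<not> (\<exists>t. triangle t \<and> t \<subseteq> E \<and> e \<in> t)"
    | x where "x \<in> \<Union>E" "card (edges_at E x) < 3"
    | "E \<noteq> {}" "\<not> triangle_connected E" | "core E"
    using less.prems(1) unfolding core_def by (meson not_le)
  then show ?case
  proof cases
    case 1
    then show ?thesis using breaker_wins_empty[OF W] by simp
  next
    case (2 e)
    have "breaker_wins W {} ((E - {e}) \<union> {e})"
    proof (rule breaker_wins_add_pairs[OF W])
      show "breaker_wins W {} (E - {e})" using 2(1) by (intro IH) blast
      show "disjoint_pairs {}" by (simp add: disjoint_pairs_def)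
      show "t \<subseteq> E - {e} \<or> (\<exists>p\<in>{}. p \<subseteq> t \<inter> {e})" if "triangle t" "t \<subseteq> E - {e} \<union> {e}" for t
        using that 2 by blast
    qed (use fin in auto)
    with 2(1) show ?thesis by (simp add: insert_absorb)
  next
    case (3 x)
    define Q where "Q = edges_at E x"
    have Q: "Q \<subseteq> E" "Q \<noteq> {}" "finite Q"
      using 3(1) fin by (auto simp: Q_def edges_at_def)
    \<comment> \<open>A triangle through \<open>x\<close> uses two edges at \<open>x\<close>, so a
      single edge there lies in no triangle and a pair is formed only if there are two.\<close>
    define P where "P = (if card Q = 2 then {Q} else {})"
    have "breaker_wins W {} ((E - Q) \<union> Q)"
    proof (rule breaker_wins_add_pairs[OF W])
      show "breaker_wins W {} (E - Q)" using Q by (intro IH) blast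
      show "disjoint_pairs P" by (simp add: disjoint_pairs_def P_def)
      fix t assume t: "triangle t" "t \<subseteq> E - Q \<union> Q"
      show "t \<subseteq> E - Q \<or> (\<exists>p\<in>P. p \<subseteq> t \<inter> Q)"
      proof (cases "t \<inter> Q = {}")
        case False
        then obtain e where e: "e \<in> t" "e \<in> Q" by blast
        then have "x \<in> e" by (auto simp: Q_def edges_at_def)
        with e obtain f where f: "f \<in> t" "f \<noteq> e" "x \<in> f"
          using triangle_two_edges[OF t(1)] by metis
        have fQ: "f \<in> Q" using f t(2) by (auto simp: Q_def edges_at_def)
        have "card {e, f} = 2" using f(2) by simp
        moreover have "card Q \<le> 2" using 3(2) by (simp add: Q_def)
        ultimately have "{e, f} = Q" using e(2) fQ Q(3) by (intro card_seteq) auto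
        with \<open>card {e, f} = 2\<close> e f show ?thesis by (auto simp: P_def)
      qed (use t in blast)
    qed (use fin Q in auto)
    moreover have "E - Q \<union> Q = E" using Q by blast
    ultimately show ?thesis by simp
  next
    case 4
    then obtain S where S: "S \<subset> E" "S \<noteq> {}"
      "\<not> (\<exists>t. triangle t \<and> t \<subseteq> E \<and> t \<inter> S \<noteq> {} \<and> \<not> t \<subseteq> S)"
      unfolding triangle_connected_def by blast
    have "breaker_wins W {} (S \<union> (E - S))"
    proof (rule breaker_wins_split[OF W])
      show "finite S" "finite (E - S)" using S fin by (auto intro: finite_subset)
      show "breaker_wins W {} S" "breaker_wins W {} (E - S)" using S by (auto intro!: IH)
      show "t \<subseteq> S \<or> t \<subseteq> E - S" if "triangle t" "t \<subseteq> S \<union> (E - S)" for t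
        using that S by blast
    qed auto
    moreover have "S \<union> (E - S) = E" using S by blast
    ultimately show ?thesis by simp
  next
    case 5
    then show ?thesis using less.prems(2) by blast
  qed
qed

section \<open>Gluing triangles: 2-trees and the excess of edges over twice the vertices\<close>

text \<open>Gluing a triangle along an edge adds a vertex and two edges, so \<open>card E - 2 * card (\<Union>E)\<close> is
  preserved, and the two new edges can be paired.\<close>

inductive vgrow :: "nat set set \<Rightarrow> nat set set \<Rightarrow> bool" for S0 where
  vgrow_refl: "vgrow S0 S0"
| vgrow_step: "vgrow S0 S \<Longrightarrow> {a, b} \<in> S \<Longrightarrow> a \<noteq> b \<Longrightarrow> w \<notin> \<Union>S \<Longrightarrow> vgrow S0 (S \<union> {{a, w}, {b, w}})"

lemma vgrow_subset: "vgrow S0 S \<Longrightarrow> S0 \<subseteq> S"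
  by (induction rule: vgrow.induct) auto

lemma vgrow_graph: "vgrow S0 S \<Longrightarrow> graph S0 \<Longrightarrow> graph S"
proof (induction rule: vgrow.induct)
  case (vgrow_step S a b w)
  then have "a \<noteq> w" "b \<noteq> w" by auto
  then show ?case using vgrow_step by (simp add: graph_def)
qed

lemma vgrow_card:
  "vgrow S0 S \<Longrightarrow> graph S0 \<Longrightarrow> card S + 2 * card (\<Union>S0) = card S0 + 2 * card (\<Union>S)"
proof (induction rule: vgrow.induct)
  case (vgrow_step S a b w)
  have g: "graph S" using vgrow_step vgrow_graph by blast
  have "{a, w} \<notin> S" "{b, w} \<notin> S" "{a, w} \<noteq> {b, w}"
    using vgrow_step by (auto simp: doubleton_eq_iff)
  then have "card (S \<union> {{a, w}, {b, w}}) = card S + 2"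
    using g by (simp add: graph_def card_insert_if)
  moreover have "\<Union>(S \<union> {{a, w}, {b, w}}) = insert w (\<Union>S)" using vgrow_step by auto
  ultimately show ?case
    using vgrow_step graph_finite_vertices[OF g] by simp
qed simp

text \<open>The vertex glued last has degree 2. As cores have minimum degree 3, no core arises from
  a proper part by such steps alone.\<close>

lemma vgrow_last:
  "vgrow S0 S \<Longrightarrow> S = S0 \<or> (\<exists>w\<in>\<Union>S. card (edges_at S w) = 2)"
proof (induction rule: vgrow.induct)
  case (vgrow_step S a b w)
  have "edges_at (S \<union> {{a, w}, {b, w}}) w = {{a, w}, {b, w}}"
    using vgrow_step by (auto simp: edges_at_def)
  moreover have "{a, w} \<noteq> {b, w}" using vgrow_step by (auto simp: doubleton_eq_iff)
  ultimately show ?case by (intro disjI2 bexI[of _ w]) auto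
qed simp

lemma triangle_new_vertex:
  assumes "triangle t" "t \<subseteq> S \<union> {{a, w}, {b, w}}" "w \<notin> \<Union>S"
  shows "t \<subseteq> S \<or> {{a, w}, {b, w}} \<subseteq> t"
proof (cases "t \<subseteq> S")
  case False
  then obtain e where e: "e \<in> t" "e \<in> {{a, w}, {b, w}}" using assms(2) by blast
  then have "w \<in> e" by blast
  then obtain f where "f \<in> t" "f \<noteq> e" "w \<in> f"
    using triangle_two_edges[OF assms(1) _ e(1)] by metis
  then show ?thesis using e assms by blast
qed simp

text \<open>A triangle that is not contained in \<open>S0\<close> uses both edges with which its
  most recently added vertex was glued, so these two edges serve as its pair.\<close>

lemma vgrow_pairing:
  "vgrow S0 S \<Longrightarrow> \<exists>P. disjoint_pairs P \<and> \<Union>P \<subseteq> S - S0 \<and>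
     (\<forall>t. triangle t \<longrightarrow> t \<subseteq> S \<longrightarrow> t \<subseteq> S0 \<or> (\<exists>p\<in>P. p \<subseteq> t))"
proof (induction rule: vgrow.induct)
  case vgrow_refl
  show ?case by (rule exI[of _ "{}"]) (auto simp: disjoint_pairs_def)
next
  case (vgrow_step S a b w)
  then obtain P where P: "disjoint_pairs P" "\<Union>P \<subseteq> S - S0"
    "\<And>t. triangle t \<Longrightarrow> t \<subseteq> S \<Longrightarrow> t \<subseteq> S0 \<or> (\<exists>p\<in>P. p \<subseteq> t)" by blast
  let ?p = "{{a, w}, {b, w}}"
  have new: "{a, w} \<notin> S" "{b, w} \<notin> S" "{a, w} \<noteq> {b, w}"
    using vgrow_step.hyps by (auto simp: doubleton_eq_iff)
  have S0: "S0 \<subseteq> S" by (rule vgrow_subset[OF vgrow_step.hyps(1)])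
  show ?case
  proof (rule exI[of _ "insert ?p P"], intro conjI allI impI)
    have "?p \<inter> q = {}" if "q \<in> P" for q using that P(2) new by blast
    then show "disjoint_pairs (insert ?p P)"
      using P(1) new by (auto simp: disjoint_pairs_def)
    show "\<Union>(insert ?p P) \<subseteq> S \<union> ?p - S0" using P(2) new S0 by blast
    fix t assume t: "triangle t" "t \<subseteq> S \<union> ?p"
    from triangle_new_vertex[OF t \<open>w \<notin> \<Union>S\<close>] P(3)[OF t(1)]
    show "t \<subseteq> S0 \<or> (\<exists>p\<in>insert ?p P. p \<subseteq> t)" by blast
  qed
qed

lemma triangle_connected_Un:
  assumes "triangle_connected S" "triangle t" "t \<inter> S \<noteq> {}"
  shows "triangle_connected (S \<union> t)"
  unfolding triangle_connected_def
proof (intro allI impI)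
  fix R assume R: "R \<subset> S \<union> t" "R \<noteq> {}"
  show "\<exists>t'. triangle t' \<and> t' \<subseteq> S \<union> t \<and> t' \<inter> R \<noteq> {} \<and> \<not> t' \<subseteq> R"
  proof (cases "R \<inter> S = {} \<or> S \<subseteq> R")
    case True
    then show ?thesis using R assms by (intro exI[of _ t]) blast
  next
    case False
    then have "R \<inter> S \<subset> S" "R \<inter> S \<noteq> {}" by blast+
    then obtain t' where "triangle t'" "t' \<subseteq> S" "t' \<inter> (R \<inter> S) \<noteq> {}" "\<not> t' \<subseteq> R \<inter> S"
      using assms(1) unfolding triangle_connected_def by blast
    then show ?thesis by (intro exI[of _ t']) blast
  qed
qed

lemma triangleI: "a \<noteq> b \<Longrightarrow> b \<noteq> c \<Longrightarrow> a \<noteq> c \<Longrightarrow> triangle {{a, b}, {b, c}, {a, c}}"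
  by (auto simp: triangle_def)

lemma vgrow_triangle_connected:
  "vgrow S0 S \<Longrightarrow> triangle_connected S0 \<Longrightarrow> triangle_connected S"
proof (induction rule: vgrow.induct)
  case (vgrow_step S a b w)
  have "a \<noteq> w" "b \<noteq> w" using vgrow_step by auto
  then have "triangle {{a, b}, {b, w}, {a, w}}" using vgrow_step by (intro triangleI) auto
  then have "triangle_connected (S \<union> {{a, b}, {b, w}, {a, w}})"
    using vgrow_step by (intro triangle_connected_Un) auto
  moreover have "S \<union> {{a, b}, {b, w}, {a, w}} = S \<union> {{a, w}, {b, w}}" using vgrow_step by blast
  ultimately show ?case by simp
qed

text \<open>Graphs glued from a single edge are 2-trees and hence chordal; this is the case of the
  4-cycle \<open>x\<close>, \<open>z\<close>, \<open>y\<close>, \<open>p\<close>. If the newest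
  vertex lies on the cycle, its two neighbours there are the ends of the edge to which it was
  glued.\<close>

lemma vgrow_chord:
  assumes "vgrow {e} S" "graph {e}" "{x, z} \<in> S" "{z, y} \<in> S" "{y, p} \<in> S" "{p, x} \<in> S"
    "x \<noteq> y" "z \<noteq> p"
  shows "{x, y} \<in> S \<or> {z, p} \<in> S"
  using assms
proof (induction arbitrary: x y z p rule: vgrow.induct)
  case vgrow_refl
  then show ?case by (auto simp: doubleton_eq_iff)
next
  case (vgrow_step S a b w)
  have nb: "{c, w} \<in> S \<union> {{a, w}, {b, w}} \<Longrightarrow> c = a \<or> c = b"
    "{w, c} \<in> S \<union> {{a, w}, {b, w}} \<Longrightarrow> c = a \<or> c = b" for c
    using vgrow_step.hyps by (auto simp: doubleton_eq_iff)
  have ab: "{a, b} \<in> S" "{b, a} \<in> S" using vgrow_step.hyps by (auto simp: insert_commute)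
  show ?case
  proof (cases "w \<in> {x, y, z, p}")
    case True
    then consider "w = x" | "w = y" | "w = z" | "w = p" by blast
    then show ?thesis
    proof cases
      case 1
      then have "z = a \<or> z = b" "p = a \<or> p = b" using nb vgrow_step.prems(2,5) by blast+
      then show ?thesis using vgrow_step.prems(7) ab by auto
    next
      case 2
      then have "z = a \<or> z = b" "p = a \<or> p = b" using nb vgrow_step.prems(3,4) by blast+
      then show ?thesis using vgrow_step.prems(7) ab by auto
    next
      case 3
      then have "x = a \<or> x = b" "y = a \<or> y = b" using nb vgrow_step.prems(2,3) by blast+
      then show ?thesis using vgrow_step.prems(6) ab by auto
    next
      case 4
      then have "x = a \<or> x = b" "y = a \<or> y = b" using nb vgrow_step.prems(4,5) by blast+
      then show ?thesis using vgrow_step.prems(6) ab by auto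
    qed
  next
    case False
    then have "{x, z} \<in> S" "{z, y} \<in> S" "{y, p} \<in> S" "{p, x} \<in> S"
      using vgrow_step.prems by (auto simp: doubleton_eq_iff)
    then show ?thesis using vgrow_step.IH[of x z y p] vgrow_step.prems by blast
  qed
qed

lemma vgrow_maximal:
  assumes "graph E" "S0 \<subseteq> E"
  obtains S where "vgrow S0 S" "S \<subseteq> E"
    "\<And>a b w. {a, b} \<in> S \<Longrightarrow> a \<noteq> b \<Longrightarrow> w \<notin> \<Union>S \<Longrightarrow> {a, w} \<in> E \<Longrightarrow> {b, w} \<in> E \<Longrightarrow> False"
proof -
  define M where "M = {S. vgrow S0 S \<and> S \<subseteq> E}"
  have "finite M" using assms(1) by (auto simp: M_def graph_def)
  moreover have "S0 \<in> M" using assms(2) by (auto simp: M_def intro: vgrow_refl)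
  ultimately obtain S where S: "S \<in> M" "\<And>S'. S' \<in> M \<Longrightarrow> S \<subseteq> S' \<Longrightarrow> S = S'"
    using finite_has_maximal2[of M S0] by auto
  show thesis
  proof (rule that[of S])
    show "vgrow S0 S" "S \<subseteq> E" using S(1) by (auto simp: M_def)
    fix a b w assume *: "{a, b} \<in> S" "a \<noteq> b" "w \<notin> \<Union>S" "{a, w} \<in> E" "{b, w} \<in> E"
    have "vgrow S0 (S \<union> {{a, w}, {b, w}})"
      using S(1) by (intro vgrow_step *(1-3)) (simp add: M_def)
    then have "S \<union> {{a, w}, {b, w}} \<in> M" using * S(1) by (simp add: M_def)
    from S(2)[OF this] * show False by blast
  qed
qed

text \<open>The third vertex of a triangle that leaves \<open>S\<close> is either new, and can be
  glued on as in \<open>vgrow\<close>, or old, in which case the triangle adds only edges.\<close>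

lemma triangle_connected_step:
  assumes "graph E" "triangle_connected E" "S \<subset> E" "S \<noteq> {}"
  obtains a b w where "{a, b} \<in> S" "a \<noteq> b" "w \<notin> \<Union>S" "{a, w} \<in> E" "{b, w} \<in> E"
    | t where "triangle t" "t \<subseteq> E" "t \<inter> S \<noteq> {}" "\<not> t \<subseteq> S" "\<Union>t \<subseteq> \<Union>S"
proof -
  obtain t where t: "triangle t" "t \<subseteq> E" "t \<inter> S \<noteq> {}" "\<not> t \<subseteq> S"
    using assms unfolding triangle_connected_def by blast
  then obtain e where e: "e \<in> t" "e \<in> S" by blast
  then obtain a b c where c: "a \<noteq> b" "b \<noteq> c" "a \<noteq> c" "e = {a, b}" "t = {{a, b}, {b, c}, {a, c}}"
    using triangle_edgeE[OF t(1)] by metis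
  show thesis
  proof (cases "c \<in> \<Union>S")
    case True
    then have "\<Union>t \<subseteq> \<Union>S" using c e by auto
    then show thesis using that(2) t by blast
  next
    case False
    then show thesis using that(1)[of a b c] c e t by auto
  qed
qed

text \<open>The excess \<open>card S - 2 * card (\<Union>S)\<close>, written without subtraction,
  does not drop when \<open>S\<close> grows to \<open>E\<close>: a glued vertex leaves it unchanged
  and a triangle on old vertices raises it.\<close>

lemma excess_mono:
  assumes "graph E" "triangle_connected E" "S \<subseteq> E" "S \<noteq> {}"
  shows "card S + 2 * card (\<Union>E) \<le> card E + 2 * card (\<Union>S)"
  using assms(3,4)
proof (induction "card (E - S)" arbitrary: S rule: less_induct)
  case less
  have fin: "finite E" "finite S" using assms(1) less.prems by (auto simp: graph_def intro: finite_subset)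
  show ?case
  proof (cases "S = E")
    case False
    then have "S \<subset> E" using less.prems by blast
    have gS: "graph S" using graph_subset[OF assms(1) less.prems(1)] .
    show ?thesis
    proof (rule triangle_connected_step[OF assms(1,2) \<open>S \<subset> E\<close> less.prems(2)])
      fix a b w assume *: "{a, b} \<in> S" "a \<noteq> b" "w \<notin> \<Union>S" "{a, w} \<in> E" "{b, w} \<in> E"
      let ?S = "S \<union> {{a, w}, {b, w}}"
      have v: "vgrow S ?S" using * by (intro vgrow_step vgrow_refl) auto
      have "E - ?S \<subset> E - S" using * by blast
      then have "card (E - ?S) < card (E - S)" using fin by (intro psubset_card_mono) auto
      from less.hyps[OF this] have "card ?S + 2 * card (\<Union>E) \<le> card E + 2 * card (\<Union>?S)"
        using * less.prems by blast
      with vgrow_card[OF v gS] show ?thesis by linarith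
    next
      fix t assume *: "triangle t" "t \<subseteq> E" "t \<inter> S \<noteq> {}" "\<not> t \<subseteq> S" "\<Union>t \<subseteq> \<Union>S"
      have "E - (S \<union> t) \<subset> E - S" using * by blast
      then have "card (E - (S \<union> t)) < card (E - S)" using fin by (intro psubset_card_mono) auto
      from less.hyps[OF this] have "card (S \<union> t) + 2 * card (\<Union>E) \<le> card E + 2 * card (\<Union>(S \<union> t))"
        using * less.prems by blast
      moreover have "\<Union>(S \<union> t) = \<Union>S" using * by blast
      moreover have "finite (S \<union> t)" using * fin by (meson finite_subset less.prems(1) Un_least)
      then have "card S \<le> card (S \<union> t)" by (intro card_mono) auto
      ultimately show ?thesis by simp
    qed
  qed simp
qed

text \<open>If the excess of \<open>E\<close> does not exceed that of \<open>S0\<close>, a maximal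
  glued part is everything: a triangle on old vertices would raise the excess, and by
  \<open>excess_mono\<close> it could not come down again.\<close>

lemma vgrow_complete:
  assumes "graph E" "triangle_connected E" "S0 \<subseteq> E" "S0 \<noteq> {}"
    and "card E + 2 * card (\<Union>S0) \<le> card S0 + 2 * card (\<Union>E)"
  shows "vgrow S0 E"
proof -
  obtain S where S: "vgrow S0 S" "S \<subseteq> E"
    "\<And>a b w. {a, b} \<in> S \<Longrightarrow> a \<noteq> b \<Longrightarrow> w \<notin> \<Union>S \<Longrightarrow> {a, w} \<in> E \<Longrightarrow> {b, w} \<in> E \<Longrightarrow> False"
    using vgrow_maximal[OF assms(1,3)] by metis
  have "S = E"
  proof (rule ccontr)
    assume "S \<noteq> E"
    then have "S \<subset> E" "S \<noteq> {}" using S(2) vgrow_subset[OF S(1)] assms(4) by blast+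
    with S(3) obtain t where t: "triangle t" "t \<subseteq> E" "t \<inter> S \<noteq> {}" "\<not> t \<subseteq> S" "\<Union>t \<subseteq> \<Union>S"
      using triangle_connected_step[OF assms(1,2)] by metis
    have "finite E" using assms(1) by (simp add: graph_def)
    then have "card S < card (S \<union> t)"
      using t S(2) by (intro psubset_card_mono) (auto intro: finite_subset)
    moreover have "\<Union>(S \<union> t) = \<Union>S" using t by blast
    moreover have "card (S \<union> t) + 2 * card (\<Union>E) \<le> card E + 2 * card (\<Union>(S \<union> t))"
    proof (rule excess_mono[OF assms(1,2)])
      show "S \<union> t \<subseteq> E" using t(2) S(2) by simp
      show "S \<union> t \<noteq> {}" using \<open>S \<noteq> {}\<close> by simp
    qed
    moreover have "graph S0" using graph_subset[OF assms(1,3)] .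
    ultimately show False using vgrow_card[OF S(1)] assms(5) by simp
  qed
  with S(1) show ?thesis by simp
qed

text \<open>Otherwise the core would be glued from its proper part \<open>S0\<close> and end with a
  vertex of degree 2. So its excess is strictly larger than that of every nonempty proper
  part.\<close>

lemma core_no_slack:
  assumes "core E" "S0 \<subseteq> E" "S0 \<noteq> {}"
    and "card E + 2 * card (\<Union>S0) \<le> card S0 + 2 * card (\<Union>E)"
  shows "E = S0"
proof -
  have "vgrow S0 E" using assms by (intro vgrow_complete) (auto simp: core_def)
  from vgrow_last[OF this] show ?thesis
    using assms(1) by (fastforce simp: core_def)
qed

section \<open>Cores with at most 2v - 2 edges\<close>

definition K4 :: "nat \<Rightarrow> nat \<Rightarrow> nat \<Rightarrow> nat \<Rightarrow> nat set set" where
  "K4 u v w z = {{u, v}, {u, w}, {u, z}, {v, w}, {v, z}, {w, z}}"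

text \<open>Breaker's edge \<open>{u, w}\<close> destroys the triangles \<open>u v w\<close> and
  \<open>u w z\<close>. The other two, \<open>u v z\<close> and \<open>v w z\<close>, contain the
  disjoint pairs of \<open>?P\<close>.\<close>

lemma breaker_wins_K4_aux:
  assumes d: "distinct [u, v, w, z]" and a: "undir a = {u, v}"
  shows "\<exists>e. breaker_wins triangle_goal {a} (K4 u v w z - {{u, v}} - {e})"
proof (rule exI[of _ "{u, w}"])
  let ?P = "{{{u, z}, {v, z}}, {{v, w}, {w, z}}}"
  let ?F = "{{u, z}, {v, z}, {v, w}, {w, z}}"
  have F: "K4 u v w z - {{u, v}} - {{u, w}} = ?F"
    using d by (auto simp: K4_def doubleton_eq_iff)
  have "breaker_wins (\<lambda>Y. \<exists>p\<in>?P. p \<subseteq> undir ` Y) {a} ?F"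
    by (rule breaker_wins_pairs_aux) (use d a in \<open>auto simp: disjoint_pairs_def doubleton_eq_iff\<close>)
  then have "breaker_wins triangle_goal {a} ?F"
  proof (rule breaker_wins_restrict[rotated])
    fix Y assume Y: "{a} \<subseteq> Y" "undir ` (Y - {a}) \<subseteq> ?F" and "triangle_goal Y"
    then obtain t where t: "triangle t" "t \<subseteq> undir ` Y" unfolding triangle_goal_def by blast
    have sub: "undir ` Y \<subseteq> insert {u, v} ?F" using Y a by blast
    show "\<exists>p\<in>?P. p \<subseteq> undir ` Y"
    proof (cases "\<exists>e\<in>t. w \<in> e")
      case True
      then obtain e where e: "e \<in> t" "w \<in> e" by blast
      then obtain f where f: "f \<in> t" "f \<noteq> e" "w \<in> f" using triangle_two_edges[OF t(1)] by metis
      have key: "g = {v, w} \<or> g = {w, z}" if "g \<in> t" "w \<in> g" for g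
      proof -
        have "g \<in> insert {u, v} ?F" using that(1) t(2) sub by blast
        then have "g = {u, v} \<or> g = {u, z} \<or> g = {v, z} \<or> g = {v, w} \<or> g = {w, z}" by simp
        then show ?thesis using that(2) d by auto
      qed
      have "{v, w} \<in> t \<and> {w, z} \<in> t" using key[OF e] key[OF f(1,3)] e(1) f(1,2) by metis
      then have "{{v, w}, {w, z}} \<subseteq> t" by simp
      then show ?thesis using t(2) by blast
    next
      case False
      have "t \<subseteq> {{u, v}, {u, z}, {v, z}}"
      proof
        fix g assume g: "g \<in> t"
        then have "g \<in> insert {u, v} ?F" using t(2) sub by blast
        then have "g = {u, v} \<or> g = {u, z} \<or> g = {v, z} \<or> g = {v, w} \<or> g = {w, z}" by simp
        moreover have "w \<notin> g" using False g by blast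
        ultimately show "g \<in> {{u, v}, {u, z}, {v, z}}" by auto
      qed
      moreover have "card {{u, v}, {u, z}, {v, z}} \<le> card t"
        using triangle_card[OF t(1)] by (simp add: card_insert_if)
      ultimately have "t = {{u, v}, {u, z}, {v, z}}"
        by (rule card_seteq[OF finite.insertI[OF finite.insertI[OF finite.insertI[OF finite.emptyI]]]])
      then have "{{u, z}, {v, z}} \<subseteq> undir ` Y" using t(2) by simp
      then show ?thesis by blast
    qed
  qed simp
  with F show "breaker_wins triangle_goal {a} (K4 u v w z - {{u, v}} - {{u, w}})" by simp
qed

lemma breaker_wins_K4:
  assumes d: "distinct [u, v, w, z]"
  shows "breaker_wins triangle_goal {} (K4 u v w z)"
proof (rule breaker_winsI)
  show "\<not> triangle_goal {}" using triangle_nonempty by (auto simp: triangle_goal_def)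
  fix a assume "undir a \<in> K4 u v w z"
  then obtain x y p q where *: "distinct [x, y, p, q]" "undir a = {x, y}" "K4 u v w z = K4 x y p q"
  proof -
    have eqs: "K4 u v w z = K4 u w v z" "K4 u v w z = K4 u z v w" "K4 u v w z = K4 v w u z"
      "K4 u v w z = K4 v z u w" "K4 u v w z = K4 w z u v"
      by (auto simp: K4_def insert_commute)
    have "undir a = {u, v} \<or> undir a = {u, w} \<or> undir a = {u, z} \<or>
        undir a = {v, w} \<or> undir a = {v, z} \<or> undir a = {w, z}"
      using \<open>undir a \<in> K4 u v w z\<close> by (simp add: K4_def)
    then consider "undir a = {u, v}" | "undir a = {u, w}" | "undir a = {u, z}"
      | "undir a = {v, w}" | "undir a = {v, z}" | "undir a = {w, z}" by blast
    then show thesis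
    proof cases
      case 1 show thesis by (rule that[OF _ 1 refl]) (use d in auto)
    next
      case 2 show thesis by (rule that[OF _ 2 eqs(1)]) (use d in auto)
    next
      case 3 show thesis by (rule that[OF _ 3 eqs(2)]) (use d in auto)
    next
      case 4 show thesis by (rule that[OF _ 4 eqs(3)]) (use d in auto)
    next
      case 5 show thesis by (rule that[OF _ 5 eqs(4)]) (use d in auto)
    next
      case 6 show thesis by (rule that[OF _ 6 eqs(5)]) (use d in auto)
    qed
  qed
  from breaker_wins_K4_aux[OF *(1,2)]
  show "\<exists>e. breaker_wins triangle_goal {a} (K4 u v w z - {undir a} - {e})"
    using *(2,3) by simp
qed

lemma local_goal_triangle_goal: "local_goal triangle_goal"
  unfolding local_goal_def
proof (intro allI impI)
  fix D assume "triangle_goal D"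
  then obtain t where t: "triangle t" "t \<subseteq> undir ` D" unfolding triangle_goal_def by blast
  have "triangle_goal D'" if "{a \<in> D. undir a \<in> t} \<subseteq> D'" for D'
    unfolding triangle_goal_def by (rule exI[of _ t]) (use t that in blast)
  with t show "\<exists>t. triangle t \<and> t \<subseteq> undir ` D \<and> (\<forall>D'. {a \<in> D. undir a \<in> t} \<subseteq> D' \<longrightarrow> triangle_goal D')"
    by blast
qed

lemma breaker_wins_pairing:
  assumes "finite E" "disjoint_pairs P" "\<And>t. triangle t \<Longrightarrow> t \<subseteq> E \<Longrightarrow> \<exists>p\<in>P. p \<subseteq> t"
  shows "breaker_wins triangle_goal {} E"
proof -
  have "breaker_wins triangle_goal {} ({} \<union> E)"
  proof (rule breaker_wins_add_pairs[OF local_goal_triangle_goal _ assms(1)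
        breaker_wins_empty[OF local_goal_triangle_goal] _ assms(2)])
    fix t assume t: "triangle t" "t \<subseteq> {} \<union> E"
    then obtain p where "p \<in> P" "p \<subseteq> t" using assms(3)[of t] by auto
    with t(2) have "p \<subseteq> t \<inter> E" by auto
    with \<open>p \<in> P\<close> show "t \<subseteq> {} \<or> (\<exists>p\<in>P. p \<subseteq> t \<inter> E)" by blast
  qed auto
  then show ?thesis by simp
qed

text \<open>The excess of the core is exactly -2, one more than that of a 2-tree, so a maximal
  2-tree \<open>S\<close> inside it misses just one edge \<open>{x, y}\<close>. If \<open>x\<close>
  and \<open>y\<close> have a single common neighbour, one further pair disposes of the only new
  triangle; otherwise chordality of \<open>S\<close> makes the core a \<open>K4\<close>.\<close>

lemma breaker_wins_sparse_core:
  assumes core: "core E" and sparse: "card E + 2 \<le> 2 * card (\<Union>E)"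
  shows "breaker_wins triangle_goal {} E"
proof -
  have g: "graph E" "finite E" and tc: "triangle_connected E" and ne: "E \<noteq> {}"
    using core by (auto simp: core_def graph_def)
  have not_single: "E \<noteq> {e}" for e
  proof
    assume E: "E = {e}"
    obtain t where "triangle t" "t \<subseteq> {e}" using core E unfolding core_def by blast
    then have "card t \<le> 1" by (metis card_mono finite.intros card.empty is_singletonI is_singleton_altdef finite.emptyI finite_insert)
    with triangle_card[OF \<open>triangle t\<close>] show False by simp
  qed
  obtain a b where ab: "{a, b} \<in> E" "a \<noteq> b" using ne graph_edgeE[OF g(1)] by blast
  \<comment> \<open>With fewer edges the excess would be at most that of the edge
    \<open>{a, b}\<close>, and the core would be this edge alone.\<close>
  have cE: "card E + 2 = 2 * card (\<Union>E)"
  proof (rule ccontr)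
    assume "card E + 2 \<noteq> 2 * card (\<Union>E)"
    then have "card E + 2 * card (\<Union>{{a, b}}) \<le> card {{a, b}} + 2 * card (\<Union>E)"
      using sparse ab(2) by simp
    from core_no_slack[OF core _ _ this] ab(1) not_single show False by blast
  qed
  have g1: "graph {{a, b}}" using ab by (auto simp: graph_def)
  obtain S where S: "vgrow {{a, b}} S" "S \<subseteq> E"
    "\<And>a b w. {a, b} \<in> S \<Longrightarrow> a \<noteq> b \<Longrightarrow> w \<notin> \<Union>S \<Longrightarrow> {a, w} \<in> E \<Longrightarrow> {b, w} \<in> E \<Longrightarrow> False"
    using vgrow_maximal[OF g(1), of "{{a, b}}"] ab(1) by (metis empty_subsetI insert_subset)
  have cS: "card S + 3 = 2 * card (\<Union>S)" using vgrow_card[OF S(1) g1] ab(2) by simp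
  have "S \<noteq> E"
  proof
    assume "S = E"
    with vgrow_last[OF S(1)] core not_single show False by (fastforce simp: core_def)
  qed
  then have SE: "S \<subset> E" "S \<noteq> {}" using S(2) vgrow_subset[OF S(1)] by blast+
  with S(3) obtain t where t: "triangle t" "t \<subseteq> E" "t \<inter> S \<noteq> {}" "\<not> t \<subseteq> S" "\<Union>t \<subseteq> \<Union>S"
    using triangle_connected_step[OF g(1) tc] by metis
  have fS: "finite S" using S(2) g(2) finite_subset by blast
  have ft: "finite t" using t(2) g(2) finite_subset by blast
  have US: "\<Union>(S \<union> t) = \<Union>S" using t by blast
  have "card S < card (S \<union> t)" using t fS ft by (intro psubset_card_mono) auto
  \<comment> \<open>The edges that \<open>t\<close> adds on old vertices already bring
    \<open>S\<close> to the excess of the core, so nothing else is left.\<close>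
  then have "card E + 2 * card (\<Union>(S \<union> t)) \<le> card (S \<union> t) + 2 * card (\<Union>E)"
    using cS cE US by simp
  from core_no_slack[OF core _ _ this] have E: "E = S \<union> t" using S(2) t SE by blast
  have "card (S \<union> t) = card S + 1" using cE cS E US by simp
  moreover have "card (S \<union> t) = card S + card (t - S)"
    using card_Un_disjoint[of S "t - S"] fS ft by (simp add: Un_Diff_cancel Diff_disjoint)
  ultimately have "card (t - S) = 1" by simp
  then obtain e where e: "t - S = {e}" by (auto simp: card_1_singleton_iff)
  then have et: "e \<in> t" "e \<notin> S" by auto
  obtain x y where xy: "e = {x, y}" "x \<noteq> y"
    by (rule graph_edgeE[OF g(1), of e]) (use et t(2) in auto)
  obtain z where z: "z \<noteq> x" "z \<noteq> y" "t = {{x, y}, {y, z}, {x, z}}"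
    by (rule triangle_edge_thirdE[OF t(1), of x y]) (use et xy in auto)
  have xyS: "{x, y} \<notin> S" using et xy by simp
  have inS: "{x, z} \<in> S" "{y, z} \<in> S"
  proof -
    have "{x, z} \<in> t" "{y, z} \<in> t" by (simp_all add: z(3))
    moreover have "{x, z} \<noteq> e" "{y, z} \<noteq> e"
      using z(1,2) by (auto simp: xy(1) doubleton_eq_iff)
    moreover have "g \<in> S" if "g \<in> t" "g \<noteq> e" for g using that e by blast
    ultimately show "{x, z} \<in> S" "{y, z} \<in> S" by blast+
  qed
  have E': "E = insert {x, y} S"
  proof -
    have "S \<union> t = S \<union> (t - S)" by blast
    then show ?thesis using E e xy by simp
  qed
  have gS: "graph S" using graph_subset[OF g(1) S(2)] .
  have tcS: "triangle_connected S"
    by (rule vgrow_triangle_connected[OF S(1)]) (auto simp: triangle_connected_def)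
  have gxz: "graph {{x, z}}" using z by (auto simp: graph_def)
  \<comment> \<open>A 2-tree can be grown from any of its edges. Starting at \<open>{x, z}\<close>
    keeps this edge out of the pairing, free to be paired with \<open>{x, y}\<close>.\<close>
  have "vgrow {{x, z}} S"
    using inS z cS by (intro vgrow_complete[OF gS tcS]) auto
  note vg = this
  show ?thesis
  proof (cases "\<exists>z'. z' \<noteq> z \<and> {x, z'} \<in> S \<and> {y, z'} \<in> S")
    case True
    then obtain z' where z': "z' \<noteq> z" "{x, z'} \<in> S" "{y, z'} \<in> S" by blast
    have ne: "z' \<noteq> x" "z' \<noteq> y" using z' gS by (auto simp: graph_def)
    have "{x, y} \<in> S \<or> {z, z'} \<in> S"
      using z' inS xy(2) by (intro vgrow_chord[OF vg gxz]) (auto simp: insert_commute)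
    then have zz: "{z, z'} \<in> S" using xyS by blast
    have d: "distinct [x, y, z, z']" using ne z z' xy by auto
    have sub: "K4 x y z z' \<subseteq> E" using zz z' inS E' by (auto simp: K4_def)
    have "card (K4 x y z z') = 6" using d by (auto simp: K4_def card_insert_if doubleton_eq_iff)
    moreover have "\<Union>(K4 x y z z') = {x, y, z, z'}" by (auto simp: K4_def)
    moreover have "card {x, y, z, z'} = 4" using d by simp
    \<comment> \<open>\<open>K4\<close> has 6 edges on 4 vertices, hence the excess -2 of the core
      itself.\<close>
    ultimately have "E = K4 x y z z'"
      using cE by (intro core_no_slack[OF core sub]) (auto simp: K4_def)
    then show ?thesis using breaker_wins_K4[OF d] by simp
  next
    case False
    from vgrow_pairing[OF vg] obtain P where P: "disjoint_pairs P" "\<Union>P \<subseteq> S - {{x, z}}"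
      "\<And>t. triangle t \<Longrightarrow> t \<subseteq> S \<Longrightarrow> t \<subseteq> {{x, z}} \<or> (\<exists>p\<in>P. p \<subseteq> t)" by blast
    let ?p = "{{x, z}, {x, y}}"
    show ?thesis
    proof (rule breaker_wins_pairing[OF g(2)])
      have "?p \<inter> q = {}" if "q \<in> P" for q using that P(2) xyS by blast
      then show "disjoint_pairs (insert ?p P)"
        using P(1) z by (auto simp: disjoint_pairs_def doubleton_eq_iff)
      fix t' assume t': "triangle t'" "t' \<subseteq> E"
      show "\<exists>p\<in>insert ?p P. p \<subseteq> t'"
      proof (cases "{x, y} \<in> t'")
        case True
        obtain z' where w: "z' \<noteq> x" "z' \<noteq> y" "t' = {{x, y}, {y, z'}, {x, z'}}"
          by (rule triangle_edge_thirdE[OF t'(1) True])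
        have "{y, z'} \<noteq> {x, y}" "{x, z'} \<noteq> {x, y}" using w(1,2) by (auto simp: doubleton_eq_iff)
        moreover have "{y, z'} \<in> E" "{x, z'} \<in> E" using t'(2) by (simp_all add: w(3))
        ultimately have "{y, z'} \<in> S" "{x, z'} \<in> S" by (simp_all add: E')
        then have "z' = z" using False by blast
        then have "?p \<subseteq> t'" by (simp add: w(3))
        then show ?thesis by blast
      next
        case False
        then have "t' \<subseteq> S" using t'(2) E' by blast
        moreover have "\<not> t' \<subseteq> {{x, z}}"
          using triangle_card[OF t'(1)] card_mono[of "{{x, z}}" t'] by auto
        ultimately show ?thesis using P(3)[OF t'(1)] by blast
      qed
    qed
  qed
qed

section \<open>Local density bounds the size of a core\<close>

definition sparse :: "nat \<Rightarrow> nat \<Rightarrow> nat \<Rightarrow> nat set set \<Rightarrow> bool" where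
  "sparse a b m E \<longleftrightarrow>
     (\<forall>F\<subseteq>E. F \<noteq> {} \<longrightarrow> card (\<Union>F) \<le> m \<longrightarrow> a * card F < b * card (\<Union>F))"

lemma sparse_subset: "sparse a b m E \<Longrightarrow> F \<subseteq> E \<Longrightarrow> sparse a b m F"
  by (auto simp: sparse_def)

text \<open>Growing by triangles adds at most one vertex at a time, so the number \<open>m\<close>
  of vertices is met exactly, and the excess stays at least that of a single edge.\<close>

lemma triangle_connected_subgraph:
  assumes "graph E" "triangle_connected E" "S0 \<subseteq> E" "S0 \<noteq> {}" 
    "card (\<Union>S0) \<le> m" "2 * card (\<Union>S0) \<le> card S0 + 3" "m \<le> card (\<Union>E)"
  shows "\<exists>S\<subseteq>E. S \<noteq> {} \<and> card (\<Union>S) = m \<and> 2 * m \<le> card S + 3"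
  using assms(3-6)
proof (induction "card (E - S0)" arbitrary: S0 rule: less_induct)
  case less
  show ?case
  proof (cases "card (\<Union>S0) = m")
    case True
    then show ?thesis using less.prems by (intro exI[of _ S0]) auto
  next
    case False
    then have lt: "card (\<Union>S0) < m" using less.prems by simp
    then have sub: "S0 \<subset> E" using less.prems assms(7) by (metis leD psubsetI)
    have fin: "finite E" "finite S0" using assms(1) less.prems by (auto simp: graph_def intro: finite_subset)
    have gS: "graph S0" using graph_subset[OF assms(1) less.prems(1)] .
    show ?thesis
    proof (rule triangle_connected_step[OF assms(1,2) sub less.prems(2)])
      fix a b w assume *: "{a, b} \<in> S0" "a \<noteq> b" "w \<notin> \<Union>S0" "{a, w} \<in> E" "{b, w} \<in> E"
      let ?S = "S0 \<union> {{a, w}, {b, w}}"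
      have "vgrow S0 ?S" using * by (intro vgrow_step vgrow_refl) auto
      note c = vgrow_card[OF this gS]
      have "\<Union>?S = insert w (\<Union>S0)" using * by auto
      then have c2: "card (\<Union>?S) = card (\<Union>S0) + 1" using * graph_finite_vertices[OF gS] by simp
      have "E - ?S \<subset> E - S0" using * by blast
      then have lt2: "card (E - ?S) < card (E - S0)" using fin by (intro psubset_card_mono) auto
      show ?thesis
      proof (rule less.hyps[OF lt2])
        show "card (\<Union>?S) \<le> m" using c2 lt by simp
        show "2 * card (\<Union>?S) \<le> card ?S + 3" using c less.prems(4) by linarith
      qed (use * less.prems in auto)
    next
      fix t assume *: "triangle t" "t \<subseteq> E" "t \<inter> S0 \<noteq> {}" "\<not> t \<subseteq> S0" "\<Union>t \<subseteq> \<Union>S0"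
      have "E - (S0 \<union> t) \<subset> E - S0" using * by blast
      then have lt2: "card (E - (S0 \<union> t)) < card (E - S0)" using fin by (intro psubset_card_mono) auto
      have U: "\<Union>(S0 \<union> t) = \<Union>S0" using * by blast
      have "finite (S0 \<union> t)" using * fin by (meson finite_subset less.prems(1) Un_least)
      then have "card S0 \<le> card (S0 \<union> t)" by (intro card_mono) auto
      then show ?thesis
        using * less.prems U by (intro less.hyps[OF lt2]) auto
    qed
  qed
qed

text \<open>With \<open>m\<close> or more vertices the core would contain a part with exactly
  \<open>m\<close> vertices and at least 2m - 3 edges, which the numerical assumption makes too
  dense.\<close>

lemma sparse_core_card:
  assumes "core C" "sparse a b m C" "2 \<le> m" "b * m \<le> a * (2 * m - 3)"
  shows "card (\<Union>C) < m" "a * card C < b * card (\<Union>C)"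
proof -
  have g: "graph C" "triangle_connected C" "C \<noteq> {}" using assms(1) by (auto simp: core_def)
  show lt: "card (\<Union>C) < m"
  proof (rule ccontr)
    assume "\<not> card (\<Union>C) < m"
    obtain e where e: "e \<in> C" using g by blast
    then have "card e = 2" using g by (auto simp: graph_def)
    then obtain S where S: "S \<subseteq> C" "S \<noteq> {}" "card (\<Union>S) = m" "2 * m \<le> card S + 3"
      using triangle_connected_subgraph[OF g(1,2), of "{e}" m] e assms(3) \<open>\<not> card (\<Union>C) < m\<close>
      by auto
    have "a * card S < b * m" using assms(2) S unfolding sparse_def by auto
    moreover have "a * (2 * m - 3) \<le> a * card S" using S by (intro mult_le_mono2) linarith
    ultimately show False using assms(4) by linarith
  qed
  show "a * card C < b * card (\<Union>C)" using assms(2) lt g unfolding sparse_def by simp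
qed

lemma graph_card_le:
  assumes "graph E" shows "card E \<le> card (\<Union>E) choose 2"
proof -
  have "E \<subseteq> {e. e \<subseteq> \<Union>E \<and> card e = 2}" using assms by (auto simp: graph_def)
  moreover have "finite {e. e \<subseteq> \<Union>E \<and> card e = 2}"
    using graph_finite_vertices[OF assms] by simp
  ultimately have "card E \<le> card {e. e \<subseteq> \<Union>E \<and> card e = 2}" by (rule card_mono[rotated])
  then show ?thesis by (simp add: n_subsets[OF graph_finite_vertices[OF assms]])
qed

text \<open>The bound 15 is the least m with 9m \<le> 5(2m - 3). From five vertices on, 5e < 9v
  implies e \<le> 2v - 2; on two to four vertices there are at most 2v - 2 pairs anyway.\<close>

theorem breaker_wins_sparse_triangle:
  assumes "graph E" "sparse 5 9 15 E"
  shows "breaker_wins triangle_goal {} E"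
proof (rule breaker_wins_if_cores[OF local_goal_triangle_goal assms(1)])
  fix C assume C: "C \<subseteq> E" "core C"
  note s = sparse_core_card[OF C(2) sparse_subset[OF assms(2) C(1)]]
  have "5 * card C < 9 * card (\<Union>C)" using s(2) by simp
  moreover have "card C \<le> card (\<Union>C) choose 2"
    using C(2) by (intro graph_card_le) (simp add: core_def)
  moreover have "card (\<Union>C) \<noteq> 0"
  proof -
    have g: "graph C" "C \<noteq> {}" using C(2) by (simp_all add: core_def)
    then obtain e where e: "e \<in> C" by blast
    then have "card e = 2" using g(1) by (simp add: graph_def)
    then have "\<Union>C \<noteq> {}" using e by fastforce
    then show ?thesis using graph_finite_vertices[OF g(1)] by simp
  qed
  ultimately have "card C + 2 \<le> 2 * card (\<Union>C)"
  proof -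
    assume a: "5 * card C < 9 * card (\<Union>C)" "card C \<le> card (\<Union>C) choose 2" "card (\<Union>C) \<noteq> 0"
    show ?thesis
    proof (cases "card (\<Union>C) \<ge> 5")
      case False
      have ne: "card (\<Union>C) \<noteq> 1"
      proof
        assume "card (\<Union>C) = 1"
        then have "card C \<le> 0" using a(2) by (simp add: binomial_eq_0)
        then show False using C(2) by (auto simp: core_def graph_def)
      qed
      then have "card (\<Union>C) = 2 \<or> card (\<Union>C) = 3 \<or> card (\<Union>C) = 4" using False a(3) by linarith
      then show ?thesis using a(2) by (auto simp: choose_two)
    qed (use a in linarith)
  qed
  then show "breaker_wins triangle_goal {} C" by (rule breaker_wins_sparse_core[OF C(2)])
qed

subsection \<open>Certified Breaker strategies\<close>

datatype vertex = V0 | V1 | V2 | V3 | V4 | V5 | V6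

type_synonym arc = "vertex \<times> vertex"

fun mem :: "arc list \<Rightarrow> arc \<Rightarrow> bool" where
  "mem [] a \<longleftrightarrow> False"
| "mem (b # bs) a \<longleftrightarrow> (if fst a = fst b \<and> snd a = snd b then True else mem bs a)"

definition mem_edge :: "arc list \<Rightarrow> arc \<Rightarrow> bool" where
  "mem_edge c a \<longleftrightarrow> mem c a \<or> mem c (snd a, fst a)"

text \<open>Arcs of a graph list point from lower to higher rank, so a triangle shows up as
  \<open>(a, b)\<close>, \<open>(b, d)\<close>, \<open>(a, d)\<close>. Its two cyclic orientations
  are Maker's two ways to win on it.\<close>

definition cycles :: "arc list \<Rightarrow> arc list list" where
  "cycles g = concat (map (\<lambda>(a, b). concat (map (\<lambda>(c, d).
      if c = b \<and> mem g (a, d)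
      then [[(a, b), (b, d), (d, a)], [(b, a), (d, b), (a, d)]] else []) g)) g)"

text \<open>A position is given by the list of triples of arcs that Maker can still complete, each reduced to
  the arcs that she does not own yet. \<open>Pairs\<close> is a pairing strategy; an entry \<open>(as, f, c)\<close> of \<open>Reply\<close>
  answers each Maker arc in \<open>as\<close> by the edge \<open>f\<close> and goes on with \<open>c\<close>; \<open>Split E c1 c2\<close> plays
  separately on the edges in and outside \<open>E\<close>.\<close>

datatype cert =
    Pairs "(arc \<times> arc) list"
  | Reply "(arc list \<times> arc \<times> cert) list"
  | Split "arc list" cert cert

fun play :: "arc \<Rightarrow> arc \<Rightarrow> arc list list \<Rightarrow> arc list list" where
  "play a f [] = []"
| "play a f (c # S) = (if mem c (snd a, fst a) \<or> mem_edge c f then play a f S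
     else filter (\<lambda>b. \<not> (fst a = fst b \<and> snd a = snd b)) c # play a f S)"

fun distinct_edges :: "arc list \<Rightarrow> bool" where
  "distinct_edges [] \<longleftrightarrow> True"
| "distinct_edges (a # as) \<longleftrightarrow> \<not> mem_edge as a \<and> distinct_edges as"

text \<open>An empty triple, meaning that Maker has won, is rejected by \<open>Pairs\<close> and
  \<open>Reply\<close> and handed to \<open>c2\<close> by \<open>Split\<close>. In
  \<open>Reply\<close> only arcs that still occur in some triple require an answer; to any other arc
  Breaker passes. \<open>Pairs []\<close> certifies exactly the position without triples.\<close>

fun check :: "cert \<Rightarrow> arc list list \<Rightarrow> bool" where
  "check (Pairs ps) S \<longleftrightarrow>
     distinct_edges (concat (map (\<lambda>(p, q). [p, q]) ps)) \<and>
     list_all (\<lambda>c. list_ex (\<lambda>(p, q). mem_edge c p \<and> mem_edge c q) ps) S"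
| "check (Split E c1 c2) S \<longleftrightarrow>
     list_all (\<lambda>c. list_all (mem_edge E) c \<or> list_all (\<lambda>e. \<not> mem_edge E e) c) S \<and>
     check c1 (filter (list_ex (mem_edge E)) S) \<and>
     check c2 (filter (list_all (\<lambda>e. \<not> mem_edge E e)) S)"
| "check (Reply rs) S \<longleftrightarrow>
     (let cov = concat (map fst rs) in
       list_all (\<lambda>c. c \<noteq> [] \<and> list_all (mem cov) c) S \<and>
       list_all (\<lambda>(as, f, c). list_all (\<lambda>a. \<not> mem_edge [a] f \<and> check c (play a f S)) as) rs)"

section \<open>Soundness of the certificates\<close>

lemma mem_iff: "mem c a \<longleftrightarrow> a \<in> set c"
  by (induction c) (auto simp: prod_eq_iff)

lemma mem_edge_iff: "mem_edge c a \<longleftrightarrow> a \<in> set c \<or> prod.swap a \<in> set c"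
  by (simp add: mem_edge_def mem_iff prod.swap_def)

lemma set_play:
  "set (play a f S) = (\<lambda>c. filter (\<lambda>b. b \<noteq> a) c) ` {c \<in> set S. prod.swap a \<notin> set c \<and> \<not> mem_edge c f}"
proof (induction S)
  case (Cons c S)
  have "filter (\<lambda>b. \<not> (fst a = fst b \<and> snd a = snd b)) c = filter (\<lambda>b. b \<noteq> a) c"
    by (intro filter_cong) (auto simp: prod_eq_iff)
  moreover have "mem c (snd a, fst a) \<longleftrightarrow> prod.swap a \<in> set c"
    by (simp add: mem_iff prod.swap_def)
  ultimately show ?case using Cons by auto
qed simp

text \<open>The vertex type is left open because Breaker's certificates speak about
  \<open>vertex\<close> and Maker's plans about \<open>nat\<close>. Injectivity is available only on
  \<open>A\<close>, the vertices of the graph at hand, which is why the arcs of a position have to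
  lie in \<open>A \<times> A\<close>.\<close>

locale embedding =
  fixes f :: "'v \<Rightarrow> nat" and A :: "'v set"
  assumes inj: "inj_on f A"
begin

abbreviation img :: "'v \<times> 'v \<Rightarrow> nat \<times> nat" where "img \<equiv> map_prod f f"

definition goal :: "('v \<times> 'v) list list \<Rightarrow> nat rel \<Rightarrow> bool" where
  "goal S X \<longleftrightarrow> (\<exists>c\<in>set S. img ` set c \<subseteq> X)"

definition wf_arcs :: "('v \<times> 'v) list list \<Rightarrow> bool" where
  "wf_arcs S \<longleftrightarrow> (\<forall>c\<in>set S. \<forall>a\<in>set c. a \<in> A \<times> A \<and> fst a \<noteq> snd a)"

lemma undir_img_eq:
  assumes "a \<in> A \<times> A" "b \<in> A \<times> A"
  shows "undir (img a) = undir (img b) \<longleftrightarrow> a = b \<or> a = prod.swap b"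
  using assms inj_onD[OF inj] by (cases a; cases b) (auto simp: doubleton_eq_iff)

lemma undir_swap: "undir (prod.swap a) = undir a"
  by (cases a) (auto simp: insert_commute)

lemma img_swap: "img (prod.swap a) = prod.swap (img a)"
  by (cases a) simp

lemma img_eq:
  assumes "a \<in> A \<times> A" "b \<in> A \<times> A" "img a = img b"
  shows "a = b"
  using assms inj_onD[OF inj] by (cases a; cases b) auto

lemma swap_in: "a \<in> A \<times> A \<Longrightarrow> prod.swap a \<in> A \<times> A"
  by (cases a) simp

end

lemma disjoint_pairs_insert:
  assumes "disjoint_pairs P" "p \<noteq> q" "\<And>r. r \<in> P \<Longrightarrow> p \<notin> r \<and> q \<notin> r"
  shows "disjoint_pairs (insert {p, q} P)"
  using assms by (auto simp: disjoint_pairs_def)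

locale vertex_embedding = embedding f A for f :: "vertex \<Rightarrow> nat" and A
begin

text \<open>Pairs with an arc outside \<open>A \<times> A\<close> are discarded, since the images of
  such arcs could collide; triples over \<open>A\<close> never contain them.\<close>

lemma disjoint_pairs_list:
  assumes "distinct_edges (concat (map (\<lambda>(p, q). [p, q]) ps))"
  shows "disjoint_pairs ((\<lambda>(p, q). {undir (img p), undir (img q)}) `
           {(p, q). (p, q) \<in> set ps \<and> p \<in> A \<times> A \<and> q \<in> A \<times> A})"
  using assms
proof (induction ps)
  case Nil
  show ?case by (simp add: disjoint_pairs_def)
next
  case (Cons x ps)
  obtain p q where x: "x = (p, q)" by (cases x)
  let ?P = "\<lambda>ps. (\<lambda>(p, q). {undir (img p), undir (img q)}) `
           {(p, q). (p, q) \<in> set ps \<and> p \<in> A \<times> A \<and> q \<in> A \<times> A}"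
  let ?l = "concat (map (\<lambda>(p, q). [p, q]) ps)"
  have IH: "disjoint_pairs (?P ps)" using Cons by (simp add: x)
  have nm: "\<not> mem_edge (q # ?l) p" "\<not> mem_edge ?l q" using Cons.prems by (auto simp: x)
  show ?case
  proof (cases "p \<in> A \<times> A \<and> q \<in> A \<times> A")
    case True
    have "{(p', q'). (p', q') \<in> set (x # ps) \<and> p' \<in> A \<times> A \<and> q' \<in> A \<times> A} =
        insert (p, q) {(p', q'). (p', q') \<in> set ps \<and> p' \<in> A \<times> A \<and> q' \<in> A \<times> A}"
      using True by (auto simp: x)
    then have eq: "?P (x # ps) = insert {undir (img p), undir (img q)} (?P ps)" by simp
    have ne: "undir (img p) \<noteq> undir (img q)"
      using nm(1) True undir_img_eq[of p q] by (auto simp: mem_edge_iff)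
    have fresh: "undir (img p) \<notin> r \<and> undir (img q) \<notin> r" if r: "r \<in> ?P ps" for r
    proof -
      obtain p' q' where pq: "(p', q') \<in> set ps" "p' \<in> A \<times> A" "q' \<in> A \<times> A"
        "r = {undir (img p'), undir (img q')}" using r by auto
      have l: "p' \<in> set ?l \<and> q' \<in> set ?l" using pq(1) by (induction ps) auto
      have "undir (img s) \<noteq> undir (img s')"
        if s: "s \<in> A \<times> A" "\<not> mem_edge ?l s" "s' \<in> A \<times> A" "s' \<in> set ?l" for s s'
      proof -
        have "s' \<noteq> s" "s' \<noteq> prod.swap s" using s(2,4) by (auto simp only: mem_edge_iff)
        then show ?thesis using undir_img_eq[OF s(1,3)] by (metis swap_swap)
      qed
      moreover have "\<not> mem_edge ?l p" using nm(1) by (simp add: mem_edge_iff)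
      ultimately show ?thesis using pq(2,3) nm(2) True l by (simp add: pq(4))
    qed
    show ?thesis unfolding eq by (rule disjoint_pairs_insert[OF IH ne fresh])
  next
    case False
    then have "{(p', q'). (p', q') \<in> set (x # ps) \<and> p' \<in> A \<times> A \<and> q' \<in> A \<times> A} =
        {(p', q'). (p', q') \<in> set ps \<and> p' \<in> A \<times> A \<and> q' \<in> A \<times> A}"
      by (auto simp: x)
    then show ?thesis using IH by simp
  qed
qed

text \<open>Certificates record only the arcs that Maker still lacks. An arc already played is
  therefore removed from the digraph and from the goal, and the game restarts from the empty
  digraph.\<close>

lemma breaker_wins_shift:
  assumes "finite F" "breaker_wins W' {} F"
    and "\<And>Y. D \<subseteq> Y \<Longrightarrow> undir ` (Y - D) \<subseteq> F \<Longrightarrow> W Y \<Longrightarrow> W' (Y - D)"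
    and "D = {a}" "undir a \<notin> F"
  shows "breaker_wins W D F"
proof -
  have "breaker_wins (\<lambda>_. False) D {}" by (rule breaker_winsI) auto
  have "breaker_wins W (D \<union> {}) ({} \<union> F)"
  proof (rule breaker_wins_union[OF _ assms(1) \<open>breaker_wins (\<lambda>_. False) D {}\<close> assms(2)])
    fix X Y assume "D \<subseteq> X" "undir ` (X - D) \<subseteq> {}" "undir ` (Y - {}) \<subseteq> F" "W (X \<union> Y)"
    moreover from this have "X = D" "D \<inter> Y = {}" using assms(4,5) by auto
    ultimately show "False \<or> W' Y" using assms(3)[of "D \<union> Y"]
      by (metis Diff_cancel Diff_empty Un_Diff Un_upper1 Un_empty_left Diff_triv inf_commute)
  qed auto
  then show ?thesis by simp
qed

lemma check_sound:
  assumes "check c S" "wf_arcs S" "finite F"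
  shows "breaker_wins (goal S) {} F"
  using assms
proof (induction c arbitrary: S F)
  case (Pairs ps)
  let ?P = "(\<lambda>(p, q). {undir (img p), undir (img q)}) `
           {(p, q). (p, q) \<in> set ps \<and> p \<in> A \<times> A \<and> q \<in> A \<times> A}"
  have "disjoint_pairs ?P" using Pairs.prems(1) by (intro disjoint_pairs_list) simp
  from breaker_wins_pairs[OF this Pairs.prems(3)] show ?case
  proof (rule breaker_wins_weaken)
    fix Y assume "goal S Y"
    then obtain c where c: "c \<in> set S" "img ` set c \<subseteq> Y" by (auto simp: goal_def)
    with Pairs.prems(1) obtain p q where pq: "(p, q) \<in> set ps" "mem_edge c p" "mem_edge c q"
      by (auto simp: list_all_iff list_ex_iff)
    have arc: "s \<in> A \<times> A \<and> undir (img s) \<in> undir ` Y" if "mem_edge c s" for s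
    proof -
      from that consider "s \<in> set c" | "prod.swap s \<in> set c" by (auto simp: mem_edge_iff)
      then show ?thesis
      proof cases
        case 1
        then show ?thesis using c Pairs.prems(2) by (auto simp: wf_arcs_def)
      next
        case 2
        then have "prod.swap s \<in> A \<times> A" using c Pairs.prems(2) by (auto simp: wf_arcs_def)
        then have "s \<in> A \<times> A" by (cases s) simp
        moreover have "img (prod.swap s) \<in> Y" using 2 c by blast
        then have "undir (img s) \<in> undir ` Y" using undir_swap[of "img s"]
          by (metis image_eqI img_swap)
        ultimately show ?thesis by simp
      qed
    qed
    show "\<exists>p\<in>?P. p \<subseteq> undir ` Y"
      by (rule bexI[of _ "{undir (img p), undir (img q)}"])
        (use pq arc[OF pq(2)] arc[OF pq(3)] in auto)
  qed
next
  case (Split E c1 c2)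
  let ?S1 = "filter (list_ex (mem_edge E)) S" and ?S2 = "filter (list_all (\<lambda>e. \<not> mem_edge E e)) S"
  let ?U = "(\<lambda>e. undir (img e)) ` (set E \<inter> A \<times> A)"
  have U: "undir (img a) \<in> ?U \<longleftrightarrow> mem_edge E a" if a: "a \<in> A \<times> A" for a
  proof
    assume "undir (img a) \<in> ?U"
    then obtain e where "e \<in> set E" "e \<in> A \<times> A" "undir (img a) = undir (img e)" by auto
    then show "mem_edge E a" using undir_img_eq[OF a, of e] by (auto simp: mem_edge_iff)
  next
    assume "mem_edge E a"
    then consider "a \<in> set E" | "prod.swap a \<in> set E" by (auto simp: mem_edge_iff)
    then show "undir (img a) \<in> ?U"
    proof cases
      case 1
      with a have "a \<in> set E \<inter> A \<times> A" by (rule IntI[rotated])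
      then show ?thesis by (rule imageI)
    next
      case 2
      then have "prod.swap a \<in> set E \<inter> A \<times> A" using swap_in[OF a] by (rule IntI)
      then have "undir (img (prod.swap a)) \<in> ?U" by (rule imageI)
      then show ?thesis by (simp only: img_swap undir_swap)
    qed
  qed
  have wf: "wf_arcs ?S1" "wf_arcs ?S2" using Split.prems(2) by (auto simp: wf_arcs_def)
  have "breaker_wins (goal S) ({} \<union> {}) ((F \<inter> ?U) \<union> (F - ?U))"
  proof (rule breaker_wins_union)
    show "breaker_wins (goal ?S1) {} (F \<inter> ?U)"
      using Split.prems by (intro Split.IH(1) wf) auto
    show "breaker_wins (goal ?S2) {} (F - ?U)"
      using Split.prems by (intro Split.IH(2) wf) auto
    fix X Y assume X: "undir ` (X - {}) \<subseteq> F \<inter> ?U" and Y: "undir ` (Y - {}) \<subseteq> F - ?U"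
      and "goal S (X \<union> Y)"
    then obtain c where c: "c \<in> set S" "img ` set c \<subseteq> X \<union> Y" by (auto simp: goal_def)
    have cA: "a \<in> A \<times> A" if "a \<in> set c" for a using that c(1) Split.prems(2) by (auto simp: wf_arcs_def)
    from Split.prems(1) c(1)
    have "list_all (mem_edge E) c \<or> list_all (\<lambda>e. \<not> mem_edge E e) c"
      by (simp add: list_all_iff[of _ S])
    \<comment> \<open>An empty triple satisfies both alternatives vacuously; it is counted with the
      second board, whose filter keeps it.\<close>
    then have "list_all (mem_edge E) c \<and> list_ex (mem_edge E) c \<or> list_all (\<lambda>e. \<not> mem_edge E e) c"
      by (cases c) auto
    then consider "list_all (mem_edge E) c" "list_ex (mem_edge E) c"
      | "list_all (\<lambda>e. \<not> mem_edge E e) c" by blast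
    then show "goal ?S1 X \<or> goal ?S2 Y"
    proof cases
      case 1
      have "img a \<in> X" if "a \<in> set c" for a
      proof -
        have "undir (img a) \<in> ?U" using U[OF cA[OF that]] 1 that by (auto simp: list_all_iff)
        then have "img a \<notin> Y" using Y by auto
        then show ?thesis using that c(2) by auto
      qed
      then have "goal ?S1 X" unfolding goal_def using c(1) 1(2) by (intro bexI[of _ c]) auto
      then show ?thesis ..
    next
      case 2
      have "img a \<in> Y" if "a \<in> set c" for a
      proof -
        have "undir (img a) \<notin> ?U" using U[OF cA[OF that]] 2 that by (auto simp: list_all_iff)
        then have "img a \<notin> X" using X by auto
        then show ?thesis using that c(2) by auto
      qed
      then have "goal ?S2 Y" unfolding goal_def using c(1) 2 by (intro bexI[of _ c]) auto
      then show ?thesis ..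
    qed
  qed (use Split.prems(3) in auto)
  moreover have "(F \<inter> ?U) \<union> (F - ?U) = F" by blast
  ultimately show ?case by simp
next
  case (Reply rs)
  have cov: "c \<noteq> [] \<and> (\<forall>a\<in>set c. \<exists>as g k. (as, g, k) \<in> set rs \<and> a \<in> set as)" if "c \<in> set S" for c
    using that Reply.prems(1) by (fastforce simp: Let_def list_all_iff mem_iff)
  have rep: "\<not> mem_edge [a] g \<and> check k (play a g S)" if "(as, g, k) \<in> set rs" "a \<in> set as" for as g k a
    using that Reply.prems(1) by (auto simp: Let_def list_all_iff)
  \<comment> \<open>An inner induction on the board is needed because an arc that occurs in no
    triple is answered by a pass and leaves the same certificate in force.\<close>
  show ?case using Reply.prems(3)
  proof (induction "card F" arbitrary: F rule: less_induct)
    case less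
    show ?case
    proof (rule breaker_winsI)
      show "\<not> goal S {}" using cov by (auto simp: goal_def)
      fix a' assume a': "undir a' \<in> F"
      show "\<exists>e. breaker_wins (goal S) {a'} (F - {undir a'} - {e})"
      proof (cases "\<exists>c\<in>set S. \<exists>a\<in>set c. a' = img a")
        case True
        then obtain c0 a where a: "c0 \<in> set S" "a \<in> set c0" "a' = img a" by blast
        then have aA: "a \<in> A \<times> A" and loop: "fst a \<noteq> snd a"
          using Reply.prems(2) by (auto simp: wf_arcs_def)
        from cov a obtain as g k where r: "(as, g, k) \<in> set rs" "a \<in> set as" by blast
        let ?F = "F - {undir a'} - {undir (img g)}"
        have wf: "wf_arcs (play a g S)" unfolding wf_arcs_def
        proof (intro ballI)
          fix c' b assume "c' \<in> set (play a g S)" "b \<in> set c'"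
          then obtain c where "c \<in> set S" "b \<in> set c" by (auto simp: set_play)
          then show "b \<in> A \<times> A \<and> fst b \<noteq> snd b" using Reply.prems(2) unfolding wf_arcs_def by blast
        qed
        have "breaker_wins (goal (play a g S)) {} ?F"
          using less.prems rep[OF r] wf
          by (intro Reply.IH[OF r(1), of "(g, k)" k]) auto
        then have "breaker_wins (goal S) {a'} ?F"
        proof (rule breaker_wins_shift[rotated])
          fix Y assume Y: "{a'} \<subseteq> Y" "undir ` (Y - {a'}) \<subseteq> ?F" and "goal S Y"
          then obtain c where c: "c \<in> set S" "img ` set c \<subseteq> Y" by (auto simp: goal_def)
          have cA: "b \<in> A \<times> A" if "b \<in> set c" for b
            using that c(1) Reply.prems(2) by (auto simp: wf_arcs_def)
          have inF: "undir (img b) \<in> ?F" if "b \<in> set c" "b \<noteq> a" for b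
          proof -
            have "img b \<noteq> a'" using img_eq[OF cA[OF that(1)] aA] that(2) a(3) by blast
            then show ?thesis using that c(2) Y(2) by blast
          qed
          \<comment> \<open>Maker cannot own both orientations of an edge: the other arcs of
            \<open>Y\<close> come from \<open>?F\<close>, which excludes the edge of
            \<open>a\<close>.\<close>
          have "prod.swap a \<notin> set c"
          proof
            assume s: "prod.swap a \<in> set c"
            have "prod.swap a \<noteq> a" using loop by (cases a) auto
            from inF[OF s this] show False using a(3) by (simp add: img_swap undir_swap)
          qed
          moreover have "\<not> mem_edge c g"
          proof
            assume "mem_edge c g"
            then obtain b where b: "b \<in> set c" "b = g \<or> b = prod.swap g"
              unfolding mem_edge_iff by blast
            then have "b \<noteq> a" using rep[OF r] by (auto simp: mem_edge_iff)
            from inF[OF b(1) this] b(2) show False by (auto simp: img_swap undir_swap)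
          qed
          ultimately have "filter (\<lambda>b. b \<noteq> a) c \<in> set (play a g S)" using c(1) by (auto simp: set_play)
          moreover have "img ` set (filter (\<lambda>b. b \<noteq> a) c) \<subseteq> Y - {a'}"
          proof
            fix y assume "y \<in> img ` set (filter (\<lambda>b. b \<noteq> a) c)"
            then obtain b where b: "b \<in> set c" "b \<noteq> a" "y = img b" by auto
            have "y \<noteq> a'" using img_eq[OF cA[OF b(1)] aA] b(2,3) a(3) by auto
            moreover have "y \<in> Y" using b c(2) by auto
            ultimately show "y \<in> Y - {a'}" by simp
          qed
          ultimately show "goal (play a g S) (Y - {a'})" unfolding goal_def by blast
        qed (use less.prems in auto)
        then show ?thesis by blast
      next
        case False
        have "card (F - {undir a'}) < card F" using a' less.prems by (intro psubset_card_mono) auto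
        then have "breaker_wins (goal S) {} (F - {undir a'})"
          using less.prems by (intro less.hyps) auto
        then have "breaker_wins (goal S) {a'} (F - {undir a'})"
        proof (rule breaker_wins_shift[rotated])
          fix Y assume "goal S Y"
          then obtain c where c: "c \<in> set S" "img ` set c \<subseteq> Y" by (auto simp: goal_def)
          have "a' \<notin> img ` set c" using False c(1) by (metis imageE)
          with c(2) have "img ` set c \<subseteq> Y - {a'}" by (simp add: subset_Diff_insert)
          with c(1) show "goal S (Y - {a'})" unfolding goal_def by (rule bexI[rotated])
        qed (use less.prems in auto)
        then show ?thesis by (intro exI[of _ "undir a'"]) simp
      qed
    qed
  qed
qed

end

subsection \<open>Enumeration of the dense cores\<close>

definition vertices :: "nat \<Rightarrow> vertex list" where
  "vertices v = take v [V0, V1, V2, V3, V4, V5, V6]"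

definition next_vertex :: "nat \<Rightarrow> vertex" where
  "next_vertex v = [V0, V1, V2, V3, V4, V5, V6] ! v"

fun combinations :: "nat \<Rightarrow> 'a list \<Rightarrow> 'a list list" where
  "combinations 0 xs = [[]]"
| "combinations (Suc n) [] = []"
| "combinations (Suc n) (x # xs) = map ((#) x) (combinations n xs) @ combinations (Suc n) xs"

fun has_edge :: "arc list \<Rightarrow> vertex list \<Rightarrow> bool" where
  "has_edge g [] \<longleftrightarrow> False"
| "has_edge g (x # xs) \<longleftrightarrow> list_ex (\<lambda>y. mem_edge g (x, y)) xs \<or> has_edge g xs"

text \<open>The new vertex receives all its neighbours at once, so the lists describe induced
  subgraphs; \<open>has_edge\<close> expresses that it forms a triangle with an edge already
  present.\<close>

definition extensions :: "nat \<Rightarrow> nat \<Rightarrow> arc list \<Rightarrow> arc list list" where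
  "extensions r v g = map (\<lambda>N. map (\<lambda>i. (i, next_vertex v)) N @ g)
     (filter (has_edge g) (combinations r (vertices v)))"

fun same_edges :: "arc list \<Rightarrow> arc list \<Rightarrow> arc list \<Rightarrow> bool" where
  "same_edges g h [] \<longleftrightarrow> True"
| "same_edges g h ((x, x') # z) \<longleftrightarrow>
     list_all (\<lambda>(y, y'). mem_edge g (x, y) = mem_edge h (x', y')) z \<and> same_edges g h z"

fun rank :: "vertex \<Rightarrow> nat" where
  "rank V0 = 0" | "rank V1 = 1" | "rank V2 = 2" | "rank V3 = 3" | "rank V4 = 4" | "rank V5 = 5" | "rank V6 = 6"

definition wf_graph :: "nat \<Rightarrow> arc list \<Rightarrow> bool" where
  "wf_graph v g \<longleftrightarrow> list_all (\<lambda>(a, b). rank a < rank b \<and>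
     List.member (vertices v) a \<and> List.member (vertices v) b) g"

text \<open>The \<open>i\<close>-th vertex of \<open>g\<close> corresponds to the vertex \<open>p ! i\<close> of \<open>h\<close>.\<close>

definition isomorphism :: "nat \<Rightarrow> vertex list \<Rightarrow> arc list \<Rightarrow> arc list \<Rightarrow> bool" where
  "isomorphism v p g h \<longleftrightarrow> length p = v \<and> distinct p \<and>
     list_all (List.member (vertices v)) p \<and> same_edges g h (zip (vertices v) p) \<and> wf_graph v g"

fun at_least_3 :: "'a list \<Rightarrow> bool" where
  "at_least_3 (x # y # z # xs) = True"
| "at_least_3 _ = False"

text \<open>Two properties shared by all cores, used to prune the last extension step. As graph
  lists have no loops, \<open>z\<close> differs from \<open>a\<close> and \<open>b\<close>.\<close>

definition core_like :: "nat \<Rightarrow> arc list \<Rightarrow> bool" where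
  "core_like v g \<longleftrightarrow>
     list_all (\<lambda>x. at_least_3 (filter (\<lambda>(a, b). a = x \<or> b = x) g)) (vertices v) \<and>
     list_all (\<lambda>(a, b). list_ex (\<lambda>z. mem_edge g (a, z) \<and> mem_edge g (b, z)) (vertices v)) g"

text \<open>\<open>level v k\<close> lists, up to isomorphism, the induced subgraphs with \<open>v\<close> vertices and
  \<open>2 * v - 3 + k\<close> edges that arise from a triangle by repeatedly adding a vertex adjacent to both ends
  of an edge. Since the last vertex of a core has degree at least 3, only \<open>k \<le> 1\<close> can occur before the
  last step.\<close>

definition level :: "nat \<Rightarrow> nat \<Rightarrow> arc list list" where
  "level v k = (
   if v = 3 \<and> k = 0 then [
    [(V0, V1), (V0, V2), (V1, V2)]]
   else if v = 4 \<and> k = 0 then [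
    [(V0, V2), (V0, V3), (V1, V2), (V1, V3), (V2, V3)]]
   else if v = 4 \<and> k = 1 then [
    [(V0, V1), (V0, V2), (V0, V3), (V1, V2), (V1, V3), (V2, V3)]]
   else if v = 5 \<and> k = 0 then [
    [(V0, V2), (V0, V4), (V1, V3), (V1, V4), (V2, V3), (V2, V4), (V3, V4)],
    [(V0, V3), (V0, V4), (V1, V3), (V1, V4), (V2, V3), (V2, V4), (V3, V4)]]
   else if v = 5 \<and> k = 1 then [
    [(V0, V1), (V0, V2), (V0, V4), (V1, V3), (V1, V4), (V2, V3), (V2, V4), (V3, V4)],
    [(V0, V3), (V0, V4), (V1, V2), (V1, V3), (V1, V4), (V2, V3), (V2, V4), (V3, V4)]]
   else if v = 6 \<and> k = 0 then [
    [(V0, V2), (V0, V4), (V1, V3), (V1, V5), (V2, V4), (V2, V5), (V3, V4), (V3, V5), (V4, V5)],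
    [(V0, V2), (V0, V5), (V1, V3), (V1, V5), (V2, V4), (V2, V5), (V3, V4), (V3, V5), (V4, V5)],
    [(V0, V3), (V0, V4), (V1, V3), (V1, V5), (V2, V4), (V2, V5), (V3, V4), (V3, V5), (V4, V5)],
    [(V0, V3), (V0, V5), (V1, V4), (V1, V5), (V2, V4), (V2, V5), (V3, V4), (V3, V5), (V4, V5)],
    [(V0, V4), (V0, V5), (V1, V4), (V1, V5), (V2, V4), (V2, V5), (V3, V4), (V3, V5), (V4, V5)]]
   else if v = 6 \<and> k = 1 then [
    [(V0, V1), (V0, V2), (V0, V4), (V1, V3), (V1, V5), (V2, V4), (V2, V5), (V3, V4), (V3, V5), (V4, V5)],
    [(V0, V1), (V0, V2), (V0, V5), (V1, V3), (V1, V5), (V2, V4), (V2, V5), (V3, V4), (V3, V5), (V4, V5)],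
    [(V0, V3), (V0, V4), (V1, V2), (V1, V3), (V1, V5), (V2, V4), (V2, V5), (V3, V4), (V3, V5), (V4, V5)],
    [(V0, V1), (V0, V5), (V1, V4), (V1, V5), (V2, V3), (V2, V4), (V2, V5), (V3, V4), (V3, V5), (V4, V5)],
    [(V0, V4), (V0, V5), (V1, V2), (V1, V3), (V1, V5), (V2, V4), (V2, V5), (V3, V4), (V3, V5), (V4, V5)],
    [(V0, V3), (V0, V5), (V1, V4), (V1, V5), (V2, V3), (V2, V4), (V2, V5), (V3, V4), (V3, V5), (V4, V5)],
    [(V0, V4), (V0, V5), (V1, V4), (V1, V5), (V2, V3), (V2, V4), (V2, V5), (V3, V4), (V3, V5), (V4, V5)],
    [(V0, V2), (V0, V3), (V1, V4), (V1, V5), (V2, V3), (V2, V4), (V2, V5), (V3, V4), (V3, V5), (V4, V5)]]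
   else [])"

text \<open>Representatives for the cores with \<open>v\<close> vertices and 2v - 1 edges: one for
  five, four for six and ten for seven vertices. The entry for five is \<open>K5\<close> minus an
  edge.\<close>

definition candidates :: "nat \<Rightarrow> arc list list" where
  "candidates v = (
   if v = 5 then [
    [(V0, V2), (V0, V3), (V0, V4), (V1, V2), (V1, V3), (V1, V4), (V2, V3), (V2, V4), (V3, V4)]]
   else if v = 6 then [
    [(V0, V2), (V0, V3), (V0, V4), (V1, V2), (V1, V3), (V1, V5), (V2, V4), (V2, V5), (V3, V4), (V3, V5), (V4, V5)],
    [(V0, V1), (V0, V3), (V0, V5), (V1, V4), (V1, V5), (V2, V3), (V2, V4), (V2, V5), (V3, V4), (V3, V5), (V4, V5)],
    [(V0, V3), (V0, V4), (V0, V5), (V1, V3), (V1, V4), (V1, V5), (V2, V3), (V2, V4), (V2, V5), (V3, V5), (V4, V5)],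
    [(V0, V1), (V0, V4), (V0, V5), (V1, V4), (V1, V5), (V2, V3), (V2, V4), (V2, V5), (V3, V4), (V3, V5), (V4, V5)]]
   else if v = 7 then [
    [(V0, V2), (V0, V3), (V0, V4), (V1, V2), (V1, V5), (V1, V6), (V2, V3), (V2, V5), (V3, V4), (V3, V6), (V4, V5), (V4, V6), (V5, V6)],
    [(V0, V1), (V0, V3), (V0, V6), (V1, V4), (V1, V6), (V2, V3), (V2, V4), (V2, V5), (V3, V5), (V3, V6), (V4, V5), (V4, V6), (V5, V6)],
    [(V0, V2), (V0, V4), (V0, V5), (V1, V3), (V1, V4), (V1, V6), (V2, V5), (V2, V6), (V3, V5), (V3, V6), (V4, V5), (V4, V6), (V5, V6)],
    [(V0, V3), (V0, V4), (V0, V6), (V1, V3), (V1, V5), (V1, V6), (V2, V4), (V2, V5), (V2, V6), (V3, V4), (V3, V5), (V4, V6), (V5, V6)],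
    [(V0, V1), (V0, V2), (V0, V6), (V1, V4), (V1, V6), (V2, V5), (V2, V6), (V3, V4), (V3, V5), (V3, V6), (V4, V5), (V4, V6), (V5, V6)],
    [(V0, V1), (V0, V4), (V0, V6), (V1, V5), (V1, V6), (V2, V3), (V2, V4), (V2, V6), (V3, V5), (V3, V6), (V4, V5), (V4, V6), (V5, V6)],
    [(V0, V1), (V0, V4), (V0, V6), (V1, V5), (V1, V6), (V2, V4), (V2, V5), (V2, V6), (V3, V4), (V3, V5), (V3, V6), (V4, V6), (V5, V6)],
    [(V0, V1), (V0, V4), (V0, V5), (V1, V4), (V1, V6), (V2, V3), (V2, V5), (V2, V6), (V3, V5), (V3, V6), (V4, V5), (V4, V6), (V5, V6)],
    [(V0, V1), (V0, V4), (V0, V6), (V1, V4), (V1, V6), (V2, V3), (V2, V5), (V2, V6), (V3, V5), (V3, V6), (V4, V5), (V4, V6), (V5, V6)],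
    [(V0, V1), (V0, V2), (V0, V6), (V1, V5), (V1, V6), (V2, V5), (V2, V6), (V3, V4), (V3, V5), (V3, V6), (V4, V5), (V4, V6), (V5, V6)]]
   else [])"

text \<open>No isomorphism is searched for: \<open>ps\<close> supplies, in the order in which the
  extensions are produced, the index of a representative and the vertex map from it.\<close>

definition growth_check :: "nat \<Rightarrow> nat \<Rightarrow> nat \<Rightarrow> nat \<Rightarrow> (nat \<times> vertex list) list \<Rightarrow> bool" where
  "growth_check v k r k' ps \<longleftrightarrow> (let L = level (Suc v) k' in
     list_all2 (\<lambda>h (i, p). i < length L \<and> isomorphism (Suc v) p (L ! i) h)
       (concat (map (extensions r v) (level v k))) ps)"

definition final_check :: "nat \<Rightarrow> nat \<Rightarrow> nat \<Rightarrow> (nat \<times> vertex list) list \<Rightarrow> bool" where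
  "final_check v k r ps \<longleftrightarrow> (let L = candidates (Suc v) in
     list_all2 (\<lambda>h (i, p). i < length L \<and> isomorphism (Suc v) p (L ! i) h)
       (filter (core_like (Suc v)) (concat (map (extensions r v) (level v k)))) ps)"

section \<open>Completeness of the enumeration\<close>

text \<open>A new vertex of degree \<open>r\<close> adds \<open>r\<close> edges while
  \<open>2 * v - 3\<close> rises by 2, so \<open>k\<close> becomes \<open>k + r - 2\<close>. The
  growth checks cover all cases with \<open>k + r \<le> 3\<close>.\<close>

lemma growth_3_0_2:
  "growth_check 3 0 2 (0) [
    (0, [V2, V3, V0, V1]),
    (0, [V1, V3, V0, V2]),
    (0, [V0, V3, V1, V2])]"
  by code_simp

lemma growth_3_0_3:
  "growth_check 3 0 3 (1) [
    (0, [V0, V1, V2, V3])]"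
  by code_simp

lemma growth_4_0_2:
  "growth_check 4 0 2 (0) [
    (0, [V1, V4, V3, V0, V2]),
    (0, [V1, V4, V2, V0, V3]),
    (0, [V0, V4, V3, V1, V2]),
    (0, [V0, V4, V2, V1, V3]),
    (1, [V0, V1, V4, V2, V3])]"
  by code_simp

lemma growth_4_0_3:
  "growth_check 4 0 3 (1) [
    (0, [V0, V3, V4, V1, V2]),
    (0, [V0, V2, V4, V1, V3]),
    (1, [V1, V0, V4, V2, V3]),
    (1, [V0, V1, V4, V2, V3])]"
  by code_simp

lemma growth_4_1_2:
  "growth_check 4 1 2 (1) [
    (1, [V4, V2, V3, V0, V1]),
    (1, [V4, V1, V3, V0, V2]),
    (1, [V4, V1, V2, V0, V3]),
    (1, [V4, V0, V3, V1, V2]),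
    (1, [V4, V0, V2, V1, V3]),
    (1, [V4, V0, V1, V2, V3])]"
  by code_simp

lemma growth_5_0_2:
  "growth_check 5 0 2 (0) [
    (0, [V1, V5, V3, V0, V4, V2]),
    (1, [V1, V5, V3, V0, V2, V4]),
    (0, [V0, V5, V2, V1, V4, V3]),
    (1, [V0, V5, V2, V1, V3, V4]),
    (2, [V0, V1, V5, V4, V2, V3]),
    (3, [V1, V0, V5, V3, V2, V4]),
    (3, [V0, V1, V5, V2, V3, V4]),
    (3, [V5, V1, V2, V0, V4, V3]),
    (3, [V5, V1, V2, V0, V3, V4]),
    (3, [V5, V0, V2, V1, V4, V3]),
    (3, [V5, V0, V2, V1, V3, V4]),
    (3, [V5, V0, V1, V2, V4, V3]),
    (3, [V5, V0, V1, V2, V3, V4]),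
    (4, [V0, V1, V2, V5, V3, V4])]"
  by code_simp

lemma growth_5_0_3:
  "growth_check 5 0 3 (1) [
    (0, [V1, V5, V3, V0, V4, V2]),
    (0, [V0, V5, V2, V1, V4, V3]),
    (1, [V0, V2, V5, V3, V1, V4]),
    (2, [V1, V0, V5, V4, V3, V2]),
    (3, [V1, V3, V0, V5, V2, V4]),
    (4, [V1, V0, V2, V5, V3, V4]),
    (2, [V0, V1, V5, V4, V2, V3]),
    (4, [V0, V1, V3, V5, V2, V4]),
    (3, [V0, V2, V1, V5, V3, V4]),
    (5, [V0, V1, V5, V2, V3, V4]),
    (4, [V2, V5, V0, V1, V4, V3]),
    (4, [V2, V5, V0, V1, V3, V4]),
    (4, [V1, V5, V0, V2, V4, V3]),
    (4, [V1, V5, V0, V2, V3, V4]),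
    (6, [V1, V2, V0, V5, V3, V4]),
    (4, [V0, V5, V1, V2, V4, V3]),
    (4, [V0, V5, V1, V2, V3, V4]),
    (6, [V0, V2, V1, V5, V3, V4]),
    (6, [V0, V1, V2, V5, V3, V4])]"
  by code_simp

lemma growth_5_1_2:
  "growth_check 5 1 2 (1) [
    (2, [V5, V2, V3, V0, V1, V4]),
    (2, [V5, V1, V3, V0, V2, V4]),
    (4, [V5, V3, V1, V2, V0, V4]),
    (2, [V5, V0, V2, V1, V3, V4]),
    (4, [V5, V2, V0, V3, V1, V4]),
    (2, [V5, V0, V1, V2, V3, V4]),
    (4, [V5, V1, V0, V3, V2, V4]),
    (4, [V5, V0, V1, V2, V3, V4]),
    (3, [V5, V0, V1, V2, V4, V3]),
    (3, [V5, V0, V1, V2, V3, V4]),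
    (7, [V0, V5, V3, V4, V1, V2]),
    (5, [V0, V5, V2, V4, V1, V3]),
    (5, [V0, V5, V2, V3, V1, V4]),
    (5, [V0, V5, V1, V4, V2, V3]),
    (5, [V0, V5, V1, V3, V2, V4]),
    (6, [V0, V5, V1, V2, V3, V4])]"
  by code_simp

text \<open>The graph on v + 1 vertices must end up with 2(v + 1) - 1 edges, which means
  \<open>k + r = 4\<close>. Only now are the vertex degrees final and \<open>core_like\<close> can
  be tested.\<close>

lemma final_4_0:
  "final_check 4 0 4 [
    (0, [V0, V1, V2, V3, V4])]"
  by code_simp

lemma final_4_1:
  "final_check 4 1 3 [
    (0, [V3, V4, V0, V1, V2]),
    (0, [V2, V4, V0, V1, V3]),
    (0, [V1, V4, V0, V2, V3]),
    (0, [V0, V4, V1, V2, V3])]"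
  by code_simp

lemma final_5_0:
  "final_check 5 0 4 [
    (0, [V0, V1, V4, V5, V2, V3]),
    (1, [V1, V3, V0, V5, V2, V4]),
    (1, [V0, V2, V1, V5, V3, V4]),
    (2, [V0, V1, V2, V4, V5, V3]),
    (2, [V0, V1, V2, V3, V5, V4])]"
  by code_simp

lemma final_5_1:
  "final_check 5 1 3 [
    (0, [V3, V5, V1, V2, V4, V0]),
    (0, [V2, V5, V0, V3, V4, V1]),
    (1, [V2, V3, V5, V0, V1, V4]),
    (0, [V1, V5, V0, V3, V4, V2]),
    (1, [V1, V3, V5, V0, V2, V4]),
    (2, [V1, V2, V5, V0, V3, V4]),
    (0, [V0, V5, V1, V2, V4, V3]),
    (2, [V0, V3, V5, V1, V2, V4]),
    (1, [V0, V2, V5, V1, V3, V4]),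
    (1, [V0, V1, V5, V2, V3, V4]),
    (1, [V0, V5, V2, V4, V1, V3]),
    (1, [V0, V5, V2, V3, V1, V4]),
    (1, [V0, V5, V1, V4, V2, V3]),
    (1, [V0, V5, V1, V3, V2, V4]),
    (3, [V0, V5, V1, V2, V3, V4])]"
  by code_simp

lemma final_6_0:
  "final_check 6 0 4 [
    (0, [V0, V1, V6, V2, V4, V3, V5]),
    (1, [V1, V3, V0, V6, V4, V2, V5]),
    (1, [V0, V2, V1, V6, V5, V3, V4]),
    (2, [V0, V1, V2, V3, V6, V4, V5]),
    (3, [V0, V1, V4, V6, V2, V3, V5]),
    (4, [V3, V1, V4, V0, V6, V2, V5]),
    (4, [V2, V0, V4, V1, V6, V3, V5]),
    (5, [V0, V2, V1, V3, V6, V4, V5]),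
    (6, [V0, V3, V1, V2, V6, V4, V5])]"
  by code_simp

lemma final_6_1:
  "final_check 6 1 3 [
    (0, [V3, V6, V1, V5, V4, V0, V2]),
    (0, [V2, V6, V0, V4, V5, V1, V3]),
    (3, [V3, V6, V2, V1, V5, V0, V4]),
    (3, [V2, V6, V3, V0, V4, V1, V5]),
    (1, [V3, V4, V6, V1, V2, V0, V5]),
    (1, [V2, V4, V6, V0, V3, V1, V5]),
    (4, [V4, V2, V3, V6, V0, V1, V5]),
    (1, [V1, V3, V6, V0, V4, V2, V5]),
    (4, [V3, V1, V4, V6, V0, V2, V5]),
    (6, [V2, V4, V1, V6, V0, V3, V5]),
    (6, [V1, V3, V2, V6, V0, V4, V5]),
    (6, [V3, V4, V0, V6, V1, V2, V5]),
    (1, [V0, V2, V6, V1, V4, V3, V5]),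
    (4, [V2, V0, V4, V6, V1, V3, V5]),
    (6, [V0, V2, V3, V6, V1, V4, V5]),
    (1, [V0, V1, V6, V2, V3, V4, V5]),
    (6, [V0, V1, V4, V6, V2, V3, V5]),
    (4, [V1, V0, V3, V6, V2, V4, V5]),
    (4, [V0, V1, V2, V6, V3, V4, V5]),
    (1, [V0, V6, V2, V4, V1, V5, V3]),
    (1, [V0, V6, V1, V3, V2, V5, V4]),
    (7, [V1, V2, V0, V6, V5, V3, V4]),
    (2, [V0, V2, V6, V1, V4, V3, V5]),
    (2, [V0, V1, V6, V2, V3, V4, V5]),
    (7, [V0, V6, V2, V3, V1, V5, V4]),
    (8, [V0, V6, V2, V3, V1, V4, V5]),
    (4, [V0, V1, V6, V3, V4, V2, V5]),
    (4, [V0, V1, V6, V2, V4, V3, V5]),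
    (9, [V0, V1, V6, V2, V3, V4, V5]),
    (6, [V0, V6, V2, V3, V4, V1, V5]),
    (2, [V1, V6, V3, V0, V2, V5, V4]),
    (5, [V0, V6, V3, V1, V4, V2, V5]),
    (2, [V1, V6, V2, V0, V3, V5, V4]),
    (5, [V0, V6, V2, V1, V4, V3, V5]),
    (9, [V1, V2, V3, V0, V6, V4, V5]),
    (4, [V6, V0, V1, V2, V3, V4, V5]),
    (9, [V6, V0, V1, V2, V3, V5, V4]),
    (9, [V6, V0, V1, V2, V3, V4, V5])]"
  by code_simp

text \<open>Symmetric cores need replies only up to graph automorphisms and reversal of all arcs.\<close>

definition move_arc :: "vertex list \<times> bool \<Rightarrow> arc \<Rightarrow> arc" where
  "move_arc t a = (let x = fst t ! rank (fst a); y = fst t ! rank (snd a) in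
     if snd t then (y, x) else (x, y))"

fun relabel :: "vertex list \<times> bool \<Rightarrow> cert \<Rightarrow> cert" where
  "relabel t (Pairs ps) = Pairs (map (\<lambda>(p, q). (move_arc t p, move_arc t q)) ps)"
| "relabel t (Reply rs) =
     Reply (map (\<lambda>(as, f, c). (map (move_arc t) as, move_arc t f, relabel t c)) rs)"
| "relabel t (Split E c1 c2) = Split (map (move_arc t) E) (relabel t c1) (relabel t c2)"

text \<open>Nothing about automorphisms has to be proved: the replies are written out for all of
  \<open>ts\<close>, and \<open>check\<close> tests each of them.\<close>

definition orbit :: "(vertex list \<times> bool) list \<Rightarrow> arc \<Rightarrow> arc \<Rightarrow> cert \<Rightarrow>
    (arc list \<times> arc \<times> cert) list" where
  "orbit ts a f c = map (\<lambda>t. ([move_arc t a], move_arc t f, relabel t c)) ts"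

text \<open>Up to symmetry Maker opens on an edge at \<open>V0\<close> or inside the triangle
  \<open>V2 V3 V4\<close>. In the second case \<open>Split\<close> isolates the \<open>K4\<close> on
  \<open>V1\<close>, \<open>V2\<close>, \<open>V3\<close>, \<open>V4\<close>, in which Maker already
  owns \<open>(V2, V3)\<close> and is to move; there Breaker's answers depend on the
  orientations.\<close>

definition core_cert_5_0 :: cert where
  "core_cert_5_0 =
    Reply (concat [orbit [([V0,V1,V2,V3,V4], False), ([V0,V1,V3,V2,V4], False),
    ([V0,V1,V4,V2,V3], False), ([V1,V0,V2,V3,V4], False), ([V1,V0,V3,V2,V4], False),
    ([V1,V0,V4,V2,V3], False), ([V0,V1,V2,V3,V4], True), ([V1,V0,V2,V3,V4], True),
    ([V0,V1,V3,V2,V4], True), ([V1,V0,V3,V2,V4], True), ([V0,V1,V4,V2,V3], True),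
    ([V1,V0,V4,V2,V3], True)] (V0,V2) (V2,V3) (Reply [([(V0,V3), (V0,V4), (V1,V3), (V3,V0),
    (V3,V1), (V4,V2)], (V3,V4), Pairs [((V0,V4),(V2,V4)), ((V1,V2),(V1,V4))]), ([(V1,V2),
    (V2,V1), (V3,V4), (V4,V3)], (V2,V4), Pairs [((V0,V3),(V0,V4)), ((V1,V3),(V1,V4))]),
    ([(V1,V4), (V4,V1)], (V0,V4), Pairs [((V1,V2),(V2,V4)), ((V1,V3),(V3,V4))]), ([(V2,V4)],
    (V0,V4), Pairs [((V1,V2),(V1,V4)), ((V1,V3),(V3,V4))]), ([(V4,V0)], (V2,V4), Pairs
    [((V0,V3),(V3,V4)), ((V1,V3),(V1,V4))])]), orbit [([V0,V1,V2,V3,V4], False),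
    ([V0,V1,V2,V4,V3], False), ([V0,V1,V2,V3,V4], True), ([V0,V1,V3,V4,V2], False),
    ([V0,V1,V2,V4,V3], True), ([V0,V1,V3,V4,V2], True)] (V2,V3) (V0,V4) (Split [(V0,V2), (V0,V3)]
    (Pairs [((V0,V2),(V0,V3))]) (Reply [([(V1,V3), (V2,V1)], (V1,V4), Pairs [((V2,V4),(V3,V4))]),
    ([(V2,V4), (V4,V3)], (V1,V2), Pairs [((V1,V3),(V1,V4))]), ([(V1,V2)], (V1,V3), Reply
    [([(V3,V4), (V4,V1)], (V2,V4), Pairs []), ([(V2,V4)], (V1,V4), Pairs []), ([(V4,V2)],
    (V3,V4), Pairs [])]), ([(V1,V4)], (V1,V2), Reply [([(V3,V1), (V4,V2)], (V3,V4), Pairs []),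
    ([(V3,V4)], (V2,V4), Pairs []), ([(V4,V3)], (V1,V3), Pairs [])]), ([(V3,V1)], (V1,V2), Reply
    [([(V1,V4), (V4,V2)], (V3,V4), Pairs []), ([(V3,V4)], (V2,V4), Pairs []), ([(V4,V3)],
    (V1,V4), Pairs [])]), ([(V3,V4)], (V2,V4), Reply [([(V1,V2), (V4,V1)], (V1,V3), Pairs []),
    ([(V1,V3)], (V1,V4), Pairs []), ([(V3,V1)], (V1,V2), Pairs [])]), ([(V4,V1)], (V1,V3), Reply
    [([(V1,V2), (V3,V4)], (V2,V4), Pairs []), ([(V2,V4)], (V1,V2), Pairs []), ([(V4,V2)],
    (V3,V4), Pairs [])]), ([(V4,V2)], (V3,V4), Reply [([(V1,V4), (V3,V1)], (V1,V2), Pairs []),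
    ([(V1,V2)], (V1,V3), Pairs []), ([(V2,V1)], (V1,V4), Pairs [])])]))])"

lemma check_5_0: "check core_cert_5_0 (cycles (candidates 5 ! 0))"
  by code_simp

text \<open>After each opening one claim of Breaker leaves a pairing, and the same answer serves
  both directions of Maker's edge.\<close>

definition core_cert_6_0 :: cert where
  "core_cert_6_0 =
    Reply [([(V0,V2), (V0,V3), (V2,V0), (V3,V0)], (V0,V4), Pairs [((V1,V2),(V1,V5)),
    ((V1,V3),(V3,V5)), ((V2,V4),(V2,V5)), ((V3,V4),(V4,V5))]), ([(V0,V4), (V1,V2), (V2,V1),
    (V4,V0)], (V2,V5), Pairs [((V0,V2),(V2,V4)), ((V0,V3),(V3,V4)), ((V1,V3),(V1,V5)),
    ((V3,V5),(V4,V5))]), ([(V1,V3), (V3,V1), (V4,V5), (V5,V4)], (V3,V5), Pairs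
    [((V0,V2),(V0,V4)), ((V0,V3),(V3,V4)), ((V1,V2),(V1,V5)), ((V2,V4),(V2,V5))]), ([(V1,V5),
    (V2,V4), (V4,V2), (V5,V1)], (V4,V5), Pairs [((V1,V2),(V2,V5)), ((V1,V3),(V3,V5)),
    ((V0,V2),(V0,V4)), ((V0,V3),(V3,V4))]), ([(V2,V5), (V3,V4), (V4,V3), (V5,V2)], (V4,V5), Pairs
    [((V1,V2),(V1,V5)), ((V0,V2),(V2,V4)), ((V0,V3),(V0,V4)), ((V1,V3),(V3,V5))]), ([(V3,V5),
    (V5,V3)], (V2,V4), Pairs [((V0,V3),(V0,V4)), ((V1,V2),(V2,V5)), ((V1,V3),(V1,V5)),
    ((V3,V4),(V4,V5))])]"

lemma check_6_0: "check core_cert_6_0 (cycles (candidates 6 ! 0))"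
  by code_simp

definition core_cert_6_1 :: cert where
  "core_cert_6_1 =
    Reply [([(V0,V1), (V0,V3), (V1,V0), (V3,V0)], (V3,V5), Pairs [((V0,V5),(V1,V5)),
    ((V1,V4),(V4,V5)), ((V2,V3),(V3,V4)), ((V2,V4),(V2,V5))]), ([(V0,V5), (V1,V4), (V4,V1),
    (V5,V0)], (V4,V5), Pairs [((V0,V1),(V1,V5)), ((V0,V3),(V3,V5)), ((V2,V4),(V3,V4)),
    ((V2,V3),(V2,V5))]), ([(V3,V4), (V4,V3)], (V3,V5), Pairs [((V0,V1),(V0,V5)),
    ((V1,V4),(V1,V5)), ((V2,V3),(V2,V4)), ((V2,V5),(V4,V5))]), ([(V4,V5), (V5,V4)], (V3,V5),
    Pairs [((V0,V1),(V0,V5)), ((V1,V4),(V1,V5)), ((V2,V3),(V3,V4)), ((V2,V4),(V2,V5))]),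
    ([(V2,V5), (V5,V2)], (V3,V5), Pairs [((V0,V1),(V0,V5)), ((V1,V4),(V1,V5)), ((V2,V3),(V3,V4)),
    ((V2,V4),(V4,V5))]), ([(V2,V4), (V4,V2)], (V3,V5), Pairs [((V0,V1),(V0,V5)),
    ((V1,V4),(V1,V5)), ((V2,V3),(V3,V4)), ((V2,V5),(V4,V5))]), ([(V2,V3), (V3,V2)], (V3,V5),
    Pairs [((V0,V1),(V0,V5)), ((V1,V4),(V1,V5)), ((V2,V4),(V3,V4)), ((V2,V5),(V4,V5))]),
    ([(V1,V5), (V5,V1)], (V3,V5), Pairs [((V0,V1),(V0,V5)), ((V1,V4),(V4,V5)), ((V2,V3),(V3,V4)),
    ((V2,V4),(V2,V5))]), ([(V3,V5), (V5,V3)], (V4,V5), Pairs [((V0,V1),(V1,V5)),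
    ((V0,V3),(V0,V5)), ((V2,V4),(V3,V4)), ((V2,V3),(V2,V5))])]"

lemma check_6_1: "check core_cert_6_1 (cycles (candidates 6 ! 1))"
  by code_simp

definition core_cert_6_2 :: cert where
  "core_cert_6_2 =
    Reply [([(V0,V3), (V1,V3), (V2,V3), (V3,V0), (V3,V1), (V3,V2), (V4,V5), (V5,V4)], (V3,V5),
    Pairs [((V0,V4),(V0,V5)), ((V1,V4),(V1,V5)), ((V2,V4),(V2,V5))]), ([(V0,V4), (V1,V4),
    (V2,V4), (V3,V5), (V4,V0), (V4,V1), (V4,V2), (V5,V3)], (V4,V5), Pairs [((V0,V3),(V0,V5)),
    ((V1,V3),(V1,V5)), ((V2,V3),(V2,V5))]), ([(V2,V5), (V5,V2)], (V3,V5), Pairs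
    [((V0,V4),(V0,V5)), ((V1,V4),(V1,V5)), ((V2,V4),(V4,V5))]), ([(V1,V5), (V5,V1)], (V3,V5),
    Pairs [((V0,V4),(V0,V5)), ((V1,V4),(V4,V5)), ((V2,V4),(V2,V5))]), ([(V0,V5), (V5,V0)],
    (V3,V5), Pairs [((V0,V4),(V4,V5)), ((V1,V4),(V1,V5)), ((V2,V4),(V2,V5))])]"

lemma check_6_2: "check core_cert_6_2 (cycles (candidates 6 ! 2))"
  by code_simp

text \<open>Two copies of \<open>K4\<close> sharing the edge \<open>V4 V5\<close>. If Maker opens
  with that edge, Breaker's \<open>V0 V4\<close> reduces the first copy to a pairing, and in the
  second he exploits the orientations.\<close>

definition core_cert_6_3 :: cert where
  "core_cert_6_3 =
    Reply (concat [orbit [([V0,V1,V2,V3,V4,V5], False), ([V0,V1,V2,V3,V4,V5], True),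
    ([V2,V3,V0,V1,V4,V5], False), ([V2,V3,V0,V1,V4,V5], True)] (V0,V1) (V4,V5) (Pairs
    [((V0,V4),(V1,V4)), ((V0,V5),(V1,V5)), ((V2,V3),(V2,V4)), ((V2,V5),(V3,V5))]), orbit
    [([V0,V1,V2,V3,V4,V5], False), ([V0,V1,V2,V3,V5,V4], False), ([V1,V0,V2,V3,V4,V5], False),
    ([V1,V0,V2,V3,V5,V4], False), ([V2,V3,V0,V1,V4,V5], False), ([V2,V3,V0,V1,V5,V4], False),
    ([V3,V2,V0,V1,V4,V5], False), ([V3,V2,V0,V1,V5,V4], False), ([V0,V1,V2,V3,V4,V5], True),
    ([V1,V0,V2,V3,V4,V5], True), ([V2,V3,V0,V1,V4,V5], True), ([V3,V2,V0,V1,V4,V5], True),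
    ([V0,V1,V2,V3,V5,V4], True), ([V1,V0,V2,V3,V5,V4], True), ([V2,V3,V0,V1,V5,V4], True),
    ([V3,V2,V0,V1,V5,V4], True)] (V0,V4) (V4,V5) (Pairs [((V0,V1),(V1,V4)), ((V0,V5),(V1,V5)),
    ((V2,V3),(V2,V4)), ((V2,V5),(V3,V5))]), orbit [([V0,V1,V2,V3,V4,V5], False),
    ([V0,V1,V2,V3,V4,V5], True)] (V4,V5) (V0,V4) (Split [(V0,V1), (V0,V5), (V1,V4), (V1,V5)]
    (Pairs [((V1,V4),(V1,V5)), ((V0,V1),(V0,V5))]) (Reply [([(V2,V5), (V4,V2)], (V2,V3), Pairs
    [((V3,V4),(V3,V5))]), ([(V3,V5), (V4,V3)], (V2,V3), Pairs [((V2,V4),(V2,V5))]), ([(V2,V3)],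
    (V2,V4), Reply [([(V3,V4), (V5,V2)], (V3,V5), Pairs []), ([(V3,V5)], (V2,V5), Pairs []),
    ([(V5,V3)], (V3,V4), Pairs [])]), ([(V2,V4)], (V2,V5), Reply [([(V3,V2), (V5,V3)], (V3,V4),
    Pairs []), ([(V3,V4)], (V3,V5), Pairs []), ([(V4,V3)], (V2,V3), Pairs [])]), ([(V3,V2)],
    (V2,V5), Reply [([(V2,V4), (V5,V3)], (V3,V4), Pairs []), ([(V3,V4)], (V3,V5), Pairs []),
    ([(V4,V3)], (V2,V4), Pairs [])]), ([(V3,V4)], (V3,V5), Reply [([(V2,V3), (V5,V2)], (V2,V4),
    Pairs []), ([(V2,V4)], (V2,V5), Pairs []), ([(V4,V2)], (V2,V3), Pairs [])]), ([(V5,V2)],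
    (V2,V4), Reply [([(V2,V3), (V3,V4)], (V3,V5), Pairs []), ([(V3,V5)], (V2,V3), Pairs []),
    ([(V5,V3)], (V3,V4), Pairs [])]), ([(V5,V3)], (V3,V4), Reply [([(V2,V4), (V3,V2)], (V2,V5),
    Pairs []), ([(V2,V5)], (V2,V3), Pairs []), ([(V5,V2)], (V2,V4), Pairs [])])]))])"

lemma check_6_3: "check core_cert_6_3 (cycles (candidates 6 ! 3))"
  by code_simp

text \<open>The triangles of this core are blocked by disjoint pairs from the start.\<close>

definition core_cert_7_0 :: cert where
  "core_cert_7_0 =
    Pairs [((V0,V2),(V0,V3)), ((V0,V4),(V3,V4)), ((V1,V2),(V2,V5)), ((V1,V5),(V1,V6)),
    ((V3,V6),(V4,V6)), ((V4,V5),(V5,V6))]"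

lemma check_7_0: "check core_cert_7_0 (cycles (candidates 7 ! 0))"
  by code_simp

definition core_cert_7_1 :: cert where
  "core_cert_7_1 =
    Reply [([(V0,V1), (V0,V3), (V1,V0), (V3,V0)], (V0,V6), Pairs [((V1,V4),(V1,V6)),
    ((V2,V3),(V2,V5)), ((V2,V4),(V4,V5)), ((V3,V5),(V3,V6)), ((V4,V6),(V5,V6))]), ([(V0,V6),
    (V2,V3), (V3,V2), (V6,V0)], (V3,V5), Pairs [((V0,V1),(V1,V6)), ((V0,V3),(V3,V6)),
    ((V1,V4),(V4,V6)), ((V2,V4),(V2,V5)), ((V4,V5),(V5,V6))]), ([(V1,V4), (V2,V4), (V4,V1),
    (V4,V2)], (V4,V5), Pairs [((V1,V6),(V4,V6)), ((V0,V1),(V0,V6)), ((V0,V3),(V3,V6)),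
    ((V2,V3),(V2,V5)), ((V3,V5),(V5,V6))]), ([(V1,V6), (V3,V5), (V5,V3), (V6,V1)], (V5,V6), Pairs
    [((V0,V1),(V0,V6)), ((V1,V4),(V4,V6)), ((V0,V3),(V3,V6)), ((V2,V3),(V2,V5)),
    ((V2,V4),(V4,V5))]), ([(V2,V5), (V4,V6), (V5,V2), (V6,V4)], (V5,V6), Pairs
    [((V2,V3),(V3,V5)), ((V2,V4),(V4,V5)), ((V0,V1),(V0,V6)), ((V0,V3),(V3,V6)),
    ((V1,V4),(V1,V6))]), ([(V3,V6), (V4,V5), (V5,V4), (V6,V3)], (V5,V6), Pairs
    [((V0,V3),(V0,V6)), ((V0,V1),(V1,V6)), ((V1,V4),(V4,V6)), ((V2,V3),(V3,V5)),
    ((V2,V4),(V2,V5))]), ([(V5,V6), (V6,V5)], (V3,V6), Pairs [((V0,V1),(V0,V6)),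
    ((V1,V4),(V1,V6)), ((V2,V3),(V3,V5)), ((V2,V4),(V2,V5)), ((V4,V5),(V4,V6))])]"

lemma check_7_1: "check core_cert_7_1 (cycles (candidates 7 ! 1))"
  by code_simp

definition core_cert_7_2 :: cert where
  "core_cert_7_2 =
    Reply [([(V0,V2), (V2,V0), (V2,V6), (V3,V5), (V3,V6), (V5,V3), (V6,V2), (V6,V3)], (V5,V6),
    Pairs [((V0,V5),(V2,V5)), ((V0,V4),(V4,V5)), ((V1,V3),(V1,V6)), ((V1,V4),(V4,V6))]),
    ([(V0,V4), (V4,V0), (V4,V6), (V6,V4)], (V5,V6), Pairs [((V0,V5),(V4,V5)), ((V0,V2),(V2,V5)),
    ((V1,V3),(V3,V6)), ((V1,V4),(V1,V6))]), ([(V0,V5), (V1,V6), (V5,V0), (V6,V1)], (V5,V6), Pairs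
    [((V0,V2),(V2,V5)), ((V0,V4),(V4,V5)), ((V1,V3),(V3,V6)), ((V1,V4),(V4,V6))]), ([(V1,V3),
    (V2,V5), (V3,V1), (V5,V2)], (V5,V6), Pairs [((V1,V6),(V3,V6)), ((V0,V2),(V0,V5)),
    ((V0,V4),(V4,V5)), ((V1,V4),(V4,V6))]), ([(V1,V4), (V4,V1), (V4,V5), (V5,V4)], (V5,V6), Pairs
    [((V1,V6),(V4,V6)), ((V0,V2),(V2,V5)), ((V0,V4),(V0,V5)), ((V1,V3),(V3,V6))]), ([(V5,V6),
    (V6,V5)], (V4,V5), Pairs [((V0,V2),(V0,V5)), ((V1,V3),(V1,V6)), ((V1,V4),(V4,V6)),
    ((V2,V5),(V2,V6)), ((V3,V5),(V3,V6))])]"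

lemma check_7_2: "check core_cert_7_2 (cycles (candidates 7 ! 2))"
  by code_simp

definition core_cert_7_3 :: cert where
  "core_cert_7_3 =
    Pairs [((V0,V3),(V0,V4)), ((V0,V6),(V4,V6)), ((V1,V3),(V3,V5)), ((V1,V5),(V1,V6)),
    ((V2,V4),(V2,V6)), ((V2,V5),(V5,V6))]"

lemma check_7_3: "check core_cert_7_3 (cycles (candidates 7 ! 3))"
  by code_simp

definition core_cert_7_4 :: cert where
  "core_cert_7_4 =
    Reply [([(V0,V1), (V1,V0), (V1,V4), (V4,V1)], (V4,V6), Pairs [((V0,V6),(V1,V6)),
    ((V0,V2),(V2,V6)), ((V2,V5),(V5,V6)), ((V3,V4),(V4,V5)), ((V3,V5),(V3,V6))]), ([(V0,V2),
    (V2,V0), (V2,V5), (V5,V2)], (V5,V6), Pairs [((V0,V6),(V2,V6)), ((V0,V1),(V1,V6)),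
    ((V1,V4),(V4,V6)), ((V3,V5),(V4,V5)), ((V3,V4),(V3,V6))]), ([(V0,V6), (V6,V0)], (V4,V6),
    Pairs [((V0,V1),(V1,V6)), ((V0,V2),(V2,V6)), ((V2,V5),(V5,V6)), ((V3,V4),(V4,V5)),
    ((V3,V5),(V3,V6))]), ([(V1,V6), (V6,V1)], (V4,V6), Pairs [((V0,V1),(V0,V6)),
    ((V0,V2),(V2,V6)), ((V2,V5),(V5,V6)), ((V3,V4),(V4,V5)), ((V3,V5),(V3,V6))]), ([(V4,V5),
    (V5,V4)], (V4,V6), Pairs [((V0,V1),(V1,V6)), ((V0,V2),(V0,V6)), ((V2,V5),(V2,V6)),
    ((V3,V4),(V3,V5)), ((V3,V6),(V5,V6))]), ([(V5,V6), (V6,V5)], (V4,V6), Pairs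
    [((V0,V1),(V1,V6)), ((V0,V2),(V0,V6)), ((V2,V5),(V2,V6)), ((V3,V4),(V4,V5)),
    ((V3,V5),(V3,V6))]), ([(V3,V6), (V6,V3)], (V4,V6), Pairs [((V0,V1),(V1,V6)),
    ((V0,V2),(V0,V6)), ((V2,V5),(V2,V6)), ((V3,V4),(V4,V5)), ((V3,V5),(V5,V6))]), ([(V3,V5),
    (V5,V3)], (V4,V6), Pairs [((V0,V1),(V1,V6)), ((V0,V2),(V0,V6)), ((V2,V5),(V2,V6)),
    ((V3,V4),(V4,V5)), ((V3,V6),(V5,V6))]), ([(V3,V4), (V4,V3)], (V4,V6), Pairs
    [((V0,V1),(V1,V6)), ((V0,V2),(V0,V6)), ((V2,V5),(V2,V6)), ((V3,V5),(V4,V5)),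
    ((V3,V6),(V5,V6))]), ([(V2,V6), (V6,V2)], (V4,V6), Pairs [((V0,V1),(V1,V6)),
    ((V0,V2),(V0,V6)), ((V2,V5),(V5,V6)), ((V3,V4),(V4,V5)), ((V3,V5),(V3,V6))]), ([(V4,V6),
    (V6,V4)], (V5,V6), Pairs [((V0,V1),(V0,V6)), ((V0,V2),(V2,V6)), ((V1,V4),(V1,V6)),
    ((V3,V5),(V4,V5)), ((V3,V4),(V3,V6))])]"

lemma check_7_4: "check core_cert_7_4 (cycles (candidates 7 ! 4))"
  by code_simp

definition core_cert_7_5 :: cert where
  "core_cert_7_5 =
    Reply [([(V0,V1), (V0,V4), (V1,V0), (V2,V4), (V4,V0), (V4,V2), (V4,V5), (V5,V4)], (V4,V6),
    Pairs [((V0,V6),(V1,V6)), ((V1,V5),(V5,V6)), ((V2,V3),(V2,V6)), ((V3,V5),(V3,V6))]),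
    ([(V0,V6), (V1,V5), (V3,V5), (V5,V1), (V5,V3), (V6,V0)], (V5,V6), Pairs [((V0,V1),(V1,V6)),
    ((V0,V4),(V4,V6)), ((V2,V3),(V3,V6)), ((V2,V4),(V2,V6))]), ([(V5,V6), (V6,V5)], (V4,V6),
    Pairs [((V0,V1),(V0,V6)), ((V1,V5),(V1,V6)), ((V2,V3),(V2,V6)), ((V3,V5),(V3,V6))]),
    ([(V3,V6), (V6,V3)], (V4,V6), Pairs [((V0,V1),(V0,V6)), ((V1,V5),(V1,V6)), ((V2,V3),(V2,V6)),
    ((V3,V5),(V5,V6))]), ([(V2,V6), (V6,V2)], (V4,V6), Pairs [((V0,V1),(V0,V6)),
    ((V1,V5),(V1,V6)), ((V2,V3),(V3,V6)), ((V3,V5),(V5,V6))]), ([(V2,V3), (V3,V2)], (V4,V6),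
    Pairs [((V0,V1),(V0,V6)), ((V1,V5),(V1,V6)), ((V2,V6),(V3,V6)), ((V3,V5),(V5,V6))]),
    ([(V1,V6), (V6,V1)], (V4,V6), Pairs [((V0,V1),(V0,V6)), ((V1,V5),(V5,V6)), ((V2,V3),(V2,V6)),
    ((V3,V5),(V3,V6))]), ([(V4,V6), (V6,V4)], (V5,V6), Pairs [((V0,V1),(V1,V6)),
    ((V0,V4),(V0,V6)), ((V2,V3),(V3,V6)), ((V2,V4),(V2,V6))])]"

lemma check_7_5: "check core_cert_7_5 (cycles (candidates 7 ! 5))"
  by code_simp

definition core_cert_7_6 :: cert where
  "core_cert_7_6 =
    Reply [([(V0,V1), (V0,V4), (V1,V0), (V2,V4), (V3,V4), (V4,V0), (V4,V2), (V4,V3)], (V4,V6),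
    Pairs [((V0,V6),(V1,V6)), ((V1,V5),(V5,V6)), ((V2,V5),(V2,V6)), ((V3,V5),(V3,V6))]),
    ([(V0,V6), (V1,V5), (V2,V5), (V3,V5), (V5,V1), (V5,V2), (V5,V3), (V6,V0)], (V5,V6), Pairs
    [((V0,V1),(V1,V6)), ((V0,V4),(V4,V6)), ((V2,V4),(V2,V6)), ((V3,V4),(V3,V6))]), ([(V5,V6),
    (V6,V5)], (V4,V6), Pairs [((V0,V1),(V0,V6)), ((V1,V5),(V1,V6)), ((V2,V5),(V2,V6)),
    ((V3,V5),(V3,V6))]), ([(V3,V6), (V6,V3)], (V4,V6), Pairs [((V0,V1),(V0,V6)),
    ((V1,V5),(V1,V6)), ((V2,V5),(V2,V6)), ((V3,V5),(V5,V6))]), ([(V2,V6), (V6,V2)], (V4,V6),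
    Pairs [((V0,V1),(V0,V6)), ((V1,V5),(V1,V6)), ((V2,V5),(V5,V6)), ((V3,V5),(V3,V6))]),
    ([(V1,V6), (V6,V1)], (V4,V6), Pairs [((V0,V1),(V0,V6)), ((V1,V5),(V5,V6)), ((V2,V5),(V2,V6)),
    ((V3,V5),(V3,V6))]), ([(V4,V6), (V6,V4)], (V5,V6), Pairs [((V0,V1),(V1,V6)),
    ((V0,V4),(V0,V6)), ((V2,V4),(V2,V6)), ((V3,V4),(V3,V6))])]"

lemma check_7_6: "check core_cert_7_6 (cycles (candidates 7 ! 6))"
  by code_simp

text \<open>A 4-wheel with hub \<open>V4\<close> and rim \<open>V0 V1 V6 V5\<close>, and a
  \<open>K4\<close> on \<open>V2\<close>, \<open>V3\<close>, \<open>V5\<close>, \<open>V6\<close>,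
  share the rim edge \<open>V5 V6\<close>. When Maker opens with that edge, Breaker reduces the
  \<open>K4\<close> to a pairing and answers in the wheel according to the direction she
  chose.\<close>

definition core_cert_7_7 :: cert where
  "core_cert_7_7 =
    Reply [([(V0,V1), (V1,V0), (V3,V5), (V5,V3)], (V5,V6), Pairs [((V0,V4),(V1,V4)),
    ((V0,V5),(V4,V5)), ((V1,V6),(V4,V6)), ((V2,V3),(V2,V5)), ((V2,V6),(V3,V6))]), ([(V0,V4),
    (V2,V5), (V4,V0), (V5,V2)], (V5,V6), Pairs [((V0,V1),(V1,V4)), ((V0,V5),(V4,V5)),
    ((V1,V6),(V4,V6)), ((V2,V3),(V3,V5)), ((V2,V6),(V3,V6))]), ([(V0,V5), (V3,V6), (V5,V0),
    (V6,V3)], (V5,V6), Pairs [((V0,V4),(V4,V5)), ((V0,V1),(V1,V4)), ((V1,V6),(V4,V6)),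
    ((V2,V5),(V3,V5)), ((V2,V3),(V2,V6))]), ([(V1,V4), (V2,V6), (V4,V1), (V6,V2)], (V5,V6), Pairs
    [((V0,V1),(V0,V4)), ((V1,V6),(V4,V6)), ((V0,V5),(V4,V5)), ((V2,V5),(V3,V5)),
    ((V2,V3),(V3,V6))]), ([(V1,V6), (V2,V3), (V3,V2), (V6,V1)], (V5,V6), Pairs
    [((V1,V4),(V4,V6)), ((V0,V1),(V0,V4)), ((V0,V5),(V4,V5)), ((V2,V5),(V3,V5)),
    ((V2,V6),(V3,V6))]), ([(V4,V6), (V6,V4)], (V5,V6), Pairs [((V2,V5),(V3,V5)),
    ((V2,V6),(V3,V6)), ((V0,V1),(V0,V4)), ((V0,V5),(V4,V5)), ((V1,V4),(V1,V6))]), ([(V4,V5),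
    (V5,V4)], (V5,V6), Pairs [((V2,V5),(V3,V5)), ((V2,V6),(V3,V6)), ((V0,V1),(V1,V4)),
    ((V0,V4),(V0,V5)), ((V1,V6),(V4,V6))]), ([(V5,V6)], (V2,V5), Split [(V2,V3), (V2,V6),
    (V3,V5), (V3,V6)] (Pairs [((V3,V5),(V3,V6)), ((V2,V3),(V2,V6))]) (Reply [([(V0,V1), (V0,V5),
    (V1,V0), (V4,V6), (V5,V0), (V5,V4)], (V0,V4), Pairs [((V4,V5),(V4,V6)), ((V1,V4),(V1,V6))]),
    ([(V0,V4), (V1,V6), (V4,V0), (V6,V1)], (V4,V6), Pairs [((V0,V1),(V1,V4)),
    ((V0,V5),(V4,V5))]), ([(V1,V4), (V4,V1)], (V4,V5), Pairs [((V0,V1),(V0,V4)),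
    ((V1,V6),(V4,V6))]), ([(V6,V4)], (V4,V5), Pairs [((V0,V1),(V0,V4)), ((V1,V4),(V1,V6))]),
    ([(V4,V5)], (V4,V6), Pairs [((V0,V1),(V1,V4)), ((V0,V4),(V0,V5))])])), ([(V6,V5)], (V2,V5),
    Split [(V2,V3), (V2,V6), (V3,V5), (V3,V6)] (Pairs [((V3,V5),(V3,V6)), ((V2,V3),(V2,V6))])
    (Reply [([(V0,V1), (V0,V5), (V1,V0), (V4,V5), (V5,V0), (V6,V4)], (V0,V4), Pairs
    [((V4,V5),(V4,V6)), ((V1,V4),(V1,V6))]), ([(V0,V4), (V1,V6), (V4,V0), (V6,V1)], (V4,V6),
    Pairs [((V0,V1),(V1,V4)), ((V0,V5),(V4,V5))]), ([(V1,V4), (V4,V1)], (V4,V5), Pairs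
    [((V0,V1),(V0,V4)), ((V1,V6),(V4,V6))]), ([(V4,V6)], (V4,V5), Pairs [((V0,V1),(V0,V4)),
    ((V1,V4),(V1,V6))]), ([(V5,V4)], (V4,V6), Pairs [((V0,V1),(V1,V4)), ((V0,V4),(V0,V5))])]))]"

lemma check_7_7: "check core_cert_7_7 (cycles (candidates 7 ! 7))"
  by code_simp

text \<open>Two copies of \<open>K4\<close> that share \<open>V6\<close> and are linked by the
  triangle \<open>V4 V5 V6\<close>. Breaker cuts the link with \<open>V4 V6\<close>, or with
  \<open>V5 V6\<close> if Maker has taken that edge herself.\<close>

definition core_cert_7_8 :: cert where
  "core_cert_7_8 =
    Reply (concat [orbit [([V0,V1,V2,V3,V4,V5,V6], False), ([V0,V1,V2,V3,V4,V5,V6], True),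
    ([V2,V3,V0,V1,V5,V4,V6], False), ([V2,V3,V0,V1,V5,V4,V6], True)] (V0,V1) (V4,V6) (Split
    [(V0,V4), (V1,V4)] (Pairs [((V0,V4),(V1,V4))]) (Split [(V0,V6), (V1,V6)] (Pairs
    [((V0,V6),(V1,V6))]) (Reply [([(V2,V3), (V3,V2)], (V2,V5), Pairs [((V2,V6),(V3,V6)),
    ((V3,V5),(V5,V6))]), ([(V2,V5), (V5,V2)], (V2,V3), Pairs [((V2,V6),(V5,V6)),
    ((V3,V5),(V3,V6))]), ([(V2,V6), (V6,V2)], (V2,V3), Pairs [((V2,V5),(V5,V6)),
    ((V3,V5),(V3,V6))]), ([(V3,V5), (V5,V3)], (V2,V3), Pairs [((V3,V6),(V5,V6)),
    ((V2,V5),(V2,V6))]), ([(V3,V6), (V6,V3)], (V2,V3), Pairs [((V3,V5),(V5,V6)),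
    ((V2,V5),(V2,V6))]), ([(V5,V6), (V6,V5)], (V2,V3), Pairs [((V2,V5),(V2,V6)),
    ((V3,V5),(V3,V6))])]))), orbit [([V0,V1,V2,V3,V4,V5,V6], False), ([V1,V0,V2,V3,V4,V5,V6],
    False), ([V2,V3,V0,V1,V5,V4,V6], False), ([V3,V2,V0,V1,V5,V4,V6], False),
    ([V0,V1,V2,V3,V4,V5,V6], True), ([V1,V0,V2,V3,V4,V5,V6], True), ([V2,V3,V0,V1,V5,V4,V6],
    True), ([V3,V2,V0,V1,V5,V4,V6], True)] (V0,V4) (V4,V6) (Split [(V0,V1), (V0,V6), (V1,V4),
    (V1,V6)] (Pairs [((V0,V1),(V1,V4)), ((V0,V6),(V1,V6))]) (Reply [([(V2,V3), (V3,V2)], (V2,V5),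
    Pairs [((V2,V6),(V3,V6)), ((V3,V5),(V5,V6))]), ([(V2,V5), (V5,V2)], (V2,V3), Pairs
    [((V2,V6),(V5,V6)), ((V3,V5),(V3,V6))]), ([(V2,V6), (V6,V2)], (V2,V3), Pairs
    [((V2,V5),(V5,V6)), ((V3,V5),(V3,V6))]), ([(V3,V5), (V5,V3)], (V2,V3), Pairs
    [((V3,V6),(V5,V6)), ((V2,V5),(V2,V6))]), ([(V3,V6), (V6,V3)], (V2,V3), Pairs
    [((V3,V5),(V5,V6)), ((V2,V5),(V2,V6))]), ([(V5,V6), (V6,V5)], (V2,V3), Pairs
    [((V2,V5),(V2,V6)), ((V3,V5),(V3,V6))])])), orbit [([V0,V1,V2,V3,V4,V5,V6], False),
    ([V1,V0,V2,V3,V4,V5,V6], False), ([V2,V3,V0,V1,V5,V4,V6], False), ([V3,V2,V0,V1,V5,V4,V6],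
    False), ([V0,V1,V2,V3,V4,V5,V6], True), ([V1,V0,V2,V3,V4,V5,V6], True),
    ([V2,V3,V0,V1,V5,V4,V6], True), ([V3,V2,V0,V1,V5,V4,V6], True)] (V0,V6) (V4,V6) (Split
    [(V0,V1), (V0,V4), (V1,V4), (V1,V6)] (Pairs [((V0,V1),(V1,V6)), ((V0,V4),(V1,V4))]) (Reply
    [([(V2,V3), (V3,V2)], (V2,V5), Pairs [((V2,V6),(V3,V6)), ((V3,V5),(V5,V6))]), ([(V2,V5),
    (V5,V2)], (V2,V3), Pairs [((V2,V6),(V5,V6)), ((V3,V5),(V3,V6))]), ([(V2,V6), (V6,V2)],
    (V2,V3), Pairs [((V2,V5),(V5,V6)), ((V3,V5),(V3,V6))]), ([(V3,V5), (V5,V3)], (V2,V3), Pairs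
    [((V3,V6),(V5,V6)), ((V2,V5),(V2,V6))]), ([(V3,V6), (V6,V3)], (V2,V3), Pairs
    [((V3,V5),(V5,V6)), ((V2,V5),(V2,V6))]), ([(V5,V6), (V6,V5)], (V2,V3), Pairs
    [((V2,V5),(V2,V6)), ((V3,V5),(V3,V6))])])), orbit [([V0,V1,V2,V3,V4,V5,V6], False),
    ([V0,V1,V2,V3,V4,V5,V6], True)] (V4,V5) (V4,V6) (Split [(V0,V1), (V0,V4), (V0,V6), (V1,V4),
    (V1,V6)] (Pairs [((V0,V1),(V0,V4)), ((V0,V6),(V1,V6))]) (Reply [([(V2,V3), (V3,V2)], (V2,V5),
    Pairs [((V2,V6),(V3,V6)), ((V3,V5),(V5,V6))]), ([(V2,V5), (V5,V2)], (V2,V3), Pairs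
    [((V2,V6),(V5,V6)), ((V3,V5),(V3,V6))]), ([(V2,V6), (V6,V2)], (V2,V3), Pairs
    [((V2,V5),(V5,V6)), ((V3,V5),(V3,V6))]), ([(V3,V5), (V5,V3)], (V2,V3), Pairs
    [((V3,V6),(V5,V6)), ((V2,V5),(V2,V6))]), ([(V3,V6), (V6,V3)], (V2,V3), Pairs
    [((V3,V5),(V5,V6)), ((V2,V5),(V2,V6))]), ([(V5,V6), (V6,V5)], (V2,V3), Pairs
    [((V2,V5),(V2,V6)), ((V3,V5),(V3,V6))])])), orbit [([V0,V1,V2,V3,V4,V5,V6], False),
    ([V2,V3,V0,V1,V5,V4,V6], False), ([V0,V1,V2,V3,V4,V5,V6], True), ([V2,V3,V0,V1,V5,V4,V6],
    True)] (V4,V6) (V5,V6) (Split [(V0,V1), (V0,V4), (V0,V6), (V1,V4), (V1,V6)] (Reply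
    [([(V0,V6), (V4,V0)], (V0,V1), Pairs [((V1,V4),(V1,V6))]), ([(V1,V6), (V4,V1)], (V0,V1),
    Pairs [((V0,V4),(V0,V6))]), ([(V0,V1)], (V0,V4), Reply [([(V1,V4), (V6,V0)], (V1,V6), Pairs
    []), ([(V1,V6)], (V0,V6), Pairs []), ([(V6,V1)], (V1,V4), Pairs [])]), ([(V0,V4)], (V0,V6),
    Reply [([(V1,V0), (V6,V1)], (V1,V4), Pairs []), ([(V1,V4)], (V1,V6), Pairs []), ([(V4,V1)],
    (V0,V1), Pairs [])]), ([(V1,V0)], (V0,V6), Reply [([(V0,V4), (V6,V1)], (V1,V4), Pairs []),
    ([(V1,V4)], (V1,V6), Pairs []), ([(V4,V1)], (V0,V4), Pairs [])]), ([(V1,V4)], (V1,V6), Reply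
    [([(V0,V1), (V6,V0)], (V0,V4), Pairs []), ([(V0,V4)], (V0,V6), Pairs []), ([(V4,V0)],
    (V0,V1), Pairs [])]), ([(V6,V0)], (V0,V4), Reply [([(V0,V1), (V1,V4)], (V1,V6), Pairs []),
    ([(V1,V6)], (V0,V1), Pairs []), ([(V6,V1)], (V1,V4), Pairs [])]), ([(V6,V1)], (V1,V4), Reply
    [([(V0,V4), (V1,V0)], (V0,V6), Pairs []), ([(V0,V6)], (V0,V1), Pairs []), ([(V6,V0)],
    (V0,V4), Pairs [])])]) (Pairs [((V2,V3),(V2,V5)), ((V2,V6),(V3,V6))]))])"

lemma check_7_8: "check core_cert_7_8 (cycles (candidates 7 ! 8))"
  by code_simp

text \<open>A 4-wheel with hub \<open>V6\<close> and rim \<open>V0 V1 V5 V2\<close>, and a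
  \<open>K4\<close> on \<open>V3\<close>, \<open>V4\<close>, \<open>V5\<close>, \<open>V6\<close>,
  share the spoke \<open>V5 V6\<close>. Only an opening on this edge calls on the orientations:
  Breaker's \<open>V1 V6\<close> leaves a pairing in the wheel, and the \<open>K4\<close> is played
  arc by arc.\<close>

definition core_cert_7_9 :: cert where
  "core_cert_7_9 =
    Reply [([(V0,V1), (V1,V0), (V1,V5), (V2,V5), (V4,V5), (V5,V1), (V5,V2), (V5,V4)], (V5,V6),
    Pairs [((V0,V6),(V1,V6)), ((V0,V2),(V2,V6)), ((V3,V4),(V3,V5)), ((V3,V6),(V4,V6))]),
    ([(V0,V2), (V2,V0), (V3,V5), (V5,V3)], (V5,V6), Pairs [((V0,V6),(V2,V6)), ((V0,V1),(V1,V6)),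
    ((V3,V4),(V4,V5)), ((V3,V6),(V4,V6))]), ([(V0,V6), (V4,V6), (V6,V0), (V6,V4)], (V5,V6), Pairs
    [((V0,V1),(V1,V6)), ((V0,V2),(V2,V6)), ((V3,V5),(V4,V5)), ((V3,V4),(V3,V6))]), ([(V1,V6),
    (V3,V6), (V6,V1), (V6,V3)], (V5,V6), Pairs [((V0,V1),(V0,V6)), ((V0,V2),(V2,V6)),
    ((V3,V5),(V4,V5)), ((V3,V4),(V4,V6))]), ([(V2,V6), (V3,V4), (V4,V3), (V6,V2)], (V5,V6), Pairs
    [((V0,V1),(V1,V6)), ((V0,V2),(V0,V6)), ((V3,V5),(V4,V5)), ((V3,V6),(V4,V6))]), ([(V5,V6)],
    (V1,V6), Split [(V0,V2), (V0,V6), (V2,V5), (V2,V6)] (Pairs [((V2,V5),(V2,V6)),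
    ((V0,V2),(V0,V6))]) (Reply [([(V3,V6), (V5,V3)], (V3,V4), Pairs [((V4,V5),(V4,V6))]),
    ([(V4,V6), (V5,V4)], (V3,V4), Pairs [((V3,V5),(V3,V6))]), ([(V3,V4)], (V3,V5), Reply
    [([(V4,V5), (V6,V3)], (V4,V6), Pairs []), ([(V4,V6)], (V3,V6), Pairs []), ([(V6,V4)],
    (V4,V5), Pairs [])]), ([(V3,V5)], (V3,V6), Reply [([(V4,V3), (V6,V4)], (V4,V5), Pairs []),
    ([(V4,V5)], (V4,V6), Pairs []), ([(V5,V4)], (V3,V4), Pairs [])]), ([(V4,V3)], (V3,V6), Reply
    [([(V3,V5), (V6,V4)], (V4,V5), Pairs []), ([(V4,V5)], (V4,V6), Pairs []), ([(V5,V4)],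
    (V3,V5), Pairs [])]), ([(V4,V5)], (V4,V6), Reply [([(V3,V4), (V6,V3)], (V3,V5), Pairs []),
    ([(V3,V5)], (V3,V6), Pairs []), ([(V5,V3)], (V3,V4), Pairs [])]), ([(V6,V3)], (V3,V5), Reply
    [([(V3,V4), (V4,V5)], (V4,V6), Pairs []), ([(V4,V6)], (V3,V4), Pairs []), ([(V6,V4)],
    (V4,V5), Pairs [])]), ([(V6,V4)], (V4,V5), Reply [([(V3,V5), (V4,V3)], (V3,V6), Pairs []),
    ([(V3,V6)], (V3,V4), Pairs []), ([(V6,V3)], (V3,V5), Pairs [])])])), ([(V6,V5)], (V1,V6),
    Split [(V0,V2), (V0,V6), (V2,V5), (V2,V6)] (Pairs [((V2,V5),(V2,V6)), ((V0,V2),(V0,V6))])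
    (Reply [([(V3,V5), (V6,V3)], (V3,V4), Pairs [((V4,V5),(V4,V6))]), ([(V4,V5), (V6,V4)],
    (V3,V4), Pairs [((V3,V5),(V3,V6))]), ([(V3,V4)], (V3,V6), Reply [([(V4,V6), (V5,V3)],
    (V4,V5), Pairs []), ([(V4,V5)], (V3,V5), Pairs []), ([(V5,V4)], (V4,V6), Pairs [])]),
    ([(V3,V6)], (V3,V5), Reply [([(V4,V3), (V5,V4)], (V4,V6), Pairs []), ([(V4,V6)], (V4,V5),
    Pairs []), ([(V6,V4)], (V3,V4), Pairs [])]), ([(V4,V3)], (V3,V5), Reply [([(V3,V6), (V5,V4)],
    (V4,V6), Pairs []), ([(V4,V6)], (V4,V5), Pairs []), ([(V6,V4)], (V3,V6), Pairs [])]),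
    ([(V4,V6)], (V4,V5), Reply [([(V3,V4), (V5,V3)], (V3,V6), Pairs []), ([(V3,V6)], (V3,V5),
    Pairs []), ([(V6,V3)], (V3,V4), Pairs [])]), ([(V5,V3)], (V3,V6), Reply [([(V3,V4), (V4,V6)],
    (V4,V5), Pairs []), ([(V4,V5)], (V3,V4), Pairs []), ([(V5,V4)], (V4,V6), Pairs [])]),
    ([(V5,V4)], (V4,V6), Reply [([(V3,V6), (V4,V3)], (V3,V5), Pairs []), ([(V3,V5)], (V3,V4),
    Pairs []), ([(V5,V3)], (V3,V6), Pairs [])])]))]"

lemma check_7_9: "check core_cert_7_9 (cycles (candidates 7 ! 9))"
  by code_simp

subsection \<open>Breaker's strategy for the cyclic tournament\<close>

lemma length_vertices: "v \<le> 7 \<Longrightarrow> length (vertices v) = v"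
  by (simp add: vertices_def)

lemma distinct_vertices: "distinct (vertices v)"
  by (simp add: vertices_def distinct_take)

lemma vertices_Suc: "v < 7 \<Longrightarrow> vertices (Suc v) = vertices v @ [next_vertex v]"
  unfolding vertices_def next_vertex_def by (rule take_Suc_conv_app_nth) simp

lemma next_vertex_notin: "v < 7 \<Longrightarrow> next_vertex v \<notin> set (vertices v)"
  using distinct_vertices[of "Suc v"] by (simp add: vertices_Suc)

lemma rank_next:
  assumes "v < 7" "x \<in> set (vertices v)"
  shows "rank x < rank (next_vertex v)"
proof -
  have "v \<in> {0, 1, 2, 3, 4, 5, 6}" using assms(1) by auto
  then show ?thesis using assms(2)
    by (elim insertE emptyE) (auto simp: vertices_def next_vertex_def)
qed

lemma mem_edge_commute: "mem_edge g (x, y) \<longleftrightarrow> mem_edge g (y, x)"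
  by (auto simp: mem_edge_def)

lemma in_combinations_filter: "filter P xs \<in> set (combinations (length (filter P xs)) xs)"
proof (induction xs)
  case (Cons x xs)
  then show ?case
    by (cases "length (filter P xs)") auto
qed simp

lemma has_edgeI: "x \<in> set xs \<Longrightarrow> y \<in> set xs \<Longrightarrow> x \<noteq> y \<Longrightarrow> mem_edge g (x, y) \<Longrightarrow> has_edge g xs"
  by (induction xs) (auto simp: list_ex_iff mem_edge_commute)

lemma same_edges_nth:
  "same_edges g h z \<Longrightarrow> i < j \<Longrightarrow> j < length z \<Longrightarrow>
     mem_edge g (fst (z ! i), fst (z ! j)) = mem_edge h (snd (z ! i), snd (z ! j))"
proof (induction g h z arbitrary: i j rule: same_edges.induct)
  case (2 g h x x' z)
  obtain j' where j: "j = Suc j'" using 2(3) by (cases j) auto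
  show ?case
  proof (cases i)
    case 0
    have "z ! j' \<in> set z" using 2(4) j by simp
    then show ?thesis using 2(2) 0 j by (auto simp: list_all_iff split: prod.splits)
  next
    case (Suc i')
    then show ?thesis using 2 j by simp
  qed
qed simp

text \<open>Being an equivalence, the last clause makes \<open>g\<close> an induced subgraph of
  \<open>C\<close>, which is what the enumeration lists and what the edge counts refer to.\<close>

definition realizes :: "nat set set \<Rightarrow> nat \<Rightarrow> arc list \<Rightarrow> (vertex \<Rightarrow> nat) \<Rightarrow> bool" where
  "realizes C v g f \<longleftrightarrow> wf_graph v g \<and> inj_on f (set (vertices v)) \<and> f ` set (vertices v) \<subseteq> \<Union>C \<and>
     (\<forall>x\<in>set (vertices v). \<forall>y\<in>set (vertices v). x \<noteq> y \<longrightarrow> ({f x, f y} \<in> C \<longleftrightarrow> mem_edge g (x, y)))"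

text \<open>Passing to the representative renames the vertices but keeps the image in
  \<open>C\<close>, so the number of spanned edges does not change.\<close>

lemma realizes_isomorphism:
  assumes R: "realizes C v h f" and I: "isomorphism v p g h" and v: "v \<le> 7"
  shows "\<exists>f'. realizes C v g f' \<and> f' ` set (vertices v) = f ` set (vertices v)"
proof -
  let ?V = "vertices v"
  have p: "length p = v" "distinct p" "set p \<subseteq> set ?V" "same_edges g h (zip ?V p)"
    using I by (auto simp: isomorphism_def list_all_iff)
  have setp: "set p = set ?V"
    using p by (intro card_seteq) (auto simp: distinct_card length_vertices[OF v] distinct_vertices)
  define f' where "f' x = f (the (map_of (zip ?V p) x))" for x
  have f': "f' (?V ! i) = f (p ! i)" if "i < v" for i
    using that p(1) v by (simp add: f'_def map_of_zip_nth distinct_vertices length_vertices)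
  have ex: "\<exists>i<v. x = ?V ! i" if "x \<in> set ?V" for x
    using that length_vertices[OF v] by (metis in_set_conv_nth)
  have pin: "p ! i \<in> set ?V" if "i < v" for i using that p(1,3) by auto
  have injf: "inj_on f (set ?V)" using R by (simp add: realizes_def)
  have "inj_on f' (set ?V)"
  proof (rule inj_onI)
    fix x y assume "x \<in> set ?V" "y \<in> set ?V" and e: "f' x = f' y"
    then obtain i j where ij: "i < v" "j < v" "x = ?V ! i" "y = ?V ! j" using ex by metis
    with e have "f (p ! i) = f (p ! j)" by (simp add: f')
    then have "p ! i = p ! j" using inj_onD[OF injf] pin ij by blast
    then have "i = j" using p(1,2) ij by (simp add: nth_eq_iff_index_eq)
    then show "x = y" using ij by simp
  qed
  moreover have im: "f' ` set ?V = f ` set ?V"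
  proof (intro equalityI subsetI)
    fix y assume "y \<in> f' ` set ?V"
    then obtain i where "i < v" "y = f' (?V ! i)" using ex by blast
    then show "y \<in> f ` set ?V" using f' pin by auto
  next
    fix y assume "y \<in> f ` set ?V"
    then obtain i where i: "i < v" "y = f (p ! i)" using setp p(1) by (metis imageE in_set_conv_nth)
    then have "?V ! i \<in> set ?V" by (simp add: length_vertices[OF v])
    with i show "y \<in> f' ` set ?V" using f' by (metis imageI)
  qed
  moreover have "{f' x, f' y} \<in> C \<longleftrightarrow> mem_edge g (x, y)"
    if xy: "x \<in> set ?V" "y \<in> set ?V" "x \<noteq> y" for x y
  proof -
    have key: "{f' (?V ! i), f' (?V ! j)} \<in> C \<longleftrightarrow> mem_edge g (?V ! i, ?V ! j)"
      if ij: "i < j" "j < v" for i j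
    proof -
      have "p ! i \<noteq> p ! j" using p(1,2) ij by (simp add: nth_eq_iff_index_eq)
      then have "{f (p ! i), f (p ! j)} \<in> C \<longleftrightarrow> mem_edge h (p ! i, p ! j)"
        using R pin[of i] pin[of j] ij by (simp add: realizes_def)
      moreover have "mem_edge g (?V ! i, ?V ! j) = mem_edge h (p ! i, p ! j)"
        using same_edges_nth[OF p(4) ij(1)] ij p(1) length_vertices[OF v] by simp
      ultimately show ?thesis using ij by (simp add: f')
    qed
    obtain i j where ij: "i < v" "j < v" "x = ?V ! i" "y = ?V ! j" using ex xy by metis
    then consider "i < j" | "j < i" using xy(3) by (metis linorder_neqE_nat)
    then show ?thesis
    proof cases
      case 1 then show ?thesis using key[of i j] ij by simp
    next
      case 2 then show ?thesis using key[of j i] ij by (simp add: insert_commute mem_edge_commute)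
    qed
  qed
  moreover have "wf_graph v g" using I by (simp add: isomorphism_def)
  ultimately have "realizes C v g f'" using R by (simp add: realizes_def)
  with im show ?thesis by blast
qed

definition spanned :: "nat set set \<Rightarrow> nat set \<Rightarrow> nat set set" where
  "spanned C U = {e \<in> C. e \<subseteq> U}"

text \<open>Some triangle leaves the set of edges spanned by \<open>U\<close> from one of its
  members. Since \<open>U\<close> spans all edges of \<open>C\<close> between its vertices, the
  third vertex of the triangle is outside \<open>U\<close>.\<close>

lemma core_new_vertex:
  assumes "core C" "U \<subset> \<Union>C" "spanned C U \<noteq> {}"
  obtains u a b where "u \<in> \<Union>C" "u \<notin> U" "a \<in> U" "b \<in> U" "a \<noteq> b"
    "{a, b} \<in> C" "{a, u} \<in> C" "{b, u} \<in> C"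
proof -
  let ?S = "spanned C U"
  have "?S \<noteq> C" using assms(2) by (auto simp: spanned_def)
  then have "?S \<subset> C" by (auto simp: spanned_def)
  then obtain t where t: "triangle t" "t \<subseteq> C" "t \<inter> ?S \<noteq> {}" "\<not> t \<subseteq> ?S"
  proof -
    have "triangle_connected C" using assms(1) by (simp add: core_def)
    then show thesis using that \<open>?S \<subset> C\<close> assms(3) unfolding triangle_connected_def by metis
  qed
  then obtain e where e: "e \<in> t" "e \<in> ?S" by blast
  obtain a b c where c: "a \<noteq> b" "b \<noteq> c" "a \<noteq> c" "e = {a, b}" "t = {{a, b}, {b, c}, {a, c}}"
    by (rule triangle_edgeE[OF t(1) e(1)])
  have ab: "a \<in> U" "b \<in> U" using e(2) c(4) by (auto simp: spanned_def)
  have inC: "{a, b} \<in> C" "{b, c} \<in> C" "{a, c} \<in> C" using t(2) by (simp_all add: c(5))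
  have "c \<notin> U"
  proof
    assume "c \<in> U"
    then have "t \<subseteq> ?S" using ab inC by (simp add: c(5) spanned_def)
    with t(4) show False ..
  qed
  then show thesis using that[of c a b] ab inC c(1) by blast
qed

lemma spanned_insert:
  assumes "graph C" "u \<notin> U" "finite U"
  shows "card (spanned C (insert u U)) = card (spanned C U) + card {x \<in> U. {x, u} \<in> C}"
    and "edges_at (spanned C (insert u U)) u = (\<lambda>x. {x, u}) ` {x \<in> U. {x, u} \<in> C}"
proof -
  let ?N = "{x \<in> U. {x, u} \<in> C}"
  show E: "edges_at (spanned C (insert u U)) u = (\<lambda>x. {x, u}) ` ?N"
  proof (intro equalityI subsetI)
    fix e assume "e \<in> edges_at (spanned C (insert u U)) u"
    then have e: "e \<in> C" "e \<subseteq> insert u U" "u \<in> e" by (auto simp: edges_at_def spanned_def)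
    obtain a b where ab: "e = {a, b}" "a \<noteq> b" by (rule graph_edgeE[OF assms(1) e(1)])
    from e(3) ab(1) consider "a = u" | "b = u" by blast
    then show "e \<in> (\<lambda>x. {x, u}) ` ?N"
    proof cases
      case 1
      then have "b \<in> U" "e = {b, u}" using e(2) ab by auto
      then show ?thesis using e(1) by blast
    next
      case 2
      then have "a \<in> U" "e = {a, u}" using e(2) ab by auto
      then show ?thesis using e(1) by blast
    qed
  qed (auto simp: edges_at_def spanned_def)
  have "spanned C (insert u U) = spanned C U \<union> edges_at (spanned C (insert u U)) u"
    by (auto simp: spanned_def edges_at_def)
  moreover have "spanned C U \<inter> edges_at (spanned C (insert u U)) u = {}"
    using assms(2) by (auto simp: spanned_def edges_at_def)
  moreover have "finite C" using assms(1) by (simp add: graph_def)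
  then have "finite (spanned C U)" "finite (edges_at (spanned C (insert u U)) u)"
    by (auto simp: spanned_def edges_at_def)
  ultimately have "card (spanned C (insert u U)) =
      card (spanned C U) + card (edges_at (spanned C (insert u U)) u)"
    by (metis card_Un_disjoint)
  moreover have "inj_on (\<lambda>x. {x, u}) ?N" by (auto simp: inj_on_def doubleton_eq_iff)
  ultimately show "card (spanned C (insert u U)) = card (spanned C U) + card ?N"
    by (simp add: E card_image)
qed

lemma core_last_vertex:
  assumes "core C" "insert u U = \<Union>C" "u \<notin> U"
  shows "3 \<le> card {x \<in> U. {x, u} \<in> C}"
proof -
  have g: "graph C" using assms(1) by (simp add: core_def)
  have "finite U" using graph_finite_vertices[OF g] assms(2) by (metis finite_insert)
  note E = spanned_insert(2)[OF g assms(3) this]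
  have "spanned C (insert u U) = C" unfolding assms(2) by (auto simp: spanned_def)
  with E have "edges_at C u = (\<lambda>x. {x, u}) ` {x \<in> U. {x, u} \<in> C}" by simp
  moreover have "u \<in> \<Union>C" using assms(2) by blast
  then have "3 \<le> card (edges_at C u)" using assms(1) unfolding core_def by blast
  ultimately show ?thesis
    using card_image_le[of "{x \<in> U. {x, u} \<in> C}" "\<lambda>x. {x, u}"] \<open>finite U\<close> by simp
qed

text \<open>The vertices outside \<open>U\<close> can be added so that each brings at least 2 edges.
  The last one brings its full degree, at least 3, which accounts for the extra 1.\<close>

lemma spanned_lower_bound:
  assumes "core C" "U \<subset> \<Union>C" "spanned C U \<noteq> {}"
  shows "card (spanned C U) + 2 * (card (\<Union>C) - card U) + 1 \<le> card C"
  using assms(2,3)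
proof (induction "card (\<Union>C) - card U" arbitrary: U rule: less_induct)
  case less
  have g: "graph C" using assms(1) by (simp add: core_def)
  note fin = graph_finite_vertices[OF g]
  have fU: "finite U" using less.prems(1) fin by (meson finite_subset psubset_imp_subset)
  obtain u a b where u: "u \<in> \<Union>C" "u \<notin> U" "a \<in> U" "b \<in> U" "a \<noteq> b"
    "{a, b} \<in> C" "{a, u} \<in> C" "{b, u} \<in> C"
    by (rule core_new_vertex[OF assms(1) less.prems])
  let ?N = "{x \<in> U. {x, u} \<in> C}"
  note cs = spanned_insert(1)[OF g u(2) fU]
  have cU: "card (insert u U) = card U + 1" using fU u(2) by simp
  have sub: "insert u U \<subseteq> \<Union>C" using u(1) less.prems(1) by blast
  have lt: "card U < card (\<Union>C)" using less.prems(1) fin by (rule psubset_card_mono[rotated])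
  show ?case
  proof (cases "insert u U = \<Union>C")
    case True
    have "spanned C (insert u U) = C" unfolding True by (auto simp: spanned_def)
    moreover have "card (\<Union>C) = card U + 1" using cU True by simp
    ultimately show ?thesis using cs core_last_vertex[OF assms(1) True u(2)] by simp
  next
    case False
    then have ps: "insert u U \<subset> \<Union>C" using sub by blast
    have "card {a, b} \<le> card ?N" using u fU by (intro card_mono) auto
    then have N: "2 \<le> card ?N" using u(5) by simp
    have "card (\<Union>C) - card (insert u U) < card (\<Union>C) - card U" using cU lt by simp
    moreover have "spanned C (insert u U) \<noteq> {}" using less.prems(2) by (auto simp: spanned_def)
    ultimately have "card (spanned C (insert u U)) + 2 * (card (\<Union>C) - card (insert u U)) + 1 \<le> card C"
      using ps by (intro less.hyps) auto
    then show ?thesis using cs N cU lt by linarith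
  qed
qed

lemma realizes_extend:
  assumes C: "core C" and R: "realizes C v g f" and v: "v < 7" "v < card (\<Union>C)"
    and S: "spanned C (f ` set (vertices v)) \<noteq> {}"
  obtains h r f' where "h \<in> set (extensions r v g)" "realizes C (Suc v) h f'" "2 \<le> r"
    "card (spanned C (f' ` set (vertices (Suc v)))) = card (spanned C (f ` set (vertices v))) + r"
proof -
  let ?V = "vertices v" and ?w = "next_vertex v"
  let ?U = "f ` set ?V"
  have g: "graph C" using C by (simp add: core_def)
  have wf: "wf_graph v g" and inj: "inj_on f (set ?V)" and sub: "?U \<subseteq> \<Union>C"
    and adj: "\<And>x y. x \<in> set ?V \<Longrightarrow> y \<in> set ?V \<Longrightarrow> x \<noteq> y \<Longrightarrow> {f x, f y} \<in> C \<longleftrightarrow> mem_edge g (x, y)"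
    using R by (simp_all add: realizes_def)
  have cV: "card (set ?V) = v" using v by (simp add: distinct_card distinct_vertices length_vertices)
  then have "card ?U = v" using inj by (simp add: card_image)
  then have ps: "?U \<subset> \<Union>C" using sub v(2) by auto
  obtain u a b where u: "u \<in> \<Union>C" "u \<notin> ?U" "a \<in> ?U" "b \<in> ?U" "a \<noteq> b"
    "{a, b} \<in> C" "{a, u} \<in> C" "{b, u} \<in> C"
    by (rule core_new_vertex[OF C ps S])
  \<comment> \<open>All neighbours of the new vertex within the image are recorded, so that the
    extended list is again induced; \<open>r\<close> is their number.\<close>
  define N where "N = filter (\<lambda>i. {f i, u} \<in> C) ?V"
  define f' where "f' = f(?w := u)"
  have wV: "?w \<notin> set ?V" using next_vertex_notin[OF v(1)] .
  have f'V: "f' x = f x" if "x \<in> set ?V" for x using that wV by (auto simp: f'_def)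
  have f'w: "f' ?w = u" by (simp add: f'_def)
  have im: "f' ` set (vertices (Suc v)) = insert u ?U"
    using f'V f'w by (simp add: vertices_Suc[OF v(1)])
  obtain x y where xy: "x \<in> set ?V" "y \<in> set ?V" "a = f x" "b = f y" using u(3,4) by blast
  have xyN: "x \<in> set N" "y \<in> set N" "x \<noteq> y" using xy u by (auto simp: N_def)
  have "mem_edge g (x, y)" using adj[OF xy(1,2) xyN(3)] u(6) xy by simp
  from has_edgeI[OF xyN this] have ext: "map (\<lambda>i. (i, ?w)) N @ g \<in> set (extensions (length N) v g)"
    using in_combinations_filter[of "\<lambda>i. {f i, u} \<in> C" ?V] by (simp add: extensions_def N_def)
  have dN: "distinct N" by (simp add: N_def distinct_vertices)
  have setN: "set N = {i \<in> set ?V. {f i, u} \<in> C}" by (auto simp: N_def)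
  have "card {x, y} \<le> card (set N)" using xyN by (intro card_mono) auto
  then have two: "2 \<le> length N" using xyN(3) dN by (simp add: distinct_card)
  have "{z \<in> ?U. {z, u} \<in> C} = f ` set N" by (auto simp: setN)
  moreover have "card (f ` set N) = length N"
  proof -
    have "inj_on f (set N)" by (rule inj_on_subset[OF inj]) (auto simp: setN)
    then show ?thesis using distinct_card[OF dN] by (simp add: card_image)
  qed
  ultimately have cnt: "card (spanned C (f' ` set (vertices (Suc v)))) = card (spanned C ?U) + length N"
    unfolding im using spanned_insert(1)[OF g u(2)] by simp
  have "realizes C (Suc v) (map (\<lambda>i. (i, ?w)) N @ g) f'"
    unfolding realizes_def
  proof (intro conjI ballI impI)
    have "inj_on f' (set ?V)" using inj f'V by (simp cong: inj_on_cong)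
    moreover have "f' ?w \<notin> f' ` (set ?V - {?w})" using u(2) f'V f'w by auto
    ultimately show "inj_on f' (set (vertices (Suc v)))"
      by (simp add: vertices_Suc[OF v(1)])
    show "f' ` set (vertices (Suc v)) \<subseteq> \<Union>C" unfolding im using u(1) sub by blast
    show "wf_graph (Suc v) (map (\<lambda>i. (i, ?w)) N @ g)"
      using wf rank_next[OF v(1)]
      by (auto simp: wf_graph_def list_all_iff vertices_Suc[OF v(1)] setN)
    fix p q assume pq: "p \<in> set (vertices (Suc v))" "q \<in> set (vertices (Suc v))" "p \<noteq> q"
    have new: "mem_edge (map (\<lambda>i. (i, ?w)) N @ g) (p, q) \<longleftrightarrow>
        (q = ?w \<and> p \<in> set N) \<or> (p = ?w \<and> q \<in> set N) \<or> mem_edge g (p, q)"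
      by (auto simp: mem_edge_iff)
    have gV: "\<not> mem_edge g (p, q)" if "p = ?w \<or> q = ?w"
      using that wf wV by (force simp: mem_edge_iff wf_graph_def list_all_iff)
    consider "p \<in> set ?V" "q \<in> set ?V" | "p \<in> set ?V" "q = ?w" | "p = ?w" "q \<in> set ?V"
      using pq by (auto simp: vertices_Suc[OF v(1)])
    then show "{f' p, f' q} \<in> C \<longleftrightarrow> mem_edge (map (\<lambda>i. (i, ?w)) N @ g) (p, q)"
    proof cases
      case 1
      then show ?thesis using new adj pq(3) wV by (auto simp: f'V)
    next
      case 2
      then show ?thesis using new gV wV by (auto simp: f'V f'w setN)
    next
      case 3
      then show ?thesis using new gV wV by (auto simp: f'V f'w setN insert_commute)
    qed
  qed
  with ext two cnt show thesis using that by blast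
qed

lemma list_all2_obtain:
  assumes "list_all2 P xs ys" "x \<in> set xs"
  obtains y where "y \<in> set ys" "P x y"
  using assms by (metis in_set_conv_nth list_all2_conv_all_nth)

lemma growth_checkD:
  assumes "growth_check v k r k' ps" "g \<in> set (level v k)" "h \<in> set (extensions r v g)"
  shows "\<exists>g'\<in>set (level (Suc v) k'). \<exists>p. isomorphism (Suc v) p g' h"
proof -
  have "h \<in> set (concat (map (extensions r v) (level v k)))" using assms(2,3) by auto
  then obtain y where "(case y of (i, p) \<Rightarrow> i < length (level (Suc v) k') \<and> isomorphism (Suc v) p (level (Suc v) k' ! i) h)"
    by (rule list_all2_obtain[OF assms(1)[unfolded growth_check_def Let_def]])
  then obtain i p where "i < length (level (Suc v) k')" "isomorphism (Suc v) p (level (Suc v) k' ! i) h"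
    by (cases y) auto
  then show ?thesis using nth_mem by blast
qed

lemma final_checkD:
  assumes "final_check v k r ps" "g \<in> set (level v k)" "h \<in> set (extensions r v g)"
    "core_like (Suc v) h"
  shows "\<exists>i p. i < length (candidates (Suc v)) \<and> isomorphism (Suc v) p (candidates (Suc v) ! i) h"
proof -
  have "h \<in> set (filter (core_like (Suc v)) (concat (map (extensions r v) (level v k))))"
    using assms(2-4) by auto
  then obtain y where "(case y of (i, p) \<Rightarrow> i < length (candidates (Suc v)) \<and> isomorphism (Suc v) p (candidates (Suc v) ! i) h)"
    by (rule list_all2_obtain[OF assms(1)[unfolded final_check_def Let_def]])
  then obtain i p where "i < length (candidates (Suc v))" "isomorphism (Suc v) p (candidates (Suc v) ! i) h"
    by (cases y) auto
  then show ?thesis by blast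
qed

lemma level_step:
  assumes "v = 3 \<or> v = 4 \<or> v = 5" "2 \<le> r" "k + r \<le> 3"
    "g \<in> set (level v k)" "h \<in> set (extensions r v g)"
  shows "\<exists>g'\<in>set (level (Suc v) (k + r - 2)). \<exists>p. isomorphism (Suc v) p g' h"
proof -
  have "k = 0 \<and> r = 2 \<or> k = 0 \<and> r = 3 \<or> k = 1 \<and> r = 2" using assms(2,3) by linarith
  \<comment> \<open>\<open>level 3 1\<close> is empty, as a triangle has no room for a fourth
    edge.\<close>
  moreover have "v = 3 \<Longrightarrow> k \<noteq> 1" using assms(4) by (auto simp: level_def)
  ultimately show ?thesis using assms(1,4,5)
    growth_checkD[OF growth_3_0_2] growth_checkD[OF growth_3_0_3]
    growth_checkD[OF growth_4_0_2] growth_checkD[OF growth_4_0_3] growth_checkD[OF growth_4_1_2]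
    growth_checkD[OF growth_5_0_2] growth_checkD[OF growth_5_0_3] growth_checkD[OF growth_5_1_2]
    by (elim disjE conjE) simp_all
qed

lemma final_step:
  assumes "v = 4 \<or> v = 5 \<or> v = 6" "k \<le> 1" "k + r = 4"
    "g \<in> set (level v k)" "h \<in> set (extensions r v g)" "core_like (Suc v) h"
  shows "\<exists>i p. i < length (candidates (Suc v)) \<and> isomorphism (Suc v) p (candidates (Suc v) ! i) h"
proof -
  have "k = 0 \<and> r = 4 \<or> k = 1 \<and> r = 3" using assms(2,3) by linarith
  then show ?thesis using assms(1,4,5,6)
    final_checkD[OF final_4_0] final_checkD[OF final_4_1] final_checkD[OF final_5_0]
    final_checkD[OF final_5_1] final_checkD[OF final_6_0] final_checkD[OF final_6_1]
    by (elim disjE conjE) simp_all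
qed

lemma candidate_cert:
  assumes "v = 5 \<or> v = 6 \<or> v = 7" "i < length (candidates v)"
  shows "\<exists>c. check c (cycles (candidates v ! i))"
proof -
  have "length (candidates 5) = 1" "length (candidates 6) = 4" "length (candidates 7) = 10"
    by (simp_all add: candidates_def)
  note len = this
  from assms(1) show ?thesis
  proof (elim disjE)
    assume v: "v = 5"
    then have "i = 0" using assms(2) len by simp
    then show ?thesis using v check_5_0 by blast
  next
    assume v: "v = 6"
    then have "i < 4" using assms(2) len by simp
    then have "i = 0 \<or> i = 1 \<or> i = 2 \<or> i = 3" by linarith
    then show ?thesis using v check_6_0 check_6_1 check_6_2 check_6_3 by (elim disjE) blast+
  next
    assume v: "v = 7"
    then have "i < 10" using assms(2) len by simp
    then have "i = 0 \<or> i = 1 \<or> i = 2 \<or> i = 3 \<or> i = 4 \<or> i = 5 \<or> i = 6 \<or> i = 7 \<or> i = 8 \<or> i = 9"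
      by auto
    then show ?thesis using v check_7_0 check_7_1 check_7_2 check_7_3 check_7_4 check_7_5 check_7_6
        check_7_7 check_7_8 check_7_9 by (elim disjE) blast+
  qed
qed

definition cyclic_goal :: "nat rel \<Rightarrow> bool" where
  "cyclic_goal D \<longleftrightarrow> (\<exists>a b c. a \<noteq> b \<and> b \<noteq> c \<and> a \<noteq> c \<and> (a, b) \<in> D \<and> (b, c) \<in> D \<and> (c, a) \<in> D)"

lemma local_goal_cyclic_goal: "local_goal cyclic_goal"
  unfolding local_goal_def
proof (intro allI impI)
  fix D assume "cyclic_goal D"
  then obtain a b c where abc: "a \<noteq> b" "b \<noteq> c" "a \<noteq> c" "(a, b) \<in> D" "(b, c) \<in> D" "(c, a) \<in> D"
    by (auto simp: cyclic_goal_def)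
  let ?t = "{{a, b}, {b, c}, {a, c}}"
  show "\<exists>t. triangle t \<and> t \<subseteq> undir ` D \<and> (\<forall>D'. {d \<in> D. undir d \<in> t} \<subseteq> D' \<longrightarrow> cyclic_goal D')"
  proof (intro exI[of _ ?t] conjI allI impI)
    show "triangle ?t" using abc(1-3) by (rule triangleI)
    have "{a, b} = undir (a, b)" "{b, c} = undir (b, c)" "{a, c} = undir (c, a)" by auto
    then show "?t \<subseteq> undir ` D" using abc(4-6) by (metis empty_subsetI image_eqI insert_subset)
    fix D' assume "{d \<in> D. undir d \<in> ?t} \<subseteq> D'"
    moreover have "(a, b) \<in> {d \<in> D. undir d \<in> ?t}" "(b, c) \<in> {d \<in> D. undir d \<in> ?t}"
      "(c, a) \<in> {d \<in> D. undir d \<in> ?t}" using abc(4-6) by (auto simp: insert_commute)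
    ultimately show "cyclic_goal D'" unfolding cyclic_goal_def using abc(1-3) by blast
  qed
qed

lemma cyclesI:
  assumes "(a, b) \<in> set g" "(b, d) \<in> set g" "(a, d) \<in> set g"
  shows "[(a, b), (b, d), (d, a)] \<in> set (cycles g)" "[(b, a), (d, b), (a, d)] \<in> set (cycles g)"
proof -
  have "{[(a, b), (b, d), (d, a)], [(b, a), (d, b), (a, d)]} \<subseteq> set (cycles g)"
    unfolding cycles_def using assms
    by (simp add: mem_iff) (intro conjI; rule bexI[of _ "(a, b)"]; simp?; rule bexI[of _ "(b, d)"]; simp)
  then show "[(a, b), (b, d), (d, a)] \<in> set (cycles g)" "[(b, a), (d, b), (a, d)] \<in> set (cycles g)"
    by simp_all
qed

lemma cyclesE:
  assumes "c \<in> set (cycles g)" "a \<in> set c"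
  shows "mem_edge g a"
  using assms by (auto simp: cycles_def mem_iff mem_edge_iff split: if_splits)

text \<open>The triangle is listed under its vertices sorted by rank. Of the six possible orders of
  \<open>x\<close>, \<open>y\<close>, \<open>z\<close>, three make the given cycle the first listed
  orientation and three the second.\<close>

lemma cycle_in_cycles:
  assumes g: "wf_graph v g" and m: "mem_edge g (x, y)" "mem_edge g (y, z)" "mem_edge g (z, x)"
  shows "\<exists>c\<in>set (cycles g). set c \<subseteq> {(x, y), (y, z), (z, x)}"
proof -
  have rk: "rank a < rank b" if "(a, b) \<in> set g" for a b
    using that g by (auto simp: wf_graph_def list_all_iff)
  have dir: "(a, b) \<in> set g" if "mem_edge g (a, b)" "rank a < rank b" for a b
    using that rk[of b a] by (auto simp: mem_edge_iff)
  have ne: "rank a \<noteq> rank b" if "mem_edge g (a, b)" for a b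
    using that rk[of a b] rk[of b a] by (auto simp: mem_edge_iff)
  have c: "mem_edge g (y, x)" "mem_edge g (z, y)" "mem_edge g (x, z)"
    using m by (simp_all add: mem_edge_commute)
  consider "rank x < rank y" "rank y < rank z" | "rank y < rank z" "rank z < rank x"
    | "rank z < rank x" "rank x < rank y" | "rank z < rank y" "rank y < rank x"
    | "rank x < rank z" "rank z < rank y" | "rank y < rank x" "rank x < rank z"
    using ne[OF m(1)] ne[OF m(2)] ne[OF m(3)] by linarith
  then show ?thesis
  proof cases
    case 1
    then show ?thesis using cyclesI(1)[of x y g z] dir m c by (intro bexI[rotated]) auto
  next
    case 2
    then show ?thesis using cyclesI(1)[of y z g x] dir m c by (intro bexI[rotated]) auto
  next
    case 3
    then show ?thesis using cyclesI(1)[of z x g y] dir m c by (intro bexI[rotated]) auto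
  next
    case 4
    then show ?thesis using cyclesI(2)[of z y g x] dir m c by (intro bexI[rotated]) auto
  next
    case 5
    then show ?thesis using cyclesI(2)[of x z g y] dir m c by (intro bexI[rotated]) auto
  next
    case 6
    then show ?thesis using cyclesI(2)[of y x g z] dir m c by (intro bexI[rotated]) auto
  qed
qed

lemma realizes_surj:
  assumes "realizes C v g f" "graph C" "card (\<Union>C) = v" "v \<le> 7"
  shows "f ` set (vertices v) = \<Union>C"
proof (rule card_subset_eq)
  show "finite (\<Union>C)" by (rule graph_finite_vertices[OF assms(2)])
  show "f ` set (vertices v) \<subseteq> \<Union>C" using assms(1) by (simp add: realizes_def)
  show "card (f ` set (vertices v)) = card (\<Union>C)"
    using assms by (simp add: realizes_def card_image distinct_card distinct_vertices length_vertices)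
qed

lemma breaker_wins_realized:
  assumes R: "realizes C v g f" and C: "graph C" "card (\<Union>C) = v" "v \<le> 7"
    and c: "check c (cycles g)"
  shows "breaker_wins cyclic_goal {} C"
proof -
  let ?V = "set (vertices v)"
  interpret vertex_embedding f ?V using R by unfold_locales (simp add: realizes_def)
  have wf: "wf_graph v g" using R by (simp add: realizes_def)
  have "wf_arcs (cycles g)" unfolding wf_arcs_def
  proof (intro ballI)
    fix k a assume "k \<in> set (cycles g)" "a \<in> set k"
    then have "mem_edge g a" by (rule cyclesE)
    then have "a \<in> ?V \<times> ?V \<and> rank (fst a) \<noteq> rank (snd a)"
      using wf by (cases a) (auto simp: wf_graph_def list_all_iff mem_edge_iff)
    then show "a \<in> ?V \<times> ?V \<and> fst a \<noteq> snd a" by auto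
  qed
  moreover have fin: "finite C" using C(1) by (simp add: graph_def)
  ultimately have "breaker_wins (goal (cycles g)) {} C" using c by (intro check_sound)
  then show ?thesis
  proof (rule breaker_wins_restrict[OF fin])
    fix Y assume Y: "undir ` (Y - {}) \<subseteq> C" and "cyclic_goal Y"
    then obtain a b d where abd: "a \<noteq> b" "b \<noteq> d" "a \<noteq> d" "(a, b) \<in> Y" "(b, d) \<in> Y" "(d, a) \<in> Y"
      by (auto simp: cyclic_goal_def)
    have inC: "{a, b} \<in> C" "{b, d} \<in> C" "{d, a} \<in> C" using Y abd(4-6) by force+
    then have "a \<in> \<Union>C" "b \<in> \<Union>C" "d \<in> \<Union>C" by blast+
    then obtain x y z where xyz: "x \<in> ?V" "y \<in> ?V" "z \<in> ?V" "a = f x" "b = f y" "d = f z"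
      unfolding realizes_surj[OF R C, symmetric] by blast
    have "mem_edge g (x, y)" "mem_edge g (y, z)" "mem_edge g (z, x)"
      using R xyz inC abd(1-3) unfolding realizes_def by metis+
    from cycle_in_cycles[OF wf this] obtain k where
      k: "k \<in> set (cycles g)" "set k \<subseteq> {(x, y), (y, z), (z, x)}" by blast
    have "img ` set k \<subseteq> Y"
    proof
      fix q assume "q \<in> img ` set k"
      then obtain p where "q = img p" "p \<in> set k" by (rule imageE)
      then have "p = (x, y) \<or> p = (y, z) \<or> p = (z, x)" using k(2) by blast
      then show "q \<in> Y" using abd xyz \<open>q = img p\<close> by auto
    qed
    then show "goal (cycles g) Y" using k(1) unfolding goal_def by blast
  qed
qed

lemma core_like_realized:
  assumes R: "realizes C v h f" and C: "core C" "card (\<Union>C) = v" "v \<le> 7"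
  shows "core_like v h"
proof -
  let ?V = "set (vertices v)"
  have g: "graph C" using C(1) by (simp add: core_def)
  note surj = realizes_surj[OF R g C(2,3)]
  have inj: "inj_on f ?V" and wf: "wf_graph v h"
    and adj: "\<And>x y. x \<in> ?V \<Longrightarrow> y \<in> ?V \<Longrightarrow> x \<noteq> y \<Longrightarrow> {f x, f y} \<in> C \<longleftrightarrow> mem_edge h (x, y)"
    using R by (simp_all add: realizes_def)
  have three: "at_least_3 l" if "3 \<le> length l" for l :: "arc list"
    using that by (cases l rule: at_least_3.cases) auto
  have deg: "at_least_3 (filter (\<lambda>(a, b). a = x \<or> b = x) h)" if x: "x \<in> ?V" for x
  proof (rule three)
    let ?l = "filter (\<lambda>(a, b). a = x \<or> b = x) h"
    have "edges_at C (f x) \<subseteq> (\<lambda>(a, b). {f a, f b}) ` set ?l"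
    proof
      fix e assume "e \<in> edges_at C (f x)"
      then have e: "e \<in> C" "f x \<in> e" by (auto simp: edges_at_def)
      obtain a b where "e = {a, b}" "a \<noteq> b" by (rule graph_edgeE[OF g e(1)])
      with e(2) obtain b' where b': "e = {f x, b'}" "b' \<noteq> f x" by blast
      then have "b' \<in> \<Union>C" using e(1) by blast
      then obtain y where y: "y \<in> ?V" "b' = f y" using surj by blast
      then have "mem_edge h (x, y)" using adj[OF x y(1)] b' e(1) by auto
      then have "(x, y) \<in> set ?l \<or> (y, x) \<in> set ?l" by (auto simp: mem_edge_iff)
      then show "e \<in> (\<lambda>(a, b). {f a, f b}) ` set ?l"
        using b'(1) y(2) by (force simp: insert_commute)
    qed
    then have "card (edges_at C (f x)) \<le> card ((\<lambda>(a, b). {f a, f b}) ` set ?l)"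
      by (intro card_mono) auto
    also have "\<dots> \<le> length ?l" by (meson card_image_le card_length finite_set le_trans)
    finally have "card (edges_at C (f x)) \<le> length ?l" .
    moreover have "f x \<in> \<Union>C" using surj x by blast
    then have "3 \<le> card (edges_at C (f x))" using C(1) unfolding core_def by blast
    ultimately show "3 \<le> length ?l" by simp
  qed
  have tri: "\<exists>z\<in>?V. mem_edge h (a, z) \<and> mem_edge h (b, z)" if ab: "(a, b) \<in> set h" for a b
  proof -
    have V: "a \<in> ?V" "b \<in> ?V" "a \<noteq> b" using wf ab by (auto simp: wf_graph_def list_all_iff)
    have "mem_edge h (a, b)" using ab by (simp add: mem_edge_iff)
    then have "{f a, f b} \<in> C" using adj[OF V] by simp
    then obtain t where t: "triangle t" "t \<subseteq> C" "{f a, f b} \<in> t"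
      using C(1) unfolding core_def by blast
    obtain c where c: "c \<noteq> f a" "c \<noteq> f b" "t = {{f a, f b}, {f b, c}, {f a, c}}"
      by (rule triangle_edge_thirdE[OF t(1,3)])
    have inC: "{f b, c} \<in> C" "{f a, c} \<in> C" using t(2) by (simp_all add: c(3))
    then have "c \<in> \<Union>C" by blast
    then obtain z where z: "z \<in> ?V" "c = f z" using surj by blast
    have "mem_edge h (a, z)" using adj[OF V(1) z(1)] inC(2) c(1) z(2) by auto
    moreover have "mem_edge h (b, z)" using adj[OF V(2) z(1)] inC(1) c(2) z(2) by auto
    ultimately show ?thesis using z(1) by blast
  qed
  show ?thesis unfolding core_like_def using deg tri by (auto simp: list_all_iff list_ex_iff)
qed

text \<open>In a core with n vertices and 2n - 1 edges, \<open>spanned_lower_bound\<close> leaves at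
  most 2v - 2 edges on v < n vertices, which is the bound \<open>k \<le> 1\<close>. After each added
  vertex the subgraph is replaced by its representative.\<close>

lemma core_level:
  assumes C: "core C" "card C + 1 = 2 * card (\<Union>C)" "card (\<Union>C) \<le> 7"
    and v: "3 \<le> v" "v < card (\<Union>C)"
  shows "\<exists>k\<le>1. \<exists>g\<in>set (level v k). \<exists>f. realizes C v g f \<and>
    card (spanned C (f ` set (vertices v))) + 3 = 2 * v + k"
  using v
proof (induction v rule: nat_induct_at_least)
  case base
  have g: "graph C" using C(1) by (simp add: core_def)
  have "C \<noteq> {}" using C(1) by (simp add: core_def)
  then obtain e where "e \<in> C" by blast
  then obtain t where t: "triangle t" "t \<subseteq> C" using C(1) unfolding core_def by blast
  then obtain a b c where abc: "a \<noteq> b" "b \<noteq> c" "a \<noteq> c" "t = {{a, b}, {b, c}, {a, c}}"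
    by (auto simp: triangle_def)
  have inC: "{a, b} \<in> C" "{b, c} \<in> C" "{a, c} \<in> C" using t(2) by (simp_all add: abc(4))
  define f where "f x = (if x = V0 then a else if x = V1 then b else c)" for x
  let ?g = "[(V0, V1), (V0, V2), (V1, V2)]"
  have V3: "vertices 3 = [V0, V1, V2]" by (simp add: vertices_def)
  have "inj_on f (set (vertices 3))" using abc(1-3) by (auto simp: V3 inj_on_def f_def)
  moreover have fV: "f ` set (vertices 3) = {a, b, c}" by (auto simp: V3 f_def)
  then have "f ` set (vertices 3) \<subseteq> \<Union>C" using inC by auto
  moreover have "wf_graph 3 ?g" by (simp add: wf_graph_def V3)
  moreover have "{f x, f y} \<in> C \<longleftrightarrow> mem_edge ?g (x, y)"
    if "x \<in> set (vertices 3)" "y \<in> set (vertices 3)" "x \<noteq> y" for x y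
    using that inC by (auto simp: V3 f_def mem_edge_def insert_commute)
  ultimately have R: "realizes C 3 ?g f" by (simp add: realizes_def)
  have "spanned C {a, b, c} = {{a, b}, {b, c}, {a, c}}"
  proof (intro equalityI subsetI)
    fix e assume "e \<in> spanned C {a, b, c}"
    then have e: "e \<in> C" "e \<subseteq> {a, b, c}" by (auto simp: spanned_def)
    obtain x y where "e = {x, y}" "x \<noteq> y" by (rule graph_edgeE[OF g e(1)])
    with e(2) show "e \<in> {{a, b}, {b, c}, {a, c}}" by (auto simp: insert_commute)
  qed (use inC in \<open>auto simp: spanned_def\<close>)
  then have "card (spanned C (f ` set (vertices 3))) = 3"
    using triangle_card[OF t(1)] abc(4) fV by simp
  moreover have "?g \<in> set (level 3 0)" by (simp add: level_def)
  ultimately show ?case using R by (intro exI[of _ 0] conjI bexI[of _ ?g] exI[of _ f]) simp_all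
next
  case (Suc v)
  then have v: "v < card (\<Union>C)" "v < 7" using C(3) by linarith+
  from Suc.IH[OF v(1)] obtain k g f where k: "k \<le> 1" "g \<in> set (level v k)" "realizes C v g f"
    "card (spanned C (f ` set (vertices v))) + 3 = 2 * v + k" by blast
  have "spanned C (f ` set (vertices v)) \<noteq> {}" using k(4) Suc.hyps by auto
  from realizes_extend[OF C(1) k(3) v(2,1) this]
  obtain h r f' where h: "h \<in> set (extensions r v g)" "realizes C (Suc v) h f'" "2 \<le> r"
    "card (spanned C (f' ` set (vertices (Suc v)))) = card (spanned C (f ` set (vertices v))) + r"
    by blast
  let ?U = "f' ` set (vertices (Suc v))"
  have "card ?U = Suc v" using h(2) v(2)
    by (simp add: realizes_def card_image distinct_card distinct_vertices length_vertices)
  moreover have "?U \<subseteq> \<Union>C" using h(2) by (simp add: realizes_def)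
  ultimately have ps: "?U \<subset> \<Union>C" using Suc.prems by auto
  have "spanned C ?U \<noteq> {}" using h(3,4) by auto
  from spanned_lower_bound[OF C(1) ps this] have "k + r \<le> 3"
    using \<open>card ?U = Suc v\<close> h(4) k(4) C(2) Suc.prems by linarith
  have "v = 3 \<or> v = 4 \<or> v = 5" using Suc.hyps Suc.prems C(3) by linarith
  from level_step[OF this h(3) \<open>k + r \<le> 3\<close> k(2) h(1)]
  obtain g' p where g': "g' \<in> set (level (Suc v) (k + r - 2))" "isomorphism (Suc v) p g' h" by blast
  obtain f'' where f'': "realizes C (Suc v) g' f''" "f'' ` set (vertices (Suc v)) = ?U"
    using realizes_isomorphism[OF h(2) g'(2)] v(2) by auto
  have "card (spanned C (f'' ` set (vertices (Suc v)))) + 3 = 2 * Suc v + (k + r - 2)"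
    using f''(2) h(3,4) k(4) by simp
  moreover have "k + r - 2 \<le> 1" using \<open>k + r \<le> 3\<close> by simp
  ultimately show ?case using g'(1) f''(1) by blast
qed

lemma breaker_wins_dense_core:
  assumes C: "core C" "card C + 1 = 2 * card (\<Union>C)" "card (\<Union>C) \<le> 7"
  shows "breaker_wins cyclic_goal {} C"
proof -
  let ?n = "card (\<Union>C)"
  have g: "graph C" using C(1) by (simp add: core_def)
  have "card C \<le> ?n choose 2" by (rule graph_card_le[OF g])
  \<comment> \<open>At most four vertices carry fewer than 2v - 1 edges; four vertices carry at most
    6 instead of 7.\<close>
  have n5: "5 \<le> ?n"
  proof (rule ccontr)
    assume "\<not> 5 \<le> ?n"
    then have "?n = 0 \<or> ?n = 1 \<or> ?n = 2 \<or> ?n = 3 \<or> ?n = 4" by linarith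
    then show False using \<open>card C \<le> ?n choose 2\<close> C(2)
      by (elim disjE) (simp_all add: choose_two)
  qed
  define v where "v = ?n - 1"
  have v: "?n = Suc v" "3 \<le> v" "v < ?n" "v < 7" "v = 4 \<or> v = 5 \<or> v = 6"
    using n5 C(3) by (auto simp: v_def)
  from core_level[OF C v(2,3)] obtain k g f where k: "k \<le> 1" "g \<in> set (level v k)" "realizes C v g f"
    "card (spanned C (f ` set (vertices v))) + 3 = 2 * v + k" by blast
  have "spanned C (f ` set (vertices v)) \<noteq> {}" using k(4) v(2) by auto
  from realizes_extend[OF C(1) k(3) v(4,3) this]
  obtain h r f' where h: "h \<in> set (extensions r v g)" "realizes C (Suc v) h f'" "2 \<le> r"
    "card (spanned C (f' ` set (vertices (Suc v)))) = card (spanned C (f ` set (vertices v))) + r"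
    by blast
  have "f' ` set (vertices (Suc v)) = \<Union>C"
    using realizes_surj[OF h(2) \<open>graph C\<close> v(1)] v(4) by simp
  then have "spanned C (f' ` set (vertices (Suc v))) = C" by (auto simp: spanned_def)
  then have kr: "k + r = 4" using h(4) k(4) C(2) v(1,2) by simp
  have "core_like (Suc v) h" using core_like_realized[OF h(2) C(1) v(1)] v(4) by simp
  from final_step[OF v(5) k(1) kr k(2) h(1) this] obtain i p where
    i: "i < length (candidates (Suc v))" "isomorphism (Suc v) p (candidates (Suc v) ! i) h" by blast
  obtain f'' where f'': "realizes C (Suc v) (candidates (Suc v) ! i) f''"
    using realizes_isomorphism[OF h(2) i(2)] v(4) by auto
  have "Suc v = 5 \<or> Suc v = 6 \<or> Suc v = 7" using v(5) by auto
  from candidate_cert[OF this i(1)] obtain c where "check c (cycles (candidates (Suc v) ! i))" ..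
  then show ?thesis using breaker_wins_realized[OF f'' \<open>graph C\<close> v(1)] v(4) by simp
qed

text \<open>The bound 24 is the least m with 15m \<le> 8(2m - 3). The density condition excludes 2v
  edges and admits 2v - 1 edges only for v < 8.\<close>

theorem breaker_wins_sparse_cyclic:
  assumes "graph E" "sparse 8 15 24 E"
  shows "breaker_wins cyclic_goal {} E"
proof (rule breaker_wins_if_cores[OF local_goal_cyclic_goal assms(1)])
  fix C assume C: "C \<subseteq> E" "core C"
  have "8 * card C < 15 * card (\<Union>C)"
    using sparse_core_card(2)[OF C(2) sparse_subset[OF assms(2) C(1)]] by simp
  then consider "card C + 2 \<le> 2 * card (\<Union>C)" | "card C + 1 = 2 * card (\<Union>C)" "card (\<Union>C) \<le> 7"
    by linarith
  then show "breaker_wins cyclic_goal {} C"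
  proof cases
    case 1
    then show ?thesis
      using breaker_wins_weaken[OF breaker_wins_sparse_core[OF C(2)]]
        local_goal_triangle[OF local_goal_cyclic_goal] by blast
  next
    case 2
    then show ?thesis by (rule breaker_wins_dense_core[OF C(2)])
  qed
qed

subsection \<open>Maker's strategies\<close>

text \<open>As in Breaker's certificates, a position lists the triples that Maker can still
  complete, reduced to their missing arcs. \<open>Close\<close> takes a last missing arc,
  \<open>Move\<close> plays an arc and groups Breaker's answers by continuation, and
  \<open>Within\<close> forgets the triples that leave the given edges.\<close>

datatype plan =
    Close "nat \<times> nat"
  | Move "nat \<times> nat" "((nat \<times> nat) list \<times> plan) list"
  | Within "(nat \<times> nat) list" plan

definition in_edges :: "(nat \<times> nat) list \<Rightarrow> nat \<times> nat \<Rightarrow> bool" where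
  "in_edges c e \<longleftrightarrow> List.member c e \<or> List.member c (snd e, fst e)"

definition claim :: "nat \<times> nat \<Rightarrow> (nat \<times> nat) list list \<Rightarrow> (nat \<times> nat) list list" where
  "claim a S = map (filter (\<lambda>b. b \<noteq> a)) (filter (\<lambda>c. \<not> List.member c (snd a, fst a)) S)"

definition without :: "nat \<times> nat \<Rightarrow> (nat \<times> nat) list list \<Rightarrow> (nat \<times> nat) list list" where
  "without e S = filter (\<lambda>c. \<not> in_edges c e) S"

text \<open>Only answers that hit a remaining triple have to be listed. A harmless answer is treated
  like some listed one, which spoils at least as much; hence some entry must have a nonempty edge
  list.\<close>

fun check_plan :: "plan \<Rightarrow> (nat \<times> nat) list list \<Rightarrow> bool" where
  "check_plan (Close a) S \<longleftrightarrow> list_ex (\<lambda>c. c \<noteq> [] \<and> list_all (\<lambda>b. b = a) c) S"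
| "check_plan (Move a rs) S \<longleftrightarrow> list_ex (\<lambda>c. List.member c a) S \<and>
     (let S1 = claim a S in
       list_all (list_all (\<lambda>b. list_ex (\<lambda>(es, p). in_edges es b) rs)) S1 \<and>
       list_ex (\<lambda>(es, p). es \<noteq> []) rs \<and>
       list_all (\<lambda>(es, p). list_all (\<lambda>e. check_plan p (without e S1)) es) rs)"
| "check_plan (Within es p) S \<longleftrightarrow> check_plan p (filter (list_all (in_edges es)) S)"

lemma in_edges_iff: "in_edges c e \<longleftrightarrow> e \<in> set c \<or> prod.swap e \<in> set c"
  by (simp add: in_edges_def prod.swap_def)

lemma set_claim:
  "set (claim a S) = (\<lambda>c. filter (\<lambda>b. b \<noteq> a) c) ` {c \<in> set S. prod.swap a \<notin> set c}"
  by (auto simp: claim_def prod.swap_def)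

lemma set_without: "set (without e S) = {c \<in> set S. \<not> in_edges c e}"
  by (simp add: without_def)

text \<open>Maker's counterpart of \<open>breaker_wins_shift\<close>: arcs already owned may be left
  out of the digraph if the goal accounts for them.\<close>

lemma maker_wins_shift:
  "maker_wins W' D' F \<Longrightarrow> (\<And>Y. W' Y \<Longrightarrow> W (Y \<union> D)) \<Longrightarrow> maker_wins W (D' \<union> D) F"
proof (induction rule: maker_wins.induct)
  case (maker_wins_done D' F)
  then show ?case by (intro maker_wins.maker_wins_done)
next
  case (maker_wins_move a F D')
  have "maker_wins W (insert a (D' \<union> D)) (F - {undir a} - {e})" for e
    using maker_wins_move.IH[OF maker_wins_move.prems] by simp
  with maker_wins_move.hyps(1) show ?case by (rule maker_wins.maker_wins_move)
qed

locale nat_embedding = embedding f A for f :: "nat \<Rightarrow> nat" and A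
begin

lemma check_plan_sound:
  assumes "check_plan p S" "wf_arcs S" "\<And>c a. c \<in> set S \<Longrightarrow> a \<in> set c \<Longrightarrow> undir (img a) \<in> F"
  shows "maker_wins (goal S) {} F"
  using assms
proof (induction p arbitrary: S F)
  case (Close a)
  then obtain c where c: "c \<in> set S" "c \<noteq> []" "\<forall>b\<in>set c. b = a"
    by (auto simp: list_ex_iff list_all_iff)
  have a: "a \<in> set c" using c(2,3) by (metis list.set_intros(1) neq_Nil_conv)
  show ?case
  proof (rule maker_wins_move)
    show "undir (img a) \<in> F" using Close.prems(3)[OF c(1) a] .
    fix e
    have "goal S {img a}" unfolding goal_def by (rule bexI[OF _ c(1)]) (use c(3) in auto)
    then show "maker_wins (goal S) {img a} (F - {undir (img a)} - {e})"
      by (rule maker_wins_done)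
  qed
next
  case (Move a rs)
  let ?S1 = "claim a S"
  obtain c0 where c0: "c0 \<in> set S" "a \<in> set c0"
    using Move.prems(1) by (auto simp: list_ex_iff)
  have cov: "\<exists>(es, p)\<in>set rs. in_edges es b" if "c \<in> set ?S1" "b \<in> set c" for c b
    using Move.prems(1) that by (simp add: Let_def list_all_iff list_ex_iff)
  obtain es0 p0 where r0: "(es0, p0) \<in> set rs" "es0 \<noteq> []"
    using Move.prems(1) by (auto simp: Let_def list_ex_iff)
  have chk: "check_plan p (without e ?S1)" if "(es, p) \<in> set rs" "e \<in> set es" for es p e
    using Move.prems(1) that by (auto simp: Let_def list_all_iff)
  have aA: "a \<in> A \<times> A" using Move.prems(2) c0 unfolding wf_arcs_def by blast
  have S1: "b \<in> A \<times> A \<and> fst b \<noteq> snd b \<and> undir (img b) \<in> F \<and> undir (img b) \<noteq> undir (img a)"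
    if "c \<in> set ?S1" "b \<in> set c" for c b
  proof -
    from that obtain c' where c': "c' \<in> set S" "prod.swap a \<notin> set c'" "b \<in> set c'" "b \<noteq> a"
      by (auto simp: set_claim)
    then have bA: "b \<in> A \<times> A" "fst b \<noteq> snd b" using Move.prems(2) unfolding wf_arcs_def by blast+
    moreover have "undir (img b) \<noteq> undir (img a)" using undir_img_eq[OF bA(1) aA] c' by auto
    ultimately show ?thesis using Move.prems(3)[OF c'(1,3)] by simp
  qed
  \<comment> \<open>\<open>b\<close> is the answer assumed by the plan and \<open>e\<close> the
    actual one; it is enough that \<open>e\<close> meets no triple that survives
    \<open>b\<close>.\<close>
  have step: "maker_wins (goal S) {img a} (F - {undir (img a)} - {e})"
    if r: "(es, p) \<in> set rs" "b \<in> set es"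
      and e: "\<And>c x. c \<in> set (without b ?S1) \<Longrightarrow> x \<in> set c \<Longrightarrow> undir (img x) \<noteq> e" for es p b e
  proof -
    have "maker_wins (goal (without b ?S1)) {} (F - {undir (img a)} - {e})"
    proof (rule Move.IH[OF r(1), of p])
      show "check_plan p (without b ?S1)" by (rule chk[OF r])
      show "wf_arcs (without b ?S1)" using S1 unfolding wf_arcs_def set_without by blast
      show "undir (img x) \<in> F - {undir (img a)} - {e}" if "c \<in> set (without b ?S1)" "x \<in> set c" for c x
        using S1[of c x] e[OF that] that by (simp add: set_without)
    qed auto
    then have "maker_wins (goal S) ({} \<union> {img a}) (F - {undir (img a)} - {e})"
    proof (rule maker_wins_shift)
      fix Y assume "goal (without b ?S1) Y"
      then obtain c where c: "c \<in> set ?S1" "img ` set c \<subseteq> Y" by (auto simp: goal_def set_without)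
      then obtain c' where c': "c' \<in> set S" "c = filter (\<lambda>b. b \<noteq> a) c'" by (auto simp: set_claim)
      have "img x \<in> Y \<union> {img a}" if "x \<in> set c'" for x
        using that c(2) c'(2) by (cases "x = a") auto
      then have "img ` set c' \<subseteq> Y \<union> {img a}" by (rule image_subsetI)
      then show "goal S (Y \<union> {img a})" using c'(1) unfolding goal_def by blast
    qed
    then show ?thesis by simp
  qed
  show ?case
  proof (rule maker_wins_move)
    show "undir (img a) \<in> F" using Move.prems(3)[OF c0] .
    fix e
    show "maker_wins (goal S) {img a} (F - {undir (img a)} - {e})"
    proof (cases "\<exists>c\<in>set ?S1. \<exists>b\<in>set c. undir (img b) = e")
      case True
      then obtain c b where b: "c \<in> set ?S1" "b \<in> set c" "undir (img b) = e" by blast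
      from cov[OF b(1,2)] obtain es p where r: "(es, p) \<in> set rs" "in_edges es b" by auto
      from r(2) obtain b' where b': "b' \<in> set es" "b' = b \<or> b' = prod.swap b"
        unfolding in_edges_iff by blast
      have bA: "b \<in> A \<times> A" using S1[OF b(1,2)] by simp
      show ?thesis
      proof (rule step[OF r(1) b'(1)])
        fix k x assume k: "k \<in> set (without b' ?S1)" "x \<in> set k"
        then have "x \<in> A \<times> A" using S1[of k x] by (simp add: set_without)
        moreover have "\<not> in_edges k b'" using k(1) by (simp add: set_without)
        then have "x \<noteq> b" "x \<noteq> prod.swap b" using k(2) b'(2) by (auto simp: in_edges_iff)
        ultimately show "undir (img x) \<noteq> e" using undir_img_eq[OF _ bA, of x] b(3) by blast
      qed
    next
      case False
      from r0(2) obtain b where "b \<in> set es0" by (cases es0) auto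
      then show ?thesis using False by (intro step[OF r0(1)]) (auto simp: set_without)
    qed
  qed
next
  case (Within es p)
  let ?S = "filter (list_all (in_edges es)) S"
  have "maker_wins (goal ?S) {} F"
    using Within.prems by (intro Within.IH) (auto simp: wf_arcs_def)
  then have "maker_wins (goal S) ({} \<union> {}) F" by (rule maker_wins_shift) (auto simp: goal_def)
  then show ?case by simp
qed

end

text \<open>If Maker directs every edge towards the larger label, all her triangles are transitive,
  so one orientation per triangle suffices for \<open>T_A\<close>.\<close>

definition transitive_triples :: "(nat \<times> nat) list \<Rightarrow> (nat \<times> nat) list list" where
  "transitive_triples g = concat (map (\<lambda>(a, b). concat (map (\<lambda>(c, d).
      if c = b \<and> List.member g (a, d) then [[(a, b), (b, d), (a, d)]] else []) g)) g)"

definition cyclic_triples :: "(nat \<times> nat) list \<Rightarrow> (nat \<times> nat) list list" where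
  "cyclic_triples g = concat (map (\<lambda>(a, b). concat (map (\<lambda>(c, d).
      if c = b \<and> List.member g (a, d)
      then [[(a, b), (b, d), (d, a)], [(b, a), (d, b), (a, d)]] else []) g)) g)"

definition K5_minus_edge :: "(nat \<times> nat) list" where
  "K5_minus_edge =
    [(0, 1), (0, 2), (1, 2), (0, 3), (0, 4), (1, 3), (1, 4), (2, 3), (2, 4)]"

text \<open>The hub is \<open>0\<close>, the rims are \<open>1 2 3 4\<close> and
  \<open>1 5 6 7\<close>, and \<open>(0, 1)\<close> is the common spoke.\<close>

definition double_wheel :: "(nat \<times> nat) list" where
  "double_wheel =
    [(0, 1), (0, 2), (0, 3), (0, 4), (0, 5), (0, 6), (0, 7), (1, 2), (1, 4), (1, 5), (1, 7),
    (2, 3), (3, 4), (5, 6), (6, 7)]"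

text \<open>If Breaker leaves the triangle \<open>0 1 2\<close> intact, Maker's second edge
  threatens to close it, and the forced answer lets her make two threats at once. If he attacks it,
  she takes its remaining edge and still reaches a double threat.\<close>

lemma transitive_plan: "check_plan (
    Move (0, 1) [([(0, 2)], Move (1, 2) [([(0, 3)], Move (1, 4) [([(0, 4), (1, 3), (2, 3)],
    Close (2, 4)), ([(2, 4)], Close (0, 4))]), ([(0, 4)], Move (1, 3) [([(0, 3)], Close (2,
    3)), ([(1, 4), (2, 3), (2, 4)], Close (0, 3))]), ([(1, 3)], Move (1, 4) [([(0, 4)], Close
    (2, 4)), ([(2, 4)], Close (0, 4))]), ([(1, 4)], Move (1, 3) [([(0, 3)], Close (2, 3)),
    ([(2, 3)], Close (0, 3))]), ([(2, 3)], Move (1, 4) [([(0, 3), (0, 4), (1, 3)], Close (2,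
    4)), ([(2, 4)], Close (0, 4))]), ([(2, 4)], Move (1, 3) [([(0, 3)], Close (2, 3)), ([(0,
    4), (1, 4), (2, 3)], Close (0, 3))])]), ([(0, 3)], Move (0, 2) [([(0, 4), (1, 3), (1, 4),
    (2, 3), (2, 4)], Close (1, 2)), ([(1, 2)], Move (0, 4) [([(1, 4)], Close (2, 4)), ([(2,
    4)], Close (1, 4))])]), ([(0, 4)], Move (0, 2) [([(0, 3), (1, 3), (1, 4), (2, 3), (2, 4)],
    Close (1, 2)), ([(1, 2)], Move (0, 3) [([(1, 3)], Close (2, 3)), ([(2, 3)], Close (1,
    3))])]), ([(1, 2)], Move (0, 2) [([(0, 3)], Move (0, 4) [([(1, 4)], Close (2, 4)), ([(2,
    4)], Close (1, 4))]), ([(0, 4)], Move (0, 3) [([(1, 3)], Close (2, 3)), ([(2, 3)], Close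
    (1, 3))]), ([(1, 3)], Move (0, 4) [([(0, 3), (1, 4), (2, 3)], Close (2, 4)), ([(2, 4)],
    Close (1, 4))]), ([(1, 4)], Move (0, 3) [([(0, 4), (2, 3), (2, 4)], Close (1, 3)), ([(1,
    3)], Close (2, 3))]), ([(2, 3)], Move (0, 4) [([(0, 3), (1, 3), (1, 4)], Close (2, 4)),
    ([(2, 4)], Close (1, 4))]), ([(2, 4)], Move (0, 3) [([(0, 4), (1, 4), (2, 3)], Close (1,
    3)), ([(1, 3)], Close (2, 3))])]), ([(1, 3)], Move (0, 2) [([(0, 3), (0, 4), (1, 4), (2,
    3), (2, 4)], Close (1, 2)), ([(1, 2)], Move (0, 4) [([(0, 3), (1, 4), (2, 3)], Close (2,
    4)), ([(2, 4)], Close (1, 4))])]), ([(1, 4)], Move (0, 2) [([(0, 3), (0, 4), (1, 3), (2,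
    3), (2, 4)], Close (1, 2)), ([(1, 2)], Move (0, 3) [([(0, 4), (2, 3), (2, 4)], Close (1,
    3)), ([(1, 3)], Close (2, 3))])]), ([(2, 3)], Move (0, 2) [([(0, 3), (0, 4), (1, 3), (1,
    4), (2, 4)], Close (1, 2)), ([(1, 2)], Move (0, 4) [([(0, 3), (1, 3), (1, 4)], Close (2,
    4)), ([(2, 4)], Close (1, 4))])]), ([(2, 4)], Move (0, 2) [([(0, 3), (0, 4), (1, 3), (1,
    4), (2, 3)], Close (1, 2)), ([(1, 2)], Move (0, 3) [([(0, 4), (1, 4), (2, 3)], Close (1,
    3)), ([(1, 3)], Close (2, 3))])])])
    (transitive_triples K5_minus_edge)"
  by code_simp

text \<open>In the wheel that Breaker leaves alone, say with rim \<open>1 5 6 7\<close>, Maker also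
  directs the opposite spoke outwards, as \<open>(0, 6)\<close>. An inward spoke
  \<open>(7, 0)\<close> then threatens to close cycles by \<open>(1, 7)\<close> and by
  \<open>(6, 7)\<close>, and \<open>(5, 0)\<close> by \<open>(1, 5)\<close> and by
  \<open>(6, 5)\<close>. One answer cannot spoil both plans.\<close>

lemma cyclic_plan: "check_plan (
    Move (0, 1) [([(0, 2), (0, 3), (0, 4), (1, 2), (1, 4), (2, 3), (3, 4)], Within [(0, 1),
    (0, 5), (0, 6), (0, 7), (1, 5), (5, 6), (6, 7), (1, 7)] (Move (0, 6) [([(0, 5)], Move (7,
    0) [([(1, 7)], Close (6, 7)), ([(6, 7)], Close (1, 7))]), ([(0, 7)], Move (5, 0) [([(1,
    5)], Close (6, 5)), ([(5, 6)], Close (1, 5))]), ([(1, 5)], Move (7, 0) [([(0, 5), (5, 6),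
    (6, 7)], Close (1, 7)), ([(1, 7)], Close (6, 7))]), ([(1, 7)], Move (5, 0) [([(0, 7), (5,
    6), (6, 7)], Close (1, 5)), ([(1, 5)], Close (6, 5))]), ([(5, 6)], Move (7, 0) [([(0, 5),
    (1, 5), (6, 7)], Close (1, 7)), ([(1, 7)], Close (6, 7))]), ([(6, 7)], Move (5, 0) [([(0,
    7), (1, 7), (5, 6)], Close (1, 5)), ([(1, 5)], Close (6, 5))])])), ([(0, 5), (0, 6), (0,
    7), (1, 5), (1, 7), (5, 6), (6, 7)], Within [(0, 1), (0, 2), (0, 3), (0, 4), (1, 2), (2,
    3), (3, 4), (1, 4)] (Move (0, 3) [([(0, 2)], Move (4, 0) [([(1, 4)], Close (3, 4)), ([(3,
    4)], Close (1, 4))]), ([(0, 4)], Move (2, 0) [([(1, 2)], Close (3, 2)), ([(2, 3)], Close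
    (1, 2))]), ([(1, 2)], Move (4, 0) [([(0, 2), (1, 4), (2, 3)], Close (3, 4)), ([(3, 4)],
    Close (1, 4))]), ([(1, 4)], Move (2, 0) [([(0, 4), (2, 3), (3, 4)], Close (1, 2)), ([(1,
    2)], Close (3, 2))]), ([(2, 3)], Move (4, 0) [([(0, 2), (1, 2), (1, 4)], Close (3, 4)),
    ([(3, 4)], Close (1, 4))]), ([(3, 4)], Move (2, 0) [([(0, 4), (1, 4), (2, 3)], Close (1,
    2)), ([(1, 2)], Close (3, 2))])]))])
    (cyclic_triples double_wheel)"
  by code_simp

section \<open>From copies of the fixed graphs to the two tournament games\<close>

definition embeds :: "(nat \<times> nat) list \<Rightarrow> nat \<Rightarrow> (nat \<Rightarrow> nat) \<Rightarrow> nat set set \<Rightarrow> bool" where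
  "embeds g k f E \<longleftrightarrow> inj_on f {..<k} \<and> (\<forall>(i, j)\<in>set g. {f i, f j} \<in> E)"

definition transitive_goal :: "nat rel \<Rightarrow> bool" where
  "transitive_goal D \<longleftrightarrow> (\<exists>a b c. a \<noteq> b \<and> b \<noteq> c \<and> a \<noteq> c \<and> (a, b) \<in> D \<and> (b, c) \<in> D \<and> (a, c) \<in> D)"

lemma Field_T_A: "Field T_A = {0, 1, 2}" and Field_T_C: "Field T_C = {0, 1, 2}"
  unfolding T_A_def T_C_def Field_def by (simp_all add: insert_commute)

lemma contains_copy_T_A: "contains_copy T_A D \<longleftrightarrow> transitive_goal D"
proof
  assume "contains_copy T_A D"
  then obtain f where f: "inj_on f {0, 1, 2 :: nat}" "\<forall>(u, v)\<in>T_A. (f u, f v) \<in> D"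
    unfolding contains_copy_def Field_T_A by blast
  have "f 0 \<noteq> f 1" "f 1 \<noteq> f 2" "f 0 \<noteq> f 2" using f(1) by (simp_all add: inj_on_def)
  moreover have "(f 0, f 1) \<in> D" "(f 1, f 2) \<in> D" "(f 0, f 2) \<in> D" using f(2) by (simp_all add: T_A_def)
  ultimately show "transitive_goal D" unfolding transitive_goal_def by blast
next
  assume "transitive_goal D"
  then obtain a b c where "a \<noteq> b" "b \<noteq> c" "a \<noteq> c" "(a, b) \<in> D" "(b, c) \<in> D" "(a, c) \<in> D"
    by (auto simp: transitive_goal_def)
  then show "contains_copy T_A D" unfolding contains_copy_def Field_T_A
    by (intro exI[of _ "\<lambda>i. if i = 0 then a else if i = 1 then b else c"])
      (auto simp: inj_on_def T_A_def)
qed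

lemma contains_copy_T_C: "contains_copy T_C D \<longleftrightarrow> cyclic_goal D"
proof
  assume "contains_copy T_C D"
  then obtain f where f: "inj_on f {0, 1, 2 :: nat}" "\<forall>(u, v)\<in>T_C. (f u, f v) \<in> D"
    unfolding contains_copy_def Field_T_C by blast
  have "f 0 \<noteq> f 1" "f 1 \<noteq> f 2" "f 0 \<noteq> f 2" using f(1) by (simp_all add: inj_on_def)
  moreover have "(f 0, f 1) \<in> D" "(f 1, f 2) \<in> D" "(f 2, f 0) \<in> D" using f(2) by (simp_all add: T_C_def)
  ultimately show "cyclic_goal D" unfolding cyclic_goal_def by blast
next
  assume "cyclic_goal D"
  then obtain a b c where "a \<noteq> b" "b \<noteq> c" "a \<noteq> c" "(a, b) \<in> D" "(b, c) \<in> D" "(c, a) \<in> D"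
    by (auto simp: cyclic_goal_def)
  then show "contains_copy T_C D" unfolding contains_copy_def Field_T_C
    by (intro exI[of _ "\<lambda>i. if i = 0 then a else if i = 1 then b else c"])
      (auto simp: inj_on_def T_C_def)
qed

lemma maker_wins_weaken:
  "maker_wins W' D F \<Longrightarrow> (\<And>Y. W' Y \<Longrightarrow> W Y) \<Longrightarrow> maker_wins W D F"
  using maker_wins_shift[of W' D F W "{}"] by simp

lemma upward:
  assumes "(a, b) \<in> set g" "\<forall>(i, j)\<in>set g. i < j \<and> j < (k::nat)"
  shows "a < b" "a < k" "b < k"
  using assms by fastforce+

lemma transitive_triplesE:
  assumes "c \<in> set (transitive_triples g)"
  obtains a b d where "c = [(a, b), (b, d), (a, d)]" "(a, b) \<in> set g" "(b, d) \<in> set g" "(a, d) \<in> set g"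
  using assms that by (auto simp: transitive_triples_def split: if_splits)

lemma cyclic_triplesE:
  assumes "c \<in> set (cyclic_triples g)"
  obtains a b d where "c = [(a, b), (b, d), (d, a)] \<or> c = [(b, a), (d, b), (a, d)]"
    "(a, b) \<in> set g" "(b, d) \<in> set g" "(a, d) \<in> set g"
  using assms that by (auto simp: cyclic_triples_def split: if_splits)

lemma maker_wins_transitive:
  assumes e: "embeds g k f E" and g: "\<forall>(i, j)\<in>set g. i < j \<and> j < k"
    and p: "check_plan p (transitive_triples g)"
  shows "maker_wins transitive_goal {} E"
proof -
  interpret nat_embedding f "{..<k}" using e by unfold_locales (simp add: embeds_def)
  have E: "{f i, f j} \<in> E" if "(i, j) \<in> set g" for i j using e that by (auto simp: embeds_def)
  have "maker_wins (goal (transitive_triples g)) {} E"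
  proof (rule check_plan_sound[OF p])
    show "wf_arcs (transitive_triples g)" unfolding wf_arcs_def
    proof (intro ballI)
      fix c x assume "c \<in> set (transitive_triples g)" "x \<in> set c"
      then have "(fst x, snd x) \<in> set g" by (auto elim!: transitive_triplesE)
      from upward[OF this g] show "x \<in> {..<k} \<times> {..<k} \<and> fst x \<noteq> snd x" by (simp add: mem_Times_iff)
    qed
    fix c x assume "c \<in> set (transitive_triples g)" "x \<in> set c"
    then have "(fst x, snd x) \<in> set g" by (auto elim!: transitive_triplesE)
    from E[OF this] show "undir (img x) \<in> E" by (simp add: undir_def)
  qed
  then show ?thesis
  proof (rule maker_wins_weaken)
    fix Y assume "goal (transitive_triples g) Y"
    then obtain c where c: "c \<in> set (transitive_triples g)" "img ` set c \<subseteq> Y" by (auto simp: goal_def)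
    obtain a b d where abd: "c = [(a, b), (b, d), (a, d)]" "(a, b) \<in> set g" "(b, d) \<in> set g" "(a, d) \<in> set g"
      by (rule transitive_triplesE[OF c(1)])
    then have "f a \<noteq> f b" "f b \<noteq> f d" "f a \<noteq> f d"
      using upward[OF abd(2) g] upward[OF abd(3) g] upward[OF abd(4) g] inj_onD[OF inj] by fastforce+
    then show "transitive_goal Y" using c(2) unfolding transitive_goal_def abd(1) by auto
  qed
qed

lemma maker_wins_cyclic:
  assumes e: "embeds g k f E" and g: "\<forall>(i, j)\<in>set g. i < j \<and> j < k"
    and p: "check_plan p (cyclic_triples g)"
  shows "maker_wins cyclic_goal {} E"
proof -
  interpret nat_embedding f "{..<k}" using e by unfold_locales (simp add: embeds_def)
  have E: "{f i, f j} \<in> E" if "(i, j) \<in> set g" for i j using e that by (auto simp: embeds_def)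
  have sub: "x \<in> set g \<or> prod.swap x \<in> set g" if "c \<in> set (cyclic_triples g)" "x \<in> set c" for c x
    using that by (auto elim!: cyclic_triplesE)
  have "maker_wins (goal (cyclic_triples g)) {} E"
  proof (rule check_plan_sound[OF p])
    show "wf_arcs (cyclic_triples g)" unfolding wf_arcs_def
    proof (intro ballI)
      fix c x assume "c \<in> set (cyclic_triples g)" "x \<in> set c"
      from sub[OF this] have "(fst x, snd x) \<in> set g \<or> (snd x, fst x) \<in> set g" by (simp add: prod.swap_def)
      then show "x \<in> {..<k} \<times> {..<k} \<and> fst x \<noteq> snd x"
        using upward[of "fst x" "snd x", OF _ g] upward[of "snd x" "fst x", OF _ g]
        by (auto simp: mem_Times_iff)
    qed
    fix c x assume "c \<in> set (cyclic_triples g)" "x \<in> set c"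
    from sub[OF this] have "(fst x, snd x) \<in> set g \<or> (snd x, fst x) \<in> set g" by (simp add: prod.swap_def)
    then show "undir (img x) \<in> E"
      using E[of "fst x" "snd x"] E[of "snd x" "fst x"] by (auto simp: undir_def insert_commute)
  qed
  then show ?thesis
  proof (rule maker_wins_weaken)
    fix Y assume "goal (cyclic_triples g) Y"
    then obtain c where c: "c \<in> set (cyclic_triples g)" "img ` set c \<subseteq> Y" by (auto simp: goal_def)
    obtain a b d where abd: "c = [(a, b), (b, d), (d, a)] \<or> c = [(b, a), (d, b), (a, d)]"
      "(a, b) \<in> set g" "(b, d) \<in> set g" "(a, d) \<in> set g"
      by (rule cyclic_triplesE[OF c(1)])
    then have ne: "f a \<noteq> f b" "f b \<noteq> f d" "f a \<noteq> f d"
      using upward[OF abd(2) g] upward[OF abd(3) g] upward[OF abd(4) g] inj_onD[OF inj] by fastforce+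
    from abd(1) show "cyclic_goal Y"
    proof
      assume "c = [(a, b), (b, d), (d, a)]"
      then have "(f a, f b) \<in> Y" "(f b, f d) \<in> Y" "(f d, f a) \<in> Y" using c(2) by auto
      then show ?thesis using ne unfolding cyclic_goal_def by blast
    next
      assume "c = [(b, a), (d, b), (a, d)]"
      then have "(f b, f a) \<in> Y" "(f d, f b) \<in> Y" "(f a, f d) \<in> Y" using c(2) by auto
      then show ?thesis using ne unfolding cyclic_goal_def by metis
    qed
  qed
qed

theorem maker_strategy_T_A:
  assumes "graph E" "embeds K5_minus_edge 5 f E"
  shows "has_winning_strategy Maker T_A E"
proof (rule maker_wins_strategy)
  have "\<forall>(i, j)\<in>set K5_minus_edge. i < j \<and> j < 5" by (simp add: K5_minus_edge_def)
  from maker_wins_transitive[OF assms(2) this transitive_plan]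
  show "maker_wins (contains_copy T_A) {} E" by (rule maker_wins_weaken) (simp add: contains_copy_T_A)
qed (use assms(1) in \<open>simp add: graph_def\<close>)

theorem maker_strategy_T_C:
  assumes "graph E" "embeds double_wheel 8 f E"
  shows "has_winning_strategy Maker T_C E"
proof (rule maker_wins_strategy)
  have "\<forall>(i, j)\<in>set double_wheel. i < j \<and> j < 8" by (simp add: double_wheel_def)
  from maker_wins_cyclic[OF assms(2) this cyclic_plan]
  show "maker_wins (contains_copy T_C) {} E" by (rule maker_wins_weaken) (simp add: contains_copy_T_C)
qed (use assms(1) in \<open>simp add: graph_def\<close>)

theorem breaker_strategy_T_A:
  assumes "graph E" "sparse 5 9 15 E"
  shows "has_winning_strategy Breaker T_A E"
proof (rule breaker_wins_strategy)
  have "triangle_goal D" if T: "transitive_goal D" for D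
  proof -
    from T obtain a b c where abc: "a \<noteq> b" "b \<noteq> c" "a \<noteq> c" "(a, b) \<in> D" "(b, c) \<in> D" "(a, c) \<in> D"
      by (auto simp: transitive_goal_def)
    have "{{a, b}, {b, c}, {a, c}} \<subseteq> undir ` D" using abc(4-6) by force
    with triangleI[OF abc(1-3)] show ?thesis unfolding triangle_goal_def by blast
  qed
  then show "breaker_wins (contains_copy T_A) {} E"
    by (intro breaker_wins_weaken[OF breaker_wins_sparse_triangle[OF assms]]) (simp add: contains_copy_T_A)
qed

theorem breaker_strategy_T_C:
  assumes "graph E" "sparse 8 15 24 E"
  shows "has_winning_strategy Breaker T_C E"
proof (rule breaker_wins_strategy)
  show "breaker_wins (contains_copy T_C) {} E"
    by (rule breaker_wins_weaken[OF breaker_wins_sparse_cyclic[OF assms]]) (simp add: contains_copy_T_C)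
qed

subsection \<open>Random graphs\<close>

lemma finite_all_edges: "finite (all_edges n)"
  by (rule finite_subset[of _ "Pow {1..n}"]) (auto simp: all_edges_def)

lemma set_pmf_gnp: "E \<in> set_pmf (gnp n p) \<Longrightarrow> E \<subseteq> all_edges n"
  by (auto simp: gnp_def)

lemma finite_set_pmf_gnp: "finite (set_pmf (gnp n p))"
  by (rule finite_subset[of _ "Pow (all_edges n)"]) (auto simp: finite_all_edges dest: set_pmf_gnp)

lemma graph_all_edges: "E \<subseteq> all_edges n \<Longrightarrow> graph E"
  using finite_subset[OF _ finite_all_edges] by (auto simp: graph_def all_edges_def)

lemma prob_gnp_superset:
  assumes F: "F \<subseteq> all_edges n" and p: "0 \<le> p" "p \<le> 1"
  shows "measure_pmf.prob (gnp n p) {E. F \<subseteq> E} = p ^ card F"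
proof -
  let ?B = "\<lambda>e. if e \<in> F then {True} else UNIV"
  have "(\<lambda>present. {e \<in> all_edges n. present e}) -` {E. F \<subseteq> E} = Pi (all_edges n) ?B"
    using F by (auto simp: Pi_def split: if_splits)
  then have "measure_pmf.prob (gnp n p) {E. F \<subseteq> E} =
      (\<Prod>e\<in>all_edges n. measure_pmf.prob (bernoulli_pmf p) (?B e))"
    by (simp add: gnp_def measure_map_pmf measure_Pi_pmf_Pi finite_all_edges)
  also have "\<dots> = (\<Prod>e\<in>all_edges n. if e \<in> F then p else 1)"
    using p by (intro prod.cong) (auto simp: measure_pmf_single)
  also have "\<dots> = p ^ card F"
    using F by (simp add: prod.If_cases finite_all_edges Int_absorb1)
  finally show ?thesis .
qed

lemma aas_mono:
  assumes lim: "(\<lambda>n. measure_pmf.prob (gnp n (p n)) {E. P E}) \<longlonglongrightarrow> 1"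
    and imp: "\<And>E. graph E \<Longrightarrow> P E \<Longrightarrow> Q E"
  shows "aas p Q"
  unfolding aas_def
proof (rule tendsto_sandwich[OF always_eventually always_eventually lim tendsto_const])
  show "\<forall>n. measure_pmf.prob (gnp n (p n)) {E. P E} \<le> measure_pmf.prob (gnp n (p n)) {E. Q E}"
  proof
    fix n
    let ?M = "gnp n (p n)"
    have "measure_pmf.prob ?M {E. P E} = measure_pmf.prob ?M ({E. P E} \<inter> set_pmf ?M)"
      by (simp add: measure_Int_set_pmf)
    also have "\<dots> \<le> measure_pmf.prob ?M {E. Q E}"
    proof (rule measure_pmf.finite_measure_mono)
      show "{E. P E} \<inter> set_pmf ?M \<subseteq> {E. Q E}"
        using imp graph_all_edges[OF set_pmf_gnp] by auto
    qed simp
    finally show "measure_pmf.prob ?M {E. P E} \<le> measure_pmf.prob ?M {E. Q E}" .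
  qed
qed simp

lemma prob_tendsto_1:
  assumes "(\<lambda>n. measure_pmf.prob (M n) {x. \<not> P n x}) \<longlonglongrightarrow> 0"
  shows "(\<lambda>n. measure_pmf.prob (M n) {x. P n x}) \<longlonglongrightarrow> 1"
proof -
  have "measure_pmf.prob (M n) {x. P n x} = 1 - measure_pmf.prob (M n) {x. \<not> P n x}" for n
    using measure_pmf.prob_compl[of "{x. \<not> P n x}" "M n"]
    by (simp add: Collect_neg_eq[symmetric] Compl_eq_Diff_UNIV[symmetric])
  then show ?thesis using tendsto_diff[OF tendsto_const[of 1] assms] by simp
qed

section \<open>First moment: dense small subgraphs do not occur\<close>

lemma sum_inverse_power_subsets:
  assumes "0 < n"
  shows "(\<Sum>U | U \<subseteq> {1..n} \<and> card U \<le> m. 1 / real n ^ card U) \<le> real m + 1"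
proof -
  let ?S = "{U. U \<subseteq> {1..n} \<and> card U \<le> m}"
  have fin: "finite ?S" by simp
  have "(\<Sum>U\<in>?S. 1 / real n ^ card U) = (\<Sum>k\<le>m. \<Sum>U | U \<in> ?S \<and> card U = k. 1 / real n ^ card U)"
    by (rule sum.group[symmetric]) (use fin in auto)
  \<comment> \<open>Each size contributes at most 1, as there are at most \<open>n ^ k\<close> sets
    of size \<open>k\<close>.\<close>
  also have "\<dots> \<le> (\<Sum>k\<le>m. 1)"
  proof (rule sum_mono)
    fix k assume "k \<in> {..m}"
    then have "{U. U \<in> ?S \<and> card U = k} = {U. U \<subseteq> {1..n} \<and> card U = k}" by auto
    then have "(\<Sum>U | U \<in> ?S \<and> card U = k. 1 / real n ^ card U) = real (n choose k) / real n ^ k"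
      by (simp add: n_subsets)
    also have "n choose k \<le> n ^ k"
      by (cases "k \<le> n") (simp_all add: binomial_le_pow binomial_eq_0)
    then have "real (n choose k) / real n ^ k \<le> 1"
      using assms by (simp add: divide_le_eq flip: of_nat_power)
    finally show "(\<Sum>U | U \<in> ?S \<and> card U = k. 1 / real n ^ card U) \<le> 1" .
  qed
  also have "\<dots> = real m + 1" by simp
  finally show ?thesis .
qed

text \<open>First moment method with \<epsilon> = p n^(a/b). A bad edge set with v vertices and e
  edges satisfies bv \<le> ae, so it is present with probability p^e \<le> \<epsilon> n^(-v). At
  most \<open>2 ^ 2 ^ m\<close> bad edge sets share a given vertex set, and there are at most n^v
  vertex sets of size v.\<close>

lemma prob_not_sparse:
  assumes p: "0 \<le> p" "p \<le> 1" and b: "0 < b" and n: "0 < n"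
    and eps: "p * real n powr (real a / real b) \<le> 1"
  shows "measure_pmf.prob (gnp n p) {E. \<not> sparse a b m E}
    \<le> (2 ^ 2 ^ m * (real m + 1)) * (p * real n powr (real a / real b))"
proof -
  let ?M = "gnp n p" and ?\<epsilon> = "p * real n powr (real a / real b)"
  define Bad where "Bad = {F. F \<subseteq> all_edges n \<and> F \<noteq> {} \<and> card (\<Union>F) \<le> m \<and> b * card (\<Union>F) \<le> a * card F}"
  define \<U> where "\<U> = {U. U \<subseteq> {1..n} \<and> card U \<le> m}"
  have finB: "finite Bad"
    by (rule finite_subset[of _ "Pow (all_edges n)"]) (auto simp: Bad_def finite_all_edges)
  have finU: "finite \<U>" by (simp add: \<U>_def)
  have e0: "0 \<le> ?\<epsilon>" using p by simp
  have "measure_pmf.prob ?M {E. \<not> sparse a b m E}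
      = measure_pmf.prob ?M ({E. \<not> sparse a b m E} \<inter> set_pmf ?M)"
    by (simp add: measure_Int_set_pmf)
  also have "\<dots> \<le> measure_pmf.prob ?M (\<Union>F\<in>Bad. {E. F \<subseteq> E})"
  proof (rule measure_pmf.finite_measure_mono)
    show "{E. \<not> sparse a b m E} \<inter> set_pmf ?M \<subseteq> (\<Union>F\<in>Bad. {E. F \<subseteq> E})"
    proof
      fix E assume "E \<in> {E. \<not> sparse a b m E} \<inter> set_pmf ?M"
      then have "\<not> sparse a b m E" "E \<subseteq> all_edges n" by (auto dest: set_pmf_gnp)
      then obtain F where "F \<subseteq> E" "F \<noteq> {}" "card (\<Union>F) \<le> m" "\<not> a * card F < b * card (\<Union>F)"
        by (auto simp: sparse_def)
      moreover have "F \<subseteq> all_edges n" using \<open>F \<subseteq> E\<close> \<open>E \<subseteq> all_edges n\<close> by (rule order_trans)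
      ultimately have "F \<in> Bad" by (simp add: Bad_def)
      then show "E \<in> (\<Union>F\<in>Bad. {E. F \<subseteq> E})" using \<open>F \<subseteq> E\<close> by (intro UN_I) simp_all
    qed
  qed simp
  also have "\<dots> \<le> (\<Sum>F\<in>Bad. measure_pmf.prob ?M {E. F \<subseteq> E})"
    by (rule measure_pmf.finite_measure_subadditive_finite) (use finB in auto)
  also have "\<dots> \<le> (\<Sum>F\<in>Bad. ?\<epsilon> * (1 / real n ^ card (\<Union>F)))"
  proof (rule sum_mono)
    fix F assume F: "F \<in> Bad"
    then have sub: "F \<subseteq> all_edges n" and "F \<noteq> {}" and dense: "b * card (\<Union>F) \<le> a * card F"
      by (auto simp: Bad_def)
    have "finite F" using sub finite_all_edges finite_subset by blast
    then have c: "1 \<le> card F" using \<open>F \<noteq> {}\<close> by (simp add: Suc_leI card_gt_0_iff)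
    let ?v = "card (\<Union>F)" and ?e = "card F"
    have peq: "p = ?\<epsilon> * real n powr (- (real a / real b))"
      using n by (simp add: powr_minus field_simps)
    have "p ^ ?e = ?\<epsilon> ^ ?e * (real n powr (- (real a / real b))) ^ ?e"
      by (subst peq) (simp add: power_mult_distrib)
    also have "(real n powr (- (real a / real b))) ^ ?e = real n powr (- (real a / real b * real ?e))"
      using n by (simp add: powr_power mult.commute)
    also have "?\<epsilon> ^ ?e * \<dots> \<le> ?\<epsilon> * (1 / real n ^ ?v)"
    proof (rule mult_mono)
      show "?\<epsilon> ^ ?e \<le> ?\<epsilon>" using power_decreasing[OF c e0 eps] by simp
      have "real b * real ?v \<le> real a * real ?e" using dense by (metis of_nat_le_iff of_nat_mult)
      then have "real ?v \<le> real a / real b * real ?e" using b by (simp add: field_simps)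
      then have "real n powr (- (real a / real b * real ?e)) \<le> real n powr (- real ?v)"
        using n by (intro powr_mono) auto
      also have "\<dots> = 1 / real n ^ ?v" using n by (simp add: powr_minus powr_realpow field_simps)
      finally show "real n powr (- (real a / real b * real ?e)) \<le> 1 / real n ^ ?v" .
    qed (use e0 in auto)
    finally show "measure_pmf.prob ?M {E. F \<subseteq> E} \<le> ?\<epsilon> * (1 / real n ^ ?v)"
      using prob_gnp_superset[OF sub p] by simp
  qed
  also have "\<dots> = ?\<epsilon> * (\<Sum>F\<in>Bad. 1 / real n ^ card (\<Union>F))" by (simp add: sum_distrib_left)
  also have "\<dots> \<le> ?\<epsilon> * (2 ^ 2 ^ m * (real m + 1))"
  proof (rule mult_left_mono[OF _ e0])
    have "(\<Sum>F\<in>Bad. 1 / real n ^ card (\<Union>F))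
        = (\<Sum>U\<in>\<U>. \<Sum>F | F \<in> Bad \<and> \<Union>F = U. 1 / real n ^ card (\<Union>F))"
      by (rule sum.group[symmetric]) (use finB finU in \<open>auto simp: Bad_def \<U>_def all_edges_def\<close>)
    also have "\<dots> \<le> (\<Sum>U\<in>\<U>. 2 ^ 2 ^ m * (1 / real n ^ card U))"
    proof (rule sum_mono)
      fix U assume U: "U \<in> \<U>"
      have "(\<Sum>F | F \<in> Bad \<and> \<Union>F = U. 1 / real n ^ card (\<Union>F))
          = real (card {F \<in> Bad. \<Union>F = U}) * (1 / real n ^ card U)" by simp
      also have "\<dots> \<le> 2 ^ 2 ^ m * (1 / real n ^ card U)"
      proof (rule mult_right_mono)
        have fU: "finite U" using U finite_subset[of U "{1..n}"] by (auto simp: \<U>_def)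
        have "card {F \<in> Bad. \<Union>F = U} \<le> card (Pow (Pow U))"
          using fU by (intro card_mono) auto
        also have "\<dots> = 2 ^ 2 ^ card U" using fU by (simp add: card_Pow)
        also have "\<dots> \<le> 2 ^ 2 ^ m" using U by (simp add: \<U>_def)
        finally show "real (card {F \<in> Bad. \<Union>F = U}) \<le> 2 ^ 2 ^ m"
          by (metis (no_types, lifting) of_nat_le_iff of_nat_numeral of_nat_power)
      qed simp
      finally show "(\<Sum>F | F \<in> Bad \<and> \<Union>F = U. 1 / real n ^ card (\<Union>F)) \<le> 2 ^ 2 ^ m * (1 / real n ^ card U)" .
    qed
    also have "\<dots> = 2 ^ 2 ^ m * (\<Sum>U\<in>\<U>. 1 / real n ^ card U)" by (simp add: sum_distrib_left)
    also have "\<dots> \<le> 2 ^ 2 ^ m * (real m + 1)"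
      using sum_inverse_power_subsets[OF n, of m] by (intro mult_left_mono) (auto simp: \<U>_def)
    finally show "(\<Sum>F\<in>Bad. 1 / real n ^ card (\<Union>F)) \<le> 2 ^ 2 ^ m * (real m + 1)" .
  qed
  finally show ?thesis by (simp add: mult.commute)
qed

theorem sparse_aas:
  assumes p: "\<And>n. 0 \<le> p n \<and> p n \<le> 1" and b: "0 < b"
    and o: "p \<in> o(\<lambda>n. real n powr (- (real a / real b)))"
  shows "(\<lambda>n. measure_pmf.prob (gnp n (p n)) {E. sparse a b m E}) \<longlonglongrightarrow> 1"
proof (rule prob_tendsto_1, rule tendstoI)
  fix r :: real assume r: "0 < r"
  define K :: real where "K = 2 ^ 2 ^ m * (real m + 1)"
  have K: "0 < K" by (simp add: K_def)
  \<comment> \<open>The bound 1 meets the premise of \<open>prob_not_sparse\<close>, and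
    \<open>r / (2 * K)\<close> keeps \<open>K * c\<close> strictly below \<open>r\<close>.\<close>
  define c where "c = min 1 (r / (2 * K))"
  have c: "0 < c" "c \<le> 1" "K * c < r"
    using r K by (auto simp: c_def min_def field_simps)
  from landau_o.smallD[OF o c(1)]
  have "\<forall>\<^sub>F n in sequentially. p n \<le> c * real n powr (- (real a / real b))"
    by (rule eventually_mono) (use p in auto)
  then show "\<forall>\<^sub>F n in sequentially. dist (measure_pmf.prob (gnp n (p n)) {E. \<not> sparse a b m E}) 0 < r"
    using eventually_gt_at_top[of 0]
  proof eventually_elim
    case (elim n)
    have "p n * real n powr (real a / real b)
        \<le> c * real n powr (- (real a / real b)) * real n powr (real a / real b)"
      using elim(1) by (rule mult_right_mono) simp
    also have "\<dots> = c" using elim(2) by (simp add: powr_minus field_simps)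
    finally have le: "p n * real n powr (real a / real b) \<le> c" .
    have "measure_pmf.prob (gnp n (p n)) {E. \<not> sparse a b m E} \<le> K * (p n * real n powr (real a / real b))"
      unfolding K_def using p le c(2) elim(2) b by (intro prob_not_sparse) auto
    also have "\<dots> \<le> K * c" using le K by (intro mult_left_mono) auto
    finally show ?case using c(3) by simp
  qed
qed

section \<open>Second moment: copies of a fixed balanced graph\<close>

lemma second_moment:
  fixes M :: "'a pmf" and A :: "'b \<Rightarrow> 'a set"
  assumes fin: "finite (set_pmf M)" "finite \<Phi>" and q: "\<And>\<phi>. \<phi> \<in> \<Phi> \<Longrightarrow> measure_pmf.prob M (A \<phi>) = q"
  shows "(real (card \<Phi>) * q)\<^sup>2 * measure_pmf.prob M {x. \<forall>\<phi>\<in>\<Phi>. x \<notin> A \<phi>}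
    \<le> (\<Sum>\<phi>\<in>\<Phi>. \<Sum>\<psi>\<in>\<Phi>. measure_pmf.prob M (A \<phi> \<inter> A \<psi>)) - (real (card \<Phi>) * q)\<^sup>2"
proof -
  let ?\<mu> = "real (card \<Phi>) * q" and ?Z = "{x. \<forall>\<phi>\<in>\<Phi>. x \<notin> A \<phi>}"
  define X :: "'a \<Rightarrow> real" where "X x = (\<Sum>\<phi>\<in>\<Phi>. indicator (A \<phi>) x)" for x
  have int [simp]: "integrable (measure_pmf M) g" for g :: "'a \<Rightarrow> real"
    by (rule integrable_measure_pmf_finite[OF fin(1)])
  have EX: "measure_pmf.expectation M X = ?\<mu>"
    unfolding X_def using q by (simp add: Bochner_Integration.integral_sum)
  have XX: "X x * X x = (\<Sum>\<phi>\<in>\<Phi>. \<Sum>\<psi>\<in>\<Phi>. indicator (A \<phi> \<inter> A \<psi>) x)" for x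
    unfolding X_def by (simp add: sum_product indicator_inter_arith)
  have EXX: "measure_pmf.expectation M (\<lambda>x. X x * X x)
      = (\<Sum>\<phi>\<in>\<Phi>. \<Sum>\<psi>\<in>\<Phi>. measure_pmf.prob M (A \<phi> \<inter> A \<psi>))"
    unfolding XX by (simp add: Bochner_Integration.integral_sum)
  have "?\<mu>\<^sup>2 * measure_pmf.prob M ?Z = measure_pmf.expectation M (\<lambda>x. ?\<mu>\<^sup>2 * indicator ?Z x)"
    by simp
  \<comment> \<open>Chebyshev's argument: where none of the events occurs, the counting variable
    \<open>X\<close> is 0 and its squared deviation equals the squared mean.\<close>
  also have "\<dots> \<le> measure_pmf.expectation M (\<lambda>x. X x * X x - 2 * ?\<mu> * X x + ?\<mu>\<^sup>2)"
  proof (rule integral_mono)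
    fix x
    have "?\<mu>\<^sup>2 * indicator ?Z x \<le> (X x - ?\<mu>)\<^sup>2"
    proof (cases "x \<in> ?Z")
      case True
      then have "X x = 0" by (simp add: X_def)
      then show ?thesis using True by simp
    qed simp
    then show "?\<mu>\<^sup>2 * indicator ?Z x \<le> X x * X x - 2 * ?\<mu> * X x + ?\<mu>\<^sup>2"
      by (simp add: power2_eq_square algebra_simps)
  qed simp_all
  also have "\<dots> = measure_pmf.expectation M (\<lambda>x. X x * X x) - 2 * ?\<mu> * measure_pmf.expectation M X + ?\<mu>\<^sup>2"
    by simp
  finally show ?thesis unfolding EX EXX by (simp add: power2_eq_square mult_ac)
qed

text \<open>Writing the summand as a product over coordinates turns the sum into a product of
  \<open>k\<close> sums, each with one term \<open>m\<close> and m - 1 terms 1, hence at most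
  2m.\<close>

lemma sum_power_agreements:
  assumes "\<phi> \<in> PiE {..<k} (\<lambda>_. {..<m})"
  shows "(\<Sum>\<psi>\<in>PiE {..<k} (\<lambda>_. {..<m}). real m ^ card {i. i < k \<and> \<phi> i = \<psi> i}) \<le> (2 * real m) ^ k"
proof -
  have "real m ^ card {i. i < k \<and> \<phi> i = \<psi> i} = (\<Prod>i<k. if \<phi> i = \<psi> i then real m else 1)" for \<psi>
  proof -
    have "{..<k} \<inter> {i. \<phi> i = \<psi> i} = {i. i < k \<and> \<phi> i = \<psi> i}" by auto
    then show ?thesis by (simp add: prod.If_cases)
  qed
  then have "(\<Sum>\<psi>\<in>PiE {..<k} (\<lambda>_. {..<m}). real m ^ card {i. i < k \<and> \<phi> i = \<psi> i})
      = (\<Sum>\<psi>\<in>PiE {..<k} (\<lambda>_. {..<m}). \<Prod>i<k. if \<phi> i = \<psi> i then real m else 1)" by simp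
  also have "\<dots> = (\<Prod>i<k. \<Sum>y<m. if \<phi> i = y then real m else 1)"
    by (rule prod_sum_PiE[symmetric]) auto
  also have "\<dots> \<le> (\<Prod>i<k. 2 * real m)"
  proof (rule prod_mono)
    fix i assume "i \<in> {..<k}"
    then have "\<phi> i \<in> {..<m}" using assms by (auto simp: PiE_iff)
    have "(\<Sum>y<m. if \<phi> i = y then real m else 1) \<le> (\<Sum>y<m. (if \<phi> i = y then real m else 0) + 1)"
      by (rule sum_mono) auto
    also have "\<dots> = real m + real m" using \<open>\<phi> i \<in> {..<m}\<close> by (simp add: sum.distrib)
    finally show "0 \<le> (\<Sum>y<m. if \<phi> i = y then real m else 1) \<and>
        (\<Sum>y<m. if \<phi> i = y then real m else 1) \<le> 2 * real m" by (auto intro: sum_nonneg)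
  qed
  finally show ?thesis by simp
qed

text \<open>Splitting the vertices into \<open>k\<close> blocks of size \<open>m\<close> and placing vertex \<open>i\<close> of the graph into the
  \<open>i\<close>-th block makes two copies share exactly the edges on the vertices where they agree.\<close>

lemma prob_no_embedding:
  assumes g: "\<forall>(i, j)\<in>set g. i < j \<and> j < k" and dg: "distinct g"
    and balanced: "\<And>A. A \<subseteq> {..<k} \<Longrightarrow> a * card {(i, j). (i, j) \<in> set g \<and> i \<in> A \<and> j \<in> A} \<le> b * card A"
    and b: "0 < b" and p: "0 < p" "p \<le> 1" and m: "0 < m" "k * m \<le> n"
    and \<theta>: "1 \<le> p * real m powr (real a / real b)"
  shows "measure_pmf.prob (gnp n p) {E. \<not> (\<exists>f. embeds g k f E)}
    \<le> 2 ^ k / (p * real m powr (real a / real b))"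
proof -
  let ?M = "gnp n p" and ?\<theta> = "p * real m powr (real a / real b)"
  define \<Phi> where "\<Phi> = PiE {..<k} (\<lambda>_. {..<m})"
  \<comment> \<open>Block \<open>i\<close> consists of the labels from \<open>i * m + 1\<close> to
    \<open>(i + 1) * m\<close>; the shift by 1 is due to the vertex set starting at 1.\<close>
  define vert where "vert \<phi> i = i * m + \<phi> i + 1" for \<phi> :: "nat \<Rightarrow> nat" and i
  define edges where "edges \<phi> = (\<lambda>(i, j). {vert \<phi> i, vert \<phi> j}) ` set g" for \<phi>
  define h where "h = length g"
  have fin\<Phi>: "finite \<Phi>" by (auto simp: \<Phi>_def intro: finite_PiE)
  have card\<Phi>: "card \<Phi> = m ^ k" by (simp add: \<Phi>_def card_PiE)
  have lt: "\<phi> i < m" if "\<phi> \<in> \<Phi>" "i < k" for \<phi> i using that by (auto simp: \<Phi>_def PiE_iff)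
  have vert_less: "vert \<phi> i < vert \<psi> j" if "\<phi> \<in> \<Phi>" "i < j" "j < k" for \<phi> \<psi> i j
  proof -
    have "\<phi> i < m" using lt that by simp
    then have "i * m + \<phi> i < Suc i * m" by simp
    also have "\<dots> \<le> j * m" using that by (intro mult_le_mono1) simp
    finally show ?thesis by (simp add: vert_def)
  qed
  have vert_eq: "i = j \<and> \<phi> i = \<psi> j"
    if "\<phi> \<in> \<Phi>" "\<psi> \<in> \<Phi>" "i < k" "j < k" "vert \<phi> i = vert \<psi> j" for \<phi> \<psi> i j
  proof -
    have "i = j" using vert_less[of \<phi> i j \<psi>] vert_less[of \<psi> j i \<phi>] that by (metis less_irrefl nat_neq_iff)
    then show ?thesis using that(5) by (simp add: vert_def)
  qed
  have up: "i < j \<and> j < k" if "(i, j) \<in> set g" for i j using g that by auto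
  have edge_eq: "i = i' \<and> j = j' \<and> \<phi> i = \<psi> i \<and> \<phi> j = \<psi> j"
    if "\<phi> \<in> \<Phi>" "\<psi> \<in> \<Phi>" "(i, j) \<in> set g" "(i', j') \<in> set g"
      "{vert \<phi> i, vert \<phi> j} = {vert \<psi> i', vert \<psi> j'}" for \<phi> \<psi> i j i' j'
  proof -
    have l: "vert \<phi> i < vert \<phi> j" "vert \<psi> i' < vert \<psi> j'"
      using vert_less up that(1-4) by blast+
    then have "vert \<phi> i = vert \<psi> i' \<and> vert \<phi> j = vert \<psi> j'"
      using that(5) by (auto simp: doubleton_eq_iff)
    moreover have "i < k" "j < k" "i' < k" "j' < k" using up[OF that(3)] up[OF that(4)] by auto
    ultimately show ?thesis
      using vert_eq[OF that(1,2), of i i'] vert_eq[OF that(1,2), of j j'] by auto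
  qed
  have inj_edges: "inj_on (\<lambda>(i, j). {vert \<phi> i, vert \<phi> j}) (set g)" if "\<phi> \<in> \<Phi>" for \<phi>
  proof (rule inj_onI)
    fix x y assume "x \<in> set g" "y \<in> set g"
      "(\<lambda>(i, j). {vert \<phi> i, vert \<phi> j}) x = (\<lambda>(i, j). {vert \<phi> i, vert \<phi> j}) y"
    then show "x = y" using edge_eq[OF that that, of "fst x" "snd x" "fst y" "snd y"]
      by (simp add: split_def prod_eq_iff)
  qed
  have card_edges: "card (edges \<phi>) = h" if "\<phi> \<in> \<Phi>" for \<phi>
    unfolding edges_def using card_image[OF inj_edges[OF that]] distinct_card[OF dg] by (simp add: h_def)
  have fin_edges: "finite (edges \<phi>)" for \<phi> by (simp add: edges_def)
  have sub: "edges \<phi> \<subseteq> all_edges n" if "\<phi> \<in> \<Phi>" for \<phi>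
  proof
    fix e assume "e \<in> edges \<phi>"
    then obtain i j where ij: "(i, j) \<in> set g" "e = {vert \<phi> i, vert \<phi> j}" by (auto simp: edges_def)
    have "vert \<phi> i < vert \<phi> j" using vert_less[OF that] up[OF ij(1)] by blast
    moreover have "vert \<phi> j \<le> n"
    proof -
      have "j < k" using up[OF ij(1)] by simp
      then have "vert \<phi> j \<le> j * m + m" using lt[OF that] by (simp add: vert_def Suc_leI)
      also have "\<dots> = Suc j * m" by simp
      also have "\<dots> \<le> k * m" using \<open>j < k\<close> by (intro mult_le_mono1) simp
      finally show ?thesis using m(2) by simp
    qed
    moreover have "1 \<le> vert \<phi> i" by (simp add: vert_def)
    ultimately show "e \<in> all_edges n" by (auto simp: all_edges_def ij(2))
  qed
  define agree where "agree \<phi> \<psi> = {i. i < k \<and> \<phi> i = \<psi> i}" for \<phi> \<psi> :: "nat \<Rightarrow> nat"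
  define c where "c \<phi> \<psi> = card {(i, j). (i, j) \<in> set g \<and> i \<in> agree \<phi> \<psi> \<and> j \<in> agree \<phi> \<psi>}" for \<phi> \<psi>
  have inter: "card (edges \<phi> \<inter> edges \<psi>) \<le> c \<phi> \<psi>" if "\<phi> \<in> \<Phi>" "\<psi> \<in> \<Phi>" for \<phi> \<psi>
  proof -
    let ?C = "{(i, j). (i, j) \<in> set g \<and> i \<in> agree \<phi> \<psi> \<and> j \<in> agree \<phi> \<psi>}"
    have finC: "finite ?C" by (rule finite_subset[of _ "set g"]) auto
    have "edges \<phi> \<inter> edges \<psi> \<subseteq> (\<lambda>(i, j). {vert \<phi> i, vert \<phi> j}) ` ?C"
    proof
      fix e assume "e \<in> edges \<phi> \<inter> edges \<psi>"
      then obtain i j i' j' where ij: "(i, j) \<in> set g" "e = {vert \<phi> i, vert \<phi> j}"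
        "(i', j') \<in> set g" "e = {vert \<psi> i', vert \<psi> j'}" by (auto simp: edges_def)
      have "{vert \<phi> i, vert \<phi> j} = {vert \<psi> i', vert \<psi> j'}" using ij(2,4) by simp
      from edge_eq[OF that ij(1,3) this] have "\<phi> i = \<psi> i \<and> \<phi> j = \<psi> j" by blast
      then have "(i, j) \<in> ?C" using ij(1) up[OF ij(1)] by (simp add: agree_def)
      then show "e \<in> (\<lambda>(i, j). {vert \<phi> i, vert \<phi> j}) ` ?C" by (rule rev_image_eqI) (simp add: ij(2))
    qed
    then have "card (edges \<phi> \<inter> edges \<psi>) \<le> card ((\<lambda>(i, j). {vert \<phi> i, vert \<phi> j}) ` ?C)"
      using finC by (intro card_mono) auto
    also have "\<dots> \<le> card ?C" by (rule card_image_le[OF finC])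
    finally show ?thesis by (simp add: c_def)
  qed
  define A where "A \<phi> = {E. edges \<phi> \<subseteq> E}" for \<phi>
  have prob1: "measure_pmf.prob ?M (A \<phi>) = p ^ h" if "\<phi> \<in> \<Phi>" for \<phi>
    using prob_gnp_superset[OF sub[OF that], of p] p card_edges[OF that] by (simp add: A_def)
  have prob2: "measure_pmf.prob ?M (A \<phi> \<inter> A \<psi>) \<le> p ^ (2 * h) + p ^ (2 * h) * (real m ^ card (agree \<phi> \<psi>) / ?\<theta>)"
    if \<phi>\<psi>: "\<phi> \<in> \<Phi>" "\<psi> \<in> \<Phi>" for \<phi> \<psi>
  proof -
    let ?d = "card (edges \<phi> \<inter> edges \<psi>)"
    have "A \<phi> \<inter> A \<psi> = {E. edges \<phi> \<union> edges \<psi> \<subseteq> E}" by (auto simp: A_def)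
    then have P: "measure_pmf.prob ?M (A \<phi> \<inter> A \<psi>) = p ^ card (edges \<phi> \<union> edges \<psi>)"
      using prob_gnp_superset[of "edges \<phi> \<union> edges \<psi>" n p] sub \<phi>\<psi> p by simp
    have U: "card (edges \<phi> \<union> edges \<psi>) + ?d = 2 * h"
      using card_Un_Int[OF fin_edges fin_edges, of \<phi> \<psi>] card_edges \<phi>\<psi> by simp
    then have split: "p ^ card (edges \<phi> \<union> edges \<psi>) * p ^ ?d = p ^ (2 * h)"
      by (simp flip: power_add)
    show ?thesis
    proof (cases "?d = 0")
      case True
      then have "measure_pmf.prob ?M (A \<phi> \<inter> A \<psi>) = p ^ (2 * h)" using P U by simp
      moreover have "0 \<le> p ^ (2 * h) * (real m ^ card (agree \<phi> \<psi>) / ?\<theta>)" using p by simp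
      ultimately show ?thesis by simp
    next
      case False
      then have c1: "1 \<le> c \<phi> \<psi>" using inter[OF \<phi>\<psi>] by linarith
      have "agree \<phi> \<psi> \<subseteq> {..<k}" by (auto simp: agree_def)
      from balanced[OF this] have "a * c \<phi> \<psi> \<le> b * card (agree \<phi> \<psi>)" by (simp add: c_def)
      then have "real a * real (c \<phi> \<psi>) \<le> real b * real (card (agree \<phi> \<psi>))"
        by (metis of_nat_le_iff of_nat_mult)
      then have bal: "real a / real b * real (c \<phi> \<psi>) \<le> real (card (agree \<phi> \<psi>))"
        using b by (simp add: field_simps)
      \<comment> \<open>Sharing d \<ge> 1 edges raises the joint probability by the factor p^(-d).
        By balancedness the c \<ge> d edges on agreeing vertices need at least ca/b agreements, so
        this factor is at most m^s / \<theta> for s agreements.\<close>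
      have "?\<theta> \<le> ?\<theta> ^ c \<phi> \<psi>" using power_increasing[OF c1 \<theta>] by simp
      also have "\<dots> = p ^ c \<phi> \<psi> * real m powr (real a / real b * real (c \<phi> \<psi>))"
        using m by (simp add: power_mult_distrib powr_power mult.commute)
      also have "\<dots> \<le> p ^ c \<phi> \<psi> * real m powr real (card (agree \<phi> \<psi>))"
        using m p bal by (intro mult_left_mono powr_mono) auto
      also have "\<dots> = p ^ c \<phi> \<psi> * real m ^ card (agree \<phi> \<psi>)"
        using m by (simp add: powr_realpow)
      also have "\<dots> \<le> p ^ ?d * real m ^ card (agree \<phi> \<psi>)"
        using inter[OF \<phi>\<psi>] p by (intro mult_right_mono power_decreasing) auto
      finally have "1 \<le> p ^ ?d * (real m ^ card (agree \<phi> \<psi>) / ?\<theta>)"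
        using \<theta> by (simp add: le_divide_eq)
      then have "p ^ card (edges \<phi> \<union> edges \<psi>) * 1
          \<le> p ^ card (edges \<phi> \<union> edges \<psi>) * (p ^ ?d * (real m ^ card (agree \<phi> \<psi>) / ?\<theta>))"
        using p by (intro mult_left_mono) auto
      also have "\<dots> = p ^ (2 * h) * (real m ^ card (agree \<phi> \<psi>) / ?\<theta>)"
        by (simp only: split mult.assoc[symmetric])
      finally have "p ^ card (edges \<phi> \<union> edges \<psi>) \<le> p ^ (2 * h) * (real m ^ card (agree \<phi> \<psi>) / ?\<theta>)"
        by simp
      moreover have "0 \<le> p ^ (2 * h)" using p by simp
      ultimately show ?thesis using P by linarith
    qed
  qed
  let ?\<mu> = "real (card \<Phi>) * p ^ h"
  have \<mu>2: "?\<mu>\<^sup>2 = real m ^ (2 * k) * p ^ (2 * h)"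
    by (simp add: card\<Phi> power_mult_distrib power_even_eq mult.commute flip: power_mult)
  have \<mu>pos: "0 < ?\<mu>\<^sup>2" using m p by (simp add: \<mu>2)
  define K where "K = p ^ (2 * h) / ?\<theta>"
  have K: "0 \<le> K" using p by (simp add: K_def)
  \<comment> \<open>Summed over all pairs of placements, the correlated part is at most 2^k /
    \<theta> times the squared mean.\<close>
  let ?S = "\<Sum>\<phi>\<in>\<Phi>. \<Sum>\<psi>\<in>\<Phi>. real m ^ card (agree \<phi> \<psi>)"
  have mk: "real m ^ (2 * k) = real m ^ k * real m ^ k" by (simp flip: power_add mult_2)
  have "?S \<le> (\<Sum>\<phi>\<in>\<Phi>. (2 * real m) ^ k)"
    unfolding \<Phi>_def agree_def by (intro sum_mono sum_power_agreements)
  also have "\<dots> = 2 ^ k * real m ^ (2 * k)"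
    by (simp add: card\<Phi> power_mult_distrib mk)
  finally have S: "?S \<le> 2 ^ k * real m ^ (2 * k)" .
  have "(\<Sum>\<phi>\<in>\<Phi>. \<Sum>\<psi>\<in>\<Phi>. measure_pmf.prob ?M (A \<phi> \<inter> A \<psi>))
      \<le> (\<Sum>\<phi>\<in>\<Phi>. \<Sum>\<psi>\<in>\<Phi>. p ^ (2 * h) + K * real m ^ card (agree \<phi> \<psi>))"
    using prob2 by (intro sum_mono) (simp add: K_def)
  also have "\<dots> = real (card \<Phi>) * (real (card \<Phi>) * p ^ (2 * h)) + K * ?S"
    by (simp add: sum.distrib sum_distrib_left)
  also have "real (card \<Phi>) * (real (card \<Phi>) * p ^ (2 * h)) = ?\<mu>\<^sup>2"
    unfolding \<mu>2 by (simp add: card\<Phi> mk)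
  finally have T: "(\<Sum>\<phi>\<in>\<Phi>. \<Sum>\<psi>\<in>\<Phi>. measure_pmf.prob ?M (A \<phi> \<inter> A \<psi>)) \<le> ?\<mu>\<^sup>2 + K * ?S" .
  have "?\<mu>\<^sup>2 * measure_pmf.prob ?M {E. \<forall>\<phi>\<in>\<Phi>. E \<notin> A \<phi>}
      \<le> (\<Sum>\<phi>\<in>\<Phi>. \<Sum>\<psi>\<in>\<Phi>. measure_pmf.prob ?M (A \<phi> \<inter> A \<psi>)) - ?\<mu>\<^sup>2"
    by (rule second_moment[OF finite_set_pmf_gnp fin\<Phi> prob1])
  also have "\<dots> \<le> K * ?S" using T by linarith
  also have "\<dots> \<le> K * (2 ^ k * real m ^ (2 * k))" by (rule mult_left_mono[OF S K])
  also have "\<dots> = ?\<mu>\<^sup>2 * (2 ^ k / ?\<theta>)" unfolding \<mu>2 K_def by simp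
  finally have "?\<mu>\<^sup>2 * measure_pmf.prob ?M {E. \<forall>\<phi>\<in>\<Phi>. E \<notin> A \<phi>} \<le> ?\<mu>\<^sup>2 * (2 ^ k / ?\<theta>)" .
  then have bound: "measure_pmf.prob ?M {E. \<forall>\<phi>\<in>\<Phi>. E \<notin> A \<phi>} \<le> 2 ^ k / ?\<theta>"
    by (rule mult_le_cancel_left_pos[OF \<mu>pos, THEN iffD1])
  have "{E. \<not> (\<exists>f. embeds g k f E)} \<subseteq> {E. \<forall>\<phi>\<in>\<Phi>. E \<notin> A \<phi>}"
  proof safe
    fix E \<phi> assume no: "\<nexists>f. embeds g k f E" and \<phi>: "\<phi> \<in> \<Phi>" "E \<in> A \<phi>"
    have "inj_on (vert \<phi>) {..<k}" using vert_eq[OF \<phi>(1,1)] by (auto intro!: inj_onI)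
    moreover have "\<forall>(i, j)\<in>set g. {vert \<phi> i, vert \<phi> j} \<in> E" using \<phi>(2) by (auto simp: A_def edges_def)
    ultimately have "embeds g k (vert \<phi>) E" by (simp add: embeds_def)
    with no show False by blast
  qed
  then have "measure_pmf.prob ?M {E. \<not> (\<exists>f. embeds g k f E)} \<le> measure_pmf.prob ?M {E. \<forall>\<phi>\<in>\<Phi>. E \<notin> A \<phi>}"
    by (intro measure_pmf.finite_measure_mono) auto
  with bound show ?thesis by linarith
qed

theorem embeds_aas:
  assumes p: "\<And>n. 0 \<le> p n \<and> p n \<le> 1" and g: "\<forall>(i, j)\<in>set g. i < j \<and> j < k" and dg: "distinct g"
    and balanced: "\<And>A. A \<subseteq> {..<k} \<Longrightarrow> a * card {(i, j). (i, j) \<in> set g \<and> i \<in> A \<and> j \<in> A} \<le> b * card A"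
    and b: "0 < b" and k: "0 < k"
    and \<omega>: "p \<in> \<omega>(\<lambda>n. real n powr (- (real a / real b)))"
  shows "(\<lambda>n. measure_pmf.prob (gnp n (p n)) {E. \<exists>f. embeds g k f E}) \<longlonglongrightarrow> 1"
proof (rule prob_tendsto_1, rule tendstoI)
  fix r :: real assume r: "0 < r"
  \<comment> \<open>For n \<ge> k the block size \<open>n div k\<close> is at least n / (2k), and
    \<open>s\<close> absorbs the factor 2k under the exponent a/b.\<close>
  define s where "s = (2 * real k) powr (real a / real b)"
  have s: "0 < s" using k by (simp add: s_def)
  \<comment> \<open>The 1 meets the premise of \<open>prob_no_embedding\<close>, and the other bound
    makes the failure probability smaller than \<open>r\<close>.\<close>
  define L where "L = max 1 (2 * 2 ^ k / r)"
  have L: "1 \<le> L" "2 ^ k / L < r" using r by (auto simp: L_def max_def field_simps)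
  have "0 < L * s" using L s by (intro mult_pos_pos) auto
  from landau_omega.smallD[OF \<omega> this]
  have "\<forall>\<^sub>F n in sequentially. L * s * real n powr (- (real a / real b)) \<le> p n"
    by (rule eventually_mono) (use p in auto)
  then show "\<forall>\<^sub>F n in sequentially.
      dist (measure_pmf.prob (gnp n (p n)) {E. \<not> (\<exists>f. embeds g k f E)}) 0 < r"
    using eventually_ge_at_top[of k]
  proof eventually_elim
    case (elim n)
    define m where "m = n div k"
    have m: "0 < m" "k * m \<le> n" using elim(2) k by (auto simp: m_def div_greater_zero_iff)
    have n: "0 < n" using elim(2) k by simp
    have "n < k * m + k" unfolding m_def using k by (metis mult.commute dividend_less_div_times add.commute)
    also have "\<dots> \<le> 2 * k * m" using m(1) by simp
    finally have "real n \<le> 2 * real k * real m" by (metis less_imp_le of_nat_le_iff of_nat_mult of_nat_numeral)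
    then have "real n powr (real a / real b) \<le> (2 * real k * real m) powr (real a / real b)"
      by (intro powr_mono2) auto
    also have "\<dots> = s * real m powr (real a / real b)" by (simp add: s_def powr_mult)
    finally have nm: "real n powr (real a / real b) \<le> s * real m powr (real a / real b)" .
    have pos: "0 < p n"
    proof -
      have "0 < L * s * real n powr (- (real a / real b))" using \<open>0 < L * s\<close> n by simp
      then show ?thesis using elim(1) by linarith
    qed
    have "L * (real n powr (- (real a / real b)) * real n powr (real a / real b)) = L"
      using n by (simp add: powr_minus field_simps)
    then have "L \<le> L * real n powr (- (real a / real b)) * (s * real m powr (real a / real b))"
      using mult_left_mono[OF nm, of "L * real n powr (- (real a / real b))"] L(1)
      by (simp add: mult.assoc)
    also have "\<dots> = (L * s * real n powr (- (real a / real b))) * real m powr (real a / real b)" by simp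
    also have "\<dots> \<le> p n * real m powr (real a / real b)" using elim(1) by (rule mult_right_mono) simp
    finally have \<theta>: "L \<le> p n * real m powr (real a / real b)" .
    have "measure_pmf.prob (gnp n (p n)) {E. \<not> (\<exists>f. embeds g k f E)}
        \<le> 2 ^ k / (p n * real m powr (real a / real b))"
      using pos p[of n] \<theta> L(1) by (intro prob_no_embedding[OF g dg balanced b _ _ m]) auto
    also have "\<dots> \<le> 2 ^ k / L" using \<theta> L(1) pos m(1) by (intro divide_left_mono mult_pos_pos) auto
    finally show ?case using L(2) by simp
  qed
qed

text \<open>With \<open>b / a\<close> the density of \<open>g\<close>, this says that no subgraph of
  \<open>g\<close> is denser than \<open>g\<close> itself. Induced subgraphs are the densest on
  their vertex sets, so running through the \<open>2 ^ k\<close> vertex sets suffices.\<close>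

definition balanced_check :: "nat \<Rightarrow> nat \<Rightarrow> nat \<Rightarrow> (nat \<times> nat) list \<Rightarrow> bool" where
  "balanced_check a b k g \<longleftrightarrow> list_all (\<lambda>l.
     a * length (filter (\<lambda>(i, j). List.member l i \<and> List.member l j) g) \<le> b * length l) (List.subseqs [0..<k])"

lemma balanced_checkD:
  assumes "balanced_check a b k g" "distinct g" "A \<subseteq> {..<k}"
  shows "a * card {(i, j). (i, j) \<in> set g \<and> i \<in> A \<and> j \<in> A} \<le> b * card A"
proof -
  let ?l = "filter (\<lambda>i. i \<in> A) [0..<k]"
  have l: "set ?l = A" using assms(3) by auto
  have "?l \<in> set (List.subseqs [0..<k])" by simp
  then have "a * length (filter (\<lambda>(i, j). List.member ?l i \<and> List.member ?l j) g) \<le> b * length ?l"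
    using assms(1) unfolding balanced_check_def list_all_iff by blast
  moreover have "length ?l = card A" using distinct_card[of ?l] l by simp
  moreover have "length (filter (\<lambda>(i, j). List.member ?l i \<and> List.member ?l j) g)
      = card {(i, j). (i, j) \<in> set g \<and> i \<in> A \<and> j \<in> A}"
  proof -
    have "set (filter (\<lambda>(i, j). List.member ?l i \<and> List.member ?l j) g)
        = {(i, j). (i, j) \<in> set g \<and> i \<in> A \<and> j \<in> A}" using l by auto
    then show ?thesis using distinct_card[OF distinct_filter[OF assms(2)]] by metis
  qed
  ultimately show ?thesis by simp
qed

lemma balanced_K5_minus_edge: "balanced_check 5 9 5 K5_minus_edge"
  by code_simp

lemma balanced_double_wheel: "balanced_check 8 15 8 double_wheel"
  by code_simp

theorem theorem3:
  "threshold_for_maker_win T_A (\<lambda>n. real n powr (- 5 / 9)) \<and>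
   threshold_for_maker_win T_C (\<lambda>n. real n powr (- 8 / 15))"
proof
  have d: "distinct K5_minus_edge" "\<forall>(i, j)\<in>set K5_minus_edge. i < j \<and> j < 5"
    by (simp_all add: K5_minus_edge_def)
  show "threshold_for_maker_win T_A (\<lambda>n. real n powr (- 5 / 9))"
    unfolding threshold_for_maker_win_def
  proof (intro allI impI conjI)
    fix p :: "nat \<Rightarrow> real" assume p: "\<forall>n. 0 \<le> p n \<and> p n \<le> 1"
    show "aas p (has_winning_strategy Maker T_A)" if "p \<in> \<omega>(\<lambda>n. real n powr (- 5 / 9))"
    proof (rule aas_mono)
      show "(\<lambda>n. measure_pmf.prob (gnp n (p n)) {E. \<exists>f. embeds K5_minus_edge 5 f E}) \<longlonglongrightarrow> 1"
        using p that by (intro embeds_aas[OF _ d(2,1) balanced_checkD[OF balanced_K5_minus_edge d(1)]]) auto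
    qed (auto intro: maker_strategy_T_A)
    show "aas p (has_winning_strategy Breaker T_A)" if "p \<in> o(\<lambda>n. real n powr (- 5 / 9))"
    proof (rule aas_mono)
      show "(\<lambda>n. measure_pmf.prob (gnp n (p n)) {E. sparse 5 9 15 E}) \<longlonglongrightarrow> 1"
        using p that by (intro sparse_aas) auto
    qed (rule breaker_strategy_T_A)
  qed
next
  have d: "distinct double_wheel" "\<forall>(i, j)\<in>set double_wheel. i < j \<and> j < 8"
    by (simp_all add: double_wheel_def)
  show "threshold_for_maker_win T_C (\<lambda>n. real n powr (- 8 / 15))"
    unfolding threshold_for_maker_win_def
  proof (intro allI impI conjI)
    fix p :: "nat \<Rightarrow> real" assume p: "\<forall>n. 0 \<le> p n \<and> p n \<le> 1"
    show "aas p (has_winning_strategy Maker T_C)" if "p \<in> \<omega>(\<lambda>n. real n powr (- 8 / 15))"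
    proof (rule aas_mono)
      show "(\<lambda>n. measure_pmf.prob (gnp n (p n)) {E. \<exists>f. embeds double_wheel 8 f E}) \<longlonglongrightarrow> 1"
        using p that by (intro embeds_aas[OF _ d(2,1) balanced_checkD[OF balanced_double_wheel d(1)]]) auto
    qed (auto intro: maker_strategy_T_C)
    show "aas p (has_winning_strategy Breaker T_C)" if "p \<in> o(\<lambda>n. real n powr (- 8 / 15))"
    proof (rule aas_mono)
      show "(\<lambda>n. measure_pmf.prob (gnp n (p n)) {E. sparse 8 15 24 E}) \<longlonglongrightarrow> 1"
        using p that by (intro sparse_aas) auto
    qed (rule breaker_strategy_T_C)
  qed
qed

end
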